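(* Let $\sigma_1,\sigma_2\in[0,1]$. Then $$\mathbb{E}[\operatorname{perim}K_{\sigma_1,\sigma_2}]=2\pi\Bigg[I_1\!\left(\tfrac1{\sigma_1},\tfrac1{\sigma_2}\right)+G\!\left(2(1-\sigma_2^2),\tfrac1{\sigma_1},\tfrac{1-2\sigma_2^2}{\sigma_2}\right)+G\!\left(2(1-\sigma_1^2),\tfrac1{\sigma_2},\tfrac{1-2\sigma_1^2}{\sigma_1}\right)-G\!\left(2(2-\sigma_1^2-\sigma_2^2),\tfrac{1-2\sigma_1^2}{\sigma_1},\tfrac{1-2\sigma_2^2}{\sigma_2}\right)\Bigg],$$ where, for $b,c\in(0,\infty)$, $$I_1(b,c)=\frac{1}{bc\sqrt{8\pi}}\left(b+c+\sqrt{b^2+c^2}\right),$$ and, for $a>0$ and $b,c\in\mathbb{R}$, $$G(a,b,c)=\frac{\sqrt\pi}{8\sqrt a}+\frac{1}{4\sqrt{\pi a}}\left(\arctan\frac{b}{\sqrt{2a}}+\arctan\frac{c}{\sqrt{2a}}+\arctan\frac{bc}{\sqrt{2a(2a+b^2+c^2)}}\right),$$ with the edge cases $\sigma_j\in\{0,1\}$ interpreted by the limiting conventions listed in the context.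
   Context: For $\sigma\in[0,1]$, a Gaussian-endpoint Brownian bridge with parameter $\sigma$ is a process $X(t)=B_t+\sigma tZ$, $0\le t\le1$, where $B$ is a standard planar ($\mathbb{R}^2$-valued) Brownian bridge from $0$ to $0$ on $[0,1]$ (continuous centered Gaussian, covariance $\mathbb{E}[B_sB_t^{T}]=(\min\{s,t\}-st)I$) and $Z\sim N(0,I)$ is a standard Gaussian vector in $\mathbb{R}^2$ independent of $B$. Let $X_1,X_2$ be independent such processes with parameters $\sigma_1,\sigma_2$, and let $K_{\sigma_1,\sigma_2}$ be the convex hull of $\{X_1(t):0\le t\le1\}\cup\{X_2(t):0\le t\le1\}$; $\operatorname{perim}$ denotes the perimeter of a compact convex planar set. Conventions for the edge cases. If $\sigma_j=0$, then $1/\sigma_j$ and $(1-2\sigma_j^2)/\sigma_j$ are read as $+\infty$, and $I_1$, $G$ at infinite arguments are read as the corresponding limits: $I_1(\infty,c)=I_1(c,\infty)=\frac{1}{c\sqrt{2\pi}}$, $I_1(\infty,\infty)=0$; for $a>0$, $G(a,b,\infty)=G(a,\infty,b)=\frac{\sqrt\pi}{4\sqrt a}+\frac1{2\sqrt{\pi a}}\arctan\frac{b}{\sqrt{2a}}$ and $G(a,\infty,\infty)=\frac{\sqrt\pi}{2\sqrt a}$. When the first argument of $G$ is $0$ (which happens only when some $\sigma_j=1$, and then at least one of the other two arguments is negative), $G$ is read as the limit $a\downarrow0$: for nonzero reals $b,c$ at least one of which is negative, $G(0,b,c)=\frac{-1}{bc\sqrt{8\pi}}\left(b+c+\sqrt{b^2+c^2}\right)$,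 and for $b<0$, $G(0,b,\infty)=G(0,\infty,b)=\frac{-1}{b\sqrt{2\pi}}$. (These values agree with $I_1(b,c)=\int_0^\infty(1-\Phi(bx)\Phi(cx))\,dx$ and $G(a,b,c)=\int_0^\infty e^{-ax^2}\Phi(bx)\Phi(cx)\,dx$, where $\Phi$ is the standard normal distribution function and $\Phi(\infty)=1$.) *)

theory Defs
  imports "HOL-Probability.Probability"
begin

subsection \<open>Gaussian processes, Brownian bridges\<close>

text \<open>The factor \<open>s\<close> may be \<open>0\<close>, so constants count as (degenerate) Gaussian variables.\<close>

definition gaussian_rv :: "'a measure \<Rightarrow> ('a \<Rightarrow> real) \<Rightarrow> bool" where
  "gaussian_rv M Y \<longleftrightarrow> Y \<in> borel_measurable M \<and>
     (\<exists>m s. distr M borel Y = distr std_normal_distribution borel (\<lambda>x. m + s * x))"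

text \<open>A process on \<open>[0,1]\<close> is a function of type \<open>real \<Rightarrow> 'a \<Rightarrow> real^2\<close> of which only the values
  at times in \<open>{0..1}\<close> matter.  Jointly Gaussian means that every finite linear combination of
  coordinates of values of the process is Gaussian.\<close>

definition gaussian_process :: "'a measure \<Rightarrow> (real \<Rightarrow> 'a \<Rightarrow> real^2) \<Rightarrow> bool" where
  "gaussian_process M B \<longleftrightarrow>
     (\<forall>t\<in>{0..1}. B t \<in> borel_measurable M) \<and>
     (\<forall>T c. finite T \<and> T \<subseteq> {0..1} \<longrightarrow> gaussian_rv M (\<lambda>\<omega>. \<Sum>t\<in>T. c t \<bullet> B t \<omega>))"

definition planar_brownian_bridge :: "'a measure \<Rightarrow> (real \<Rightarrow> 'a \<Rightarrow> real^2) \<Rightarrow> bool" where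
  "planar_brownian_bridge M B \<longleftrightarrow>
     gaussian_process M B \<and>
     (\<forall>\<omega>\<in>space M. continuous_on {0..1} (\<lambda>t. B t \<omega>)) \<and>
     (\<forall>t\<in>{0..1}. \<forall>i. (\<integral>\<omega>. B t \<omega> $ i \<partial>M) = 0) \<and>
     (\<forall>s\<in>{0..1}. \<forall>t\<in>{0..1}. \<forall>i j.
        (\<integral>\<omega>. B s \<omega> $ i * B t \<omega> $ j \<partial>M) = (if i = j then min s t - s * t else 0))"

definition std_gaussian_vector :: "'a measure \<Rightarrow> ('a \<Rightarrow> real^2) \<Rightarrow> bool" where
  "std_gaussian_vector M Z \<longleftrightarrow>
     distributed M lborel Z (\<lambda>z. ennreal (\<Prod>i\<in>UNIV. std_normal_density (z $ i)))"

abbreviation path_space :: "(real \<Rightarrow> real^2) measure" where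
  "path_space \<equiv> Pi\<^sub>M {0..1} (\<lambda>_. borel)"

definition path_rv :: "(real \<Rightarrow> 'a \<Rightarrow> real^2) \<Rightarrow> 'a \<Rightarrow> real \<Rightarrow> real^2" where
  "path_rv X \<omega> = (\<lambda>t\<in>{0..1}. X t \<omega>)"

text \<open>The library's \<open>indep_var\<close> requires both random variables to have the same value type,
  which fails for a path and a vector.\<close>

definition indep_rvs ::
    "'a measure \<Rightarrow> 'b measure \<Rightarrow> ('a \<Rightarrow> 'b) \<Rightarrow> 'c measure \<Rightarrow> ('a \<Rightarrow> 'c) \<Rightarrow> bool" where
  "indep_rvs M S X T Y \<longleftrightarrow> X \<in> measurable M S \<and> Y \<in> measurable M T \<and>
     prob_space.indep_set M
       {X -` A \<inter> space M | A. A \<in> sets S} {Y -` A \<inter> space M | A. A \<in> sets T}"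

definition gaussian_endpoint_bridge ::
    "'a measure \<Rightarrow> real \<Rightarrow> (real \<Rightarrow> 'a \<Rightarrow> real^2) \<Rightarrow> bool" where
  "gaussian_endpoint_bridge M \<sigma> X \<longleftrightarrow>
     (\<exists>B Z. planar_brownian_bridge M B \<and> std_gaussian_vector M Z \<and>
        indep_rvs M path_space (path_rv B) borel Z \<and>
        (\<forall>t\<in>{0..1}. \<forall>\<omega>\<in>space M. X t \<omega> = B t \<omega> + (\<sigma> * t) *\<^sub>R Z \<omega>))"

definition hull_of_paths ::
    "(real \<Rightarrow> 'a \<Rightarrow> real^2) \<Rightarrow> (real \<Rightarrow> 'a \<Rightarrow> real^2) \<Rightarrow> 'a \<Rightarrow> (real^2) set" where
  "hull_of_paths X Y \<omega> = convex hull ((\<lambda>t. X t \<omega>) ` {0..1} \<union> (\<lambda>t. Y t \<omega>) ` {0..1})"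

subsection \<open>Perimeter\<close>

definition cross2 :: "real^2 \<Rightarrow> real^2 \<Rightarrow> real" where
  "cross2 u v = u $ 1 * v $ 2 - u $ 2 * v $ 1"

text \<open>The list consists of the vertices of a convex polygon in counterclockwise order, no three
  of them on a line.  One point, and two points in either order, are allowed.\<close>

definition convex_polygon :: "(real^2) list \<Rightarrow> bool" where
  "convex_polygon ps \<longleftrightarrow> distinct ps \<and>
     (\<forall>i j k. i < j \<and> j < k \<and> k < length ps \<longrightarrow>
        cross2 (ps ! j - ps ! i) (ps ! k - ps ! i) > 0)"

definition polygon_length :: "(real^2) list \<Rightarrow> real" where
  "polygon_length ps = (\<Sum>i<length ps. dist (ps ! i) (ps ! (Suc i mod length ps)))"

text \<open>For compact convex \<open>K\<close> this is the length of the boundary curve: the supremum of the lengths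
  of the inscribed closed polygons, with vertices taken in cyclic order along the boundary.
  (Omitting a vertex that lies on the segment between its neighbours does not change the length,
  so strict convexity of the polygon loses nothing.)  A segment, which is its own frontier, gets
  twice its length, as usual in convex geometry; the empty set and a point get \<open>0\<close>.\<close>

definition perim :: "(real^2) set \<Rightarrow> real" where
  "perim K = Sup {polygon_length ps | ps. set ps \<subseteq> frontier K \<and> convex_polygon ps}"

subsection \<open>The functions \<open>I\<^sub>1\<close> and \<open>G\<close>\<close>

text \<open>The arguments \<open>b\<close>, \<open>c\<close> are real or \<open>\<infinity>\<close>; values at infinite arguments, and at \<open>a = 0\<close> for \<open>G\<close>,
  are the limits.  Where no such value is meant (an argument \<open>-\<infinity>\<close>, \<open>a < 0\<close>, or \<open>a = 0\<close> with neither
  of \<open>b\<close>, \<open>c\<close> negative) the result is meaningless; this does not occur for parameters in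
  \<open>[0,1]\<close>.\<close>

definition I1 :: "ereal \<Rightarrow> ereal \<Rightarrow> real" where
  "I1 b c =
    (if b = \<infinity> \<and> c = \<infinity> then 0
     else if b = \<infinity> then 1 / (real_of_ereal c * sqrt (2 * pi))
     else if c = \<infinity> then 1 / (real_of_ereal b * sqrt (2 * pi))
     else let b = real_of_ereal b; c = real_of_ereal c
          in 1 / (b * c * sqrt (8 * pi)) * (b + c + sqrt (b\<^sup>2 + c\<^sup>2)))"

definition G_pos :: "real \<Rightarrow> ereal \<Rightarrow> ereal \<Rightarrow> real" where
  "G_pos a b c =
    (if b = \<infinity> \<and> c = \<infinity> then sqrt pi / (2 * sqrt a)
     else if b = \<infinity> then
       sqrt pi / (4 * sqrt a) + 1 / (2 * sqrt (pi * a)) * arctan (real_of_ereal c / sqrt (2 * a))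
     else if c = \<infinity> then
       sqrt pi / (4 * sqrt a) + 1 / (2 * sqrt (pi * a)) * arctan (real_of_ereal b / sqrt (2 * a))
     else let b = real_of_ereal b; c = real_of_ereal c
          in sqrt pi / (8 * sqrt a) + 1 / (4 * sqrt (pi * a)) *
             (arctan (b / sqrt (2 * a)) + arctan (c / sqrt (2 * a))
              + arctan (b * c / sqrt (2 * a * (2 * a + b\<^sup>2 + c\<^sup>2)))))"

definition G_zero :: "ereal \<Rightarrow> ereal \<Rightarrow> real" where
  "G_zero b c =
    (if b = \<infinity> then - 1 / (real_of_ereal c * sqrt (2 * pi))
     else if c = \<infinity> then - 1 / (real_of_ereal b * sqrt (2 * pi))
     else let b = real_of_ereal b; c = real_of_ereal c
          in - 1 / (b * c * sqrt (8 * pi)) * (b + c + sqrt (b\<^sup>2 + c\<^sup>2)))"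

definition G :: "real \<Rightarrow> ereal \<Rightarrow> ereal \<Rightarrow> real" where
  "G a b c = (if a = 0 then G_zero b c else G_pos a b c)"

text \<open>The quotient \<open>p / s\<close>, read as \<open>\<infinity>\<close> if \<open>s = 0\<close> (it is used only where then \<open>p = 1\<close>).\<close>

definition quot :: "real \<Rightarrow> real \<Rightarrow> ereal" where
  "quot p s = (if s = 0 then \<infinity> else ereal (p / s))"

end

theory Submission
  imports Defs "HOL-Real_Asymp.Real_Asymp"
begin

text \<open>By Cauchy's formula the perimeter of \<open>K\<close> is the integral over all directions \<open>u\<close> of the support
  function \<open>h u\<close>, the maximum of \<open>x \<bullet> u\<close> on \<open>K\<close>.  For the hull of the two paths, \<open>h u\<close> is the
  larger of the maxima of two independent one-dimensional processes, so its mean does not depend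
  on \<open>u\<close> and equals \<open>\<integral> (1 - F\<^sub>1 x F\<^sub>2 x) dx\<close> over \<open>x > 0\<close>, where \<open>F\<^sub>j\<close> is the distribution
  function of the \<open>j\<close>-th maximum.  Given its endpoint \<open>y < x\<close>, a Brownian bridge stays below \<open>x\<close>
  with probability \<open>1 - exp (- 2 x (x - y))\<close>, by optional stopping of an exponential martingale.
  Averaging over the Gaussian endpoint gives
  \<open>F\<^sub>j x = \<Phi>(x / \<sigma>\<^sub>j) - exp (- 2 (1 - \<sigma>\<^sub>j\<^sup>2) x\<^sup>2) \<Phi>((1 - 2 \<sigma>\<^sub>j\<^sup>2) x / \<sigma>\<^sub>j)\<close>, and expanding the product
  yields the four integrals \<open>I\<^sub>1\<close> and \<open>G\<close>.\<close>

subsection \<open>Cauchy's formula for the perimeter\<close>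

text \<open>The perimeter is a supremum over inscribed strictly convex polygons, so Cauchy's formula
  is at heart a statement about polygons: projected to a line, a convex polygon covers its range
  exactly twice, and an edge \<open>v\<close> contributes \<open>4 * norm v\<close> when its
  projected length is integrated over all directions. The bridge is given only by its Gaussian
  linear combinations and covariances; independence of increments, on which the martingale rests,
  has to be extracted from characteristic functions. Stopping takes place on dyadic grids, and path
  continuity removes the overshoot in the limit. The exponent 2 x (x - y) comes from the barrier x +
  \<mu> s with \<mu> = x - y: for a Brownian motion W, exp (2 \<mu> (W s - \<mu> s)) has mean 1, and
  it equals exp (2 \<mu> x) on the barrier. Averaging exp (2 x \<sigma> v) over a standard normal v
  multiplies by exp (2 \<sigma>^2 x^2) and shifts the argument of \<Phi> by 2 \<sigma> x, whence 1 -
  \<sigma>^2 and 1 - 2 \<sigma>^2. Only x > 0 enters the mean because the paths start at 0 almost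
  surely, which makes the support function nonnegative.\<close>

lemma detour:
  fixes a b c L U :: real
  assumes "min U c \<le> max a b" "min a b \<le> max L c" "a \<le> U" "L \<le> a" "b \<le> U" "L \<le> b"
  shows "\<bar>c - b\<bar> + \<bar>c - a\<bar> - \<bar>b - a\<bar> \<le> 2 * (max c U - U) + 2 * (L - min c L)"
proof -
  \<comment> \<open>A detour from \<open>a\<close> to \<open>b\<close> through \<open>c\<close>
    costs twice the distance by which \<open>c\<close> leaves the interval between them. The first
    two assumptions bound that distance by the amount by which \<open>c\<close> enlarges
    \<open>[L, U]\<close>: if \<open>c\<close> exceeds \<open>U\<close>, then \<open>U\<close> must
    be \<open>max a b\<close>, and dually for \<open>L\<close>.\<close>
  have "\<bar>c - b\<bar> + \<bar>c - a\<bar> - \<bar>b - a\<bar> = 2 * max 0 (c - max a b) + 2 * max 0 (min a b - c)"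
    by (cases "a \<le> b"; cases "c \<le> a"; cases "c \<le> b"; simp add: max_def min_def abs_if)
  moreover have "max 0 (c - max a b) \<le> max c U - U"
    using assms(1,3,5) by (cases "c \<le> U"; simp add: max_def min_def split: if_splits)
  moreover have "max 0 (min a b - c) \<le> L - min c L"
    using assms(2,4,6) by (cases "c \<le> L"; simp add: max_def min_def split: if_splits)
  moreover have "x \<le> 2 * r + 2 * s" if "x = 2 * p + 2 * q" "p \<le> r" "q \<le> s" for x p q r s :: real
    using that by linarith
  ultimately show ?thesis by blast
qed

text \<open>Induction on the number of vertices: the new vertex is inserted between
  \<open>f n\<close> and \<open>f 0\<close>, and \<open>detour\<close> bounds the added length by
  twice the growth of the range. The maximum and minimum so far are values \<open>f j\<close> and
  \<open>f k\<close>, so only the quadrilaterals with vertices 0, \<open>j\<close>,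
  \<open>k\<close>, \<open>Suc k\<close> are needed; the assumption compares their two
  diagonals.\<close>

lemma closed_path_upper:
  fixes f :: "nat \<Rightarrow> real"
  assumes "\<And>j k. \<lbrakk>0 < j; j < k; k < n\<rbrakk> \<Longrightarrow>
      min (f j) (f (Suc k)) \<le> max (f 0) (f k) \<and> min (f 0) (f k) \<le> max (f j) (f (Suc k))"
  shows "(\<Sum>i<n. \<bar>f (Suc i) - f i\<bar>) + \<bar>f n - f 0\<bar> \<le> 2 * (Max (f ` {..n}) - Min (f ` {..n}))"
  using assms
proof (induction n)
  case 0
  then show ?case by simp
next
  case (Suc n)
  define U where "U = Max (f ` {..n})"
  define L where "L = Min (f ` {..n})"
  have IH: "(\<Sum>i<n. \<bar>f (Suc i) - f i\<bar>) + \<bar>f n - f 0\<bar> \<le> 2 * (U - L)"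
    unfolding U_def L_def by (rule Suc.IH) (use Suc.prems in simp)
  have range: "f ` {..Suc n} = insert (f (Suc n)) (f ` {..n})"
    by (auto simp: atMost_Suc)
  have U': "Max (f ` {..Suc n}) = max (f (Suc n)) U" and L': "Min (f ` {..Suc n}) = min (f (Suc n)) L"
    unfolding range U_def L_def by (simp_all del: image_Suc_atMost)
  have "U \<in> f ` {..n}" unfolding U_def by (intro Max_in) auto
  then obtain j where j: "j \<le> n" "U = f j" by blast
  have "L \<in> f ` {..n}" unfolding L_def by (intro Min_in) auto
  then obtain k where k: "k \<le> n" "L = f k" by blast
  have bounds: "f i \<le> U" "L \<le> f i" if "i \<le> n" for i
    using that by (auto simp: U_def L_def)
  have b0: "f 0 \<le> U" "L \<le> f 0" "f n \<le> U" "L \<le> f n" using bounds by auto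
  have 1: "min U (f (Suc n)) \<le> max (f 0) (f n)"
  proof (cases "j = 0 \<or> j = n")
    case True then show ?thesis using j by auto
  next
    case False then show ?thesis using Suc.prems[of j n] j by auto
  qed
  have 2: "min (f 0) (f n) \<le> max L (f (Suc n))"
  proof (cases "k = 0 \<or> k = n")
    case True then show ?thesis using k by auto
  next
    case False then show ?thesis using Suc.prems[of k n] k by auto
  qed
  have "\<bar>f (Suc n) - f n\<bar> + \<bar>f (Suc n) - f 0\<bar> - \<bar>f n - f 0\<bar>
      \<le> 2 * (max (f (Suc n)) U - U) + 2 * (L - min (f (Suc n)) L)"
    using 1 2 b0 by (rule detour)
  then show ?case using IH unfolding U' L' by simp
qed

lemma path_lower:
  fixes f :: "nat \<Rightarrow> real"
  assumes "i \<le> j"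
  shows "\<bar>f j - f i\<bar> \<le> (\<Sum>k=i..<j. \<bar>f (Suc k) - f k\<bar>)"
  using assms
proof (induction j rule: dec_induct)
  case (step n)
  then show ?case by (simp add: sum.atLeastLessThan_Suc)
qed simp

text \<open>An index of the minimum and an index of the maximum cut the closed path into two arcs,
  and each of them is at least as long as the difference of the two values.\<close>

lemma closed_path_lower:
  fixes f :: "nat \<Rightarrow> real"
  shows "2 * (Max (f ` {..n}) - Min (f ` {..n})) \<le> (\<Sum>i<n. \<bar>f (Suc i) - f i\<bar>) + \<bar>f n - f 0\<bar>"
proof -
  have *: "2 * \<bar>f j - f i\<bar> \<le> (\<Sum>i<n. \<bar>f (Suc i) - f i\<bar>) + \<bar>f n - f 0\<bar>" if "i \<le> j" "j \<le> n" for i j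
  proof -
    let ?d = "\<lambda>k. \<bar>f (Suc k) - f k\<bar>"
    have "(\<Sum>k<n. ?d k) = sum ?d {0..<i} + sum ?d {i..<j} + sum ?d {j..<n}"
      using that by (simp add: lessThan_atLeast0 sum.atLeastLessThan_concat)
    note S = this
    have le: "\<bar>f i - f 0\<bar> \<le> sum ?d {0..<i}" "\<bar>f j - f i\<bar> \<le> sum ?d {i..<j}" "\<bar>f n - f j\<bar> \<le> sum ?d {j..<n}"
      using that by (auto intro: path_lower)
    have tri: "\<bar>f j - f i\<bar> \<le> \<bar>f n - f j\<bar> + \<bar>f n - f 0\<bar> + \<bar>f i - f 0\<bar>"
      using abs_triangle_ineq[of "f j - f n" "f n - f i"] abs_triangle_ineq[of "f n - f 0" "f 0 - f i"]
      by (simp add: abs_minus_commute)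
    have "2 * x \<le> S + w"
      if "S = A + B + C" "y \<le> A" "x \<le> B" "z \<le> C" "x \<le> z + w + y" for S A B C w x y z :: real
      using that by linarith
    from this[OF S le tri] show ?thesis .
  qed
  have "Max (f ` {..n}) \<in> f ` {..n}" by (intro Max_in) auto
  then obtain j where j: "j \<le> n" "Max (f ` {..n}) = f j" by blast
  have "Min (f ` {..n}) \<in> f ` {..n}" by (intro Min_in) auto
  then obtain i where i: "i \<le> n" "Min (f ` {..n}) = f i" by blast
  show ?thesis
  proof (cases "i \<le> j")
    case True
    show ?thesis unfolding i(2) j(2)
      by (rule order_trans[OF mult_left_mono[OF abs_ge_self] *[OF True j(1)]]) simp
  next
    case False
    then have "2 * \<bar>f j - f i\<bar> \<le> (\<Sum>i<n. \<bar>f (Suc i) - f i\<bar>) + \<bar>f n - f 0\<bar>"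
      using *[of j i] i(1) by (simp add: abs_minus_commute[of "f j" "f i"])
    from order_trans[OF mult_left_mono[OF abs_ge_self] this] show ?thesis unfolding i(2) j(2) by simp
  qed
qed

text \<open>The two diagonals of a quadrilateral meet in a point whose barycentric weights are areas of
  triangles spanned by the vertices.  So a linear functional cannot be larger at both ends of
  one diagonal than at both ends of the other, and a convex polygon is traversed by it
  unimodally.\<close>

lemma cross2_diagonals:
  fixes a b c d :: "real^2"
  shows "cross2 (c - b) (d - b) *\<^sub>R a + cross2 (b - a) (d - a) *\<^sub>R c
       = cross2 (c - a) (d - a) *\<^sub>R b + cross2 (b - a) (c - a) *\<^sub>R d"
    and "cross2 (c - b) (d - b) + cross2 (b - a) (d - a)
       = cross2 (c - a) (d - a) + cross2 (b - a) (c - a)"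
  by (simp_all add: cross2_def vec_eq_iff forall_2 algebra_simps)

text \<open>The total weights agree, hence so do the two weighted means; the first is at most
  \<open>max a c\<close> and the second at least \<open>min b d\<close>.\<close>

lemma weighted_avg_le:
  fixes A B C D a b c d :: real
  assumes "A > 0" "B > 0" "C > 0" "D > 0" "A + C = B + D" "A * a + C * c = B * b + D * d"
  shows "min b d \<le> max a c"
proof (rule ccontr)
  assume "\<not> ?thesis"
  then have "max a c < min b d" by (simp only: not_le)
  have "A * a + C * c \<le> (A + C) * max a c"
    using assms(1,3) by (simp only: distrib_right) (intro add_mono mult_left_mono, auto)
  also have "\<dots> < (B + D) * min b d"
    using \<open>max a c < min b d\<close> assms by (simp add: mult_strict_left_mono)
  also have "\<dots> \<le> B * b + D * d"
    using assms(2,4) by (simp only: distrib_right) (intro add_mono mult_left_mono, auto)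
  finally show False using assms by simp
qed

lemma convex_polygon_quadrilateral:
  assumes "convex_polygon ps" "i < j" "j < k" "k < l" "l < length ps"
  shows "min (ps ! j \<bullet> u) (ps ! l \<bullet> u) \<le> max (ps ! i \<bullet> u) (ps ! k \<bullet> u)"
    and "min (ps ! i \<bullet> u) (ps ! k \<bullet> u) \<le> max (ps ! j \<bullet> u) (ps ! l \<bullet> u)"
proof -
  have pos: "cross2 (ps ! j - ps ! i) (ps ! k - ps ! i) > 0" if "i < j" "j < k" "k < length ps" for i j k
    using assms(1) that unfolding convex_polygon_def by blast
  define A where "A = cross2 (ps!k - ps!j) (ps!l - ps!j)"
  define B where "B = cross2 (ps!k - ps!i) (ps!l - ps!i)"
  define C where "C = cross2 (ps!j - ps!i) (ps!l - ps!i)"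
  define D where "D = cross2 (ps!j - ps!i) (ps!k - ps!i)"
  have "A > 0" "B > 0" "C > 0" "D > 0"
    unfolding A_def B_def C_def D_def using assms by (auto intro!: pos)
  note pos' = this
  have sum: "A + C = B + D" unfolding A_def B_def C_def D_def by (rule cross2_diagonals)
  have "A *\<^sub>R ps!i + C *\<^sub>R ps!k = B *\<^sub>R ps!j + D *\<^sub>R ps!l"
    unfolding A_def B_def C_def D_def by (rule cross2_diagonals)
  then have comb: "A * (ps!i \<bullet> u) + C * (ps!k \<bullet> u) = B * (ps!j \<bullet> u) + D * (ps!l \<bullet> u)"
    by (drule_tac arg_cong[where f = "\<lambda>x. x \<bullet> u"]) (simp add: inner_add_left)
  show "min (ps ! j \<bullet> u) (ps ! l \<bullet> u) \<le> max (ps ! i \<bullet> u) (ps ! k \<bullet> u)"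
    and "min (ps ! i \<bullet> u) (ps ! k \<bullet> u) \<le> max (ps ! j \<bullet> u) (ps ! l \<bullet> u)"
    using weighted_avg_le[OF pos'(1,2,3,4) sum comb]
      weighted_avg_le[OF pos'(2,1,4,3) sum[symmetric] comb[symmetric]] by this
qed

text \<open>The upper and the lower bound for closed paths meet: the projection of the polygon runs
  through its range exactly twice. One or two vertices are included, where no quadrilateral has to
  be checked.\<close>

lemma convex_polygon_projection:
  assumes "convex_polygon ps" "length ps = Suc n"
  shows "(\<Sum>i<n. \<bar>(ps ! Suc i - ps ! i) \<bullet> u\<bar>) + \<bar>(ps ! n - ps ! 0) \<bullet> u\<bar>
    = 2 * (Max ((\<lambda>x. x \<bullet> u) ` set ps) - Min ((\<lambda>x. x \<bullet> u) ` set ps))"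
proof -
  define f where "f = (\<lambda>i. ps ! i \<bullet> u)"
  have "f ` {..n} = (\<lambda>x. x \<bullet> u) ` (!) ps ` {..n}" by (auto simp: f_def)
  also have "(!) ps ` {..n} = set ps"
    using assms(2) by (auto simp: set_conv_nth less_Suc_eq_le)
  finally have img: "f ` {..n} = (\<lambda>x. x \<bullet> u) ` set ps" .
  have "(\<Sum>i<n. \<bar>f (Suc i) - f i\<bar>) + \<bar>f n - f 0\<bar> \<le> 2 * (Max (f ` {..n}) - Min (f ` {..n}))"
    by (rule closed_path_upper)
       (use convex_polygon_quadrilateral[OF assms(1), of 0 _ _ _ u] assms(2) in \<open>auto simp: f_def\<close>)
  then have "(\<Sum>i<n. \<bar>f (Suc i) - f i\<bar>) + \<bar>f n - f 0\<bar> = 2 * (Max (f ` {..n}) - Min (f ` {..n}))"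
    using closed_path_lower[where f = f] by (intro antisym)
  then show ?thesis unfolding img by (simp add: f_def inner_diff_left)
qed

lemma polygon_length_Suc:
  assumes "length ps = Suc n"
  shows "polygon_length ps = (\<Sum>i<n. dist (ps ! i) (ps ! Suc i)) + dist (ps ! n) (ps ! 0)"
proof -
  have "(\<Sum>i<n. dist (ps ! i) (ps ! (Suc i mod Suc n))) = (\<Sum>i<n. dist (ps ! i) (ps ! Suc i))"
    by (rule sum.cong) auto
  then show ?thesis unfolding polygon_length_def assms by simp
qed

section \<open>Convex polygons from finite point sets\<close>

text \<open>The angular order is total and transitive only on points seen from the pole in a half
  plane, so the assumptions are restricted to \<open>A\<close>. A new element is placed between the
  elements related to it and the others.\<close>

lemma finite_sorted_wrt_list:
  assumes "finite A"
    and "\<And>x y. \<lbrakk>x \<in> A; y \<in> A; x \<noteq> y\<rbrakk> \<Longrightarrow> R x y \<or> R y x"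
    and "\<And>x y z. \<lbrakk>x \<in> A; y \<in> A; z \<in> A; R x y; R y z\<rbrakk> \<Longrightarrow> R x z"
  shows "\<exists>xs. set xs = A \<and> distinct xs \<and> sorted_wrt R xs"
  using assms
proof (induction A rule: finite_induct)
  case (insert a A)
  have tot: "\<And>x y. \<lbrakk>x \<in> insert a A; y \<in> insert a A; x \<noteq> y\<rbrakk> \<Longrightarrow> R x y \<or> R y x"
    and tr: "\<And>x y z. \<lbrakk>x \<in> insert a A; y \<in> insert a A; z \<in> insert a A; R x y; R y z\<rbrakk> \<Longrightarrow> R x z"
    by (fact insert.prems)+
  have "\<exists>xs. set xs = A \<and> distinct xs \<and> sorted_wrt R xs"
  proof (rule insert.IH)
    show "R x y \<or> R y x" if "x \<in> A" "y \<in> A" "x \<noteq> y" for x y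
      using that by (intro tot) auto
    show "R x z" if "x \<in> A" "y \<in> A" "z \<in> A" "R x y" "R y z" for x y z
      using that by (intro tr[of x y z]) auto
  qed
  then obtain xs where xs: "set xs = A" "distinct xs" "sorted_wrt R xs"
    by blast
  let ?ys = "filter (\<lambda>x. R x a) xs @ a # filter (\<lambda>x. \<not> R x a) xs"
  have 1: "R a y" if "y \<in> A" "\<not> R y a" for y
    using tot[of a y] that insert.hyps by auto
  have 2: "R x y" if "x \<in> A" "R x a" "y \<in> A" "\<not> R y a" for x y
    using tot[of a y] tr[of x a y] that insert.hyps by auto
  have "sorted_wrt R ?ys"
    unfolding sorted_wrt_append sorted_wrt.simps
  proof (intro conjI ballI sorted_wrt_filter xs(3))
    show "R a y" if "y \<in> set (filter (\<lambda>x. \<not> R x a) xs)" for y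
    proof -
      have "y \<in> A" "\<not> R y a" using that xs(1) by simp_all
      then show ?thesis by (rule 1)
    qed
    show "R x y" if "x \<in> set (filter (\<lambda>x. R x a) xs)" "y \<in> set (a # filter (\<lambda>x. \<not> R x a) xs)" for x y
    proof (cases "y = a")
      case False
      then have "x \<in> A" "R x a" "y \<in> A" "\<not> R y a" using that xs(1) by simp_all
      then show ?thesis by (rule 2)
    next
      case True
      then show ?thesis using that(1) by simp
    qed
  qed
  moreover have "set ?ys = insert a A" using xs(1) by (auto simp del: insert_iff)
  moreover have "distinct ?ys" using xs(1,2) insert.hyps(2) by auto
  ultimately show ?case by blast
next
  case empty
  show ?case by (rule exI[of _ "[]"]) simp
qed

text \<open>Extremality in the large hull passes to the triangle inside it, whose extreme points are
  among its three vertices. Coordinates are relative to \<open>p\<close>, the future pole of the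
  angular order; \<open>a = c\<close> covers points on a segment from \<open>p\<close>.\<close>

lemma extreme_not_in_triangle:
  fixes V :: "(real^2) set"
  assumes "b extreme_point_of (convex hull V)" "p \<in> V" "p + a \<in> V" "p + c \<in> V" 
    and "b = p + \<alpha> *\<^sub>R a + \<gamma> *\<^sub>R c" "\<alpha> \<ge> 0" "\<gamma> \<ge> 0" "\<alpha> + \<gamma> \<le> 1" 
  shows "b \<in> {p, p + a, p + c}"
proof -
  have "b = (1 - \<alpha> - \<gamma>) *\<^sub>R p + \<alpha> *\<^sub>R (p + a) + \<gamma> *\<^sub>R (p + c)"
    using assms(5) by (simp add: algebra_simps)
  then have b: "b \<in> convex hull {p, p + a, p + c}"
    unfolding convex_hull_3 mem_Collect_eq using assms(6-8)
    by (intro exI[of _ "1-\<alpha>-\<gamma>"] exI[of _ \<alpha>] exI[of _ \<gamma>]) simp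
  have sub: "convex hull {p, p + a, p + c} \<subseteq> convex hull V"
    using assms(2-4) by (intro hull_mono) auto
  have "b extreme_point_of (convex hull {p, p + a, p + c})"
    unfolding extreme_point_of_def
  proof (intro conjI ballI b)
    fix x y assume "x \<in> convex hull {p, p + a, p + c}" "y \<in> convex hull {p, p + a, p + c}"
    then have "x \<in> convex hull V" "y \<in> convex hull V" using sub by (auto intro: subsetD)
    then show "b \<notin> open_segment x y" using assms(1) by (simp add: extreme_point_of_def)
  qed
  then show ?thesis by (rule extreme_point_of_convex_hull)
qed

text \<open>The vertices are the extreme points of the hull, ordered by angle around the
  lexicographically least of them, from which all others are seen in an open half plane
  (together with one boundary ray).\<close>

lemma finite_hull_convex_polygon:
  fixes S :: "(real^2) set"
  assumes "finite S" "S \<noteq> {}"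
  shows "\<exists>ps. convex_polygon ps \<and> ps \<noteq> [] \<and> set ps \<subseteq> S \<and> S \<subseteq> convex hull (set ps)"
proof -
  define V where "V = {x. x extreme_point_of (convex hull S)}"
  have VS: "V \<subseteq> S" unfolding V_def using extreme_point_of_convex_hull by blast
  have fin: "finite V" using VS assms finite_subset by blast
  have hull: "convex hull S = convex hull V"
    unfolding V_def by (rule Krein_Milman_polytope[OF assms(1)])
  have ext: "b extreme_point_of (convex hull V)" if "b \<in> V" for b
    using that unfolding hull[symmetric] by (simp add: V_def)
  have "V \<noteq> {}" using hull assms by auto
  define m where "m = Min ((\<lambda>x. x $ 1) ` V)"
  have "m \<in> (\<lambda>x. x $ 1) ` V" unfolding m_def using fin \<open>V \<noteq> {}\<close> by (intro Min_in) auto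
  define V1 where "V1 = {x \<in> V. x $ 1 = m}"
  have "V1 \<noteq> {}" "finite V1" using \<open>m \<in> _\<close> fin by (auto simp: V1_def)
  obtain p where p: "p \<in> V1" "p $ 2 = Min ((\<lambda>x. x $ 2) ` V1)"
    using Min_in[of "(\<lambda>x. x $ 2) ` V1"] \<open>V1 \<noteq> {}\<close> \<open>finite V1\<close> by fastforce
  have pV: "p \<in> V" using p by (simp add: V1_def)
  have lex: "p $ 1 < x $ 1 \<or> (p $ 1 = x $ 1 \<and> p $ 2 < x $ 2)" if "x \<in> V" "x \<noteq> p" for x
  proof -
    have "m \<le> x $ 1" unfolding m_def using fin that by auto
    moreover have "p $ 2 \<le> x $ 2" if "x $ 1 = m"
      using p(2) that \<open>x \<in> V\<close> \<open>finite V1\<close> by (simp add: V1_def)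
    moreover have "p $ 1 = m" using p by (simp add: V1_def)
    ultimately show ?thesis using that by (auto simp: vec_eq_iff forall_2 less_le)
  qed
  define R where "R = (\<lambda>x y. cross2 (x - p) (y - p) > 0)"
  let ?A = "V - {p}"
  \<comment> \<open>Two points at the same angle differ from \<open>p\<close> by positive multiples
    of one vector, because all directions from \<open>p\<close> lie in a half plane that contains no
    opposite pair. The nearer point is then on the segment from \<open>p\<close> to the farther one
    and cannot be extreme.\<close>
  have tot: "R x y \<or> R y x" if "x \<in> ?A" "y \<in> ?A" "x \<noteq> y" for x y
  proof (rule ccontr)
    assume "\<not> ?thesis"
    then have "cross2 (x - p) (y - p) = 0" by (simp add: R_def cross2_def algebra_simps)
    define a where "a = x - p" define c where "c = y - p"
    have c0: "a$1 * c$2 = a$2 * c$1" using \<open>cross2 _ _ = 0\<close> by (simp add: a_def c_def cross2_def)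
    have la: "0 < a$1 \<or> (a$1 = 0 \<and> 0 < a$2)" and lc: "0 < c$1 \<or> (c$1 = 0 \<and> 0 < c$2)"
      using lex[of x] lex[of y] that by (auto simp: a_def c_def)
    have "\<exists>r>0. a = r *\<^sub>R c"
    proof (cases "c$1 = 0")
      case True
      then have "0 < c$2" "a$1 = 0" using lc c0 by auto
      then show ?thesis using True la
        by (intro exI[of _ "a$2 / c$2"]) (auto simp: vec_eq_iff forall_2)
    next
      case False
      then have "0 < c$1" using lc by auto
      moreover have "a $ 1 \<noteq> 0" using c0 False la by auto
      ultimately show ?thesis using la c0
        by (intro exI[of _ "a$1 / c$1"]) (auto simp: vec_eq_iff forall_2 field_simps)
    qed
    then obtain r where r: "r > 0" "a = r *\<^sub>R c" by blast
    have xy: "x = p + a" "y = p + c" by (simp_all add: a_def c_def)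
    show False
    proof (cases "r \<le> 1")
      case True
      have "x \<in> {p, p + c, p + c}"
      proof (rule extreme_not_in_triangle[OF ext pV])
        show "x \<in> V" "p + c \<in> V" "p + c \<in> V" using that by (simp_all add: c_def)
        show "x = p + r *\<^sub>R c + 0 *\<^sub>R c" unfolding xy(1) r(2) by simp
      qed (use r True in auto)
      then show ?thesis using that by (simp add: c_def)
    next
      case False
      have "y \<in> {p, p + a, p + a}"
      proof (rule extreme_not_in_triangle[OF ext pV])
        show "y \<in> V" "p + a \<in> V" "p + a \<in> V" using that by (simp_all add: a_def)
        show "y = p + inverse r *\<^sub>R a + 0 *\<^sub>R a" unfolding xy(2) r(2) using r(1) by simp
        show "0 \<le> inverse r" "inverse r + 0 \<le> 1" using False r(1) by (simp_all add: field_simps)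
      qed simp
      then show ?thesis using that by (simp add: a_def)
    qed
  qed
  have tr: "R x z" if "x \<in> ?A" "y \<in> ?A" "z \<in> ?A" "R x y" "R y z" for x y z
  proof -
    define a where "a = x - p" define b where "b = y - p" define c where "c = z - p"
    have la: "0 < a$1 \<or> (a$1 = 0 \<and> 0 < a$2)" and lb: "0 < b$1 \<or> (b$1 = 0 \<and> 0 < b$2)" and lc: "0 < c$1 \<or> (c$1 = 0 \<and> 0 < c$2)"
      using lex[of x] lex[of y] lex[of z] that by (auto simp: a_def b_def c_def)
    have ab: "cross2 a b > 0" and bc: "cross2 b c > 0" using that by (auto simp: R_def a_def b_def c_def)
    \<comment> \<open>The first coordinate of Cramer's rule for writing \<open>b\<close> through
      \<open>a\<close> and \<open>c\<close>. The half plane makes the first coordinates nonnegative,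
      so the right-hand side is positive once \<open>b$1\<close> is.\<close>
    have id: "b$1 * cross2 a c = c$1 * cross2 a b + a$1 * cross2 b c"
      by (simp add: cross2_def algebra_simps)
    have "cross2 a c > 0"
    proof (cases "b$1 > 0")
      case True
      have "0 \<le> c$1" "0 \<le> a$1" using la lc by auto
      moreover have "c$1 > 0 \<or> a$1 > 0"
      proof (rule ccontr)
        assume "\<not> ?thesis"
        then have "a$1 = 0" "c$1 = 0" "a$2 > 0" using la lc by auto
        then have "cross2 a b < 0" using True by (simp add: cross2_def)
        then show False using ab by simp
      qed
      ultimately have "b$1 * cross2 a c > 0"
        unfolding id using ab bc by (auto intro: add_nonneg_pos add_pos_nonneg)
      then show ?thesis using True by (simp add: zero_less_mult_iff)
    next
      case False
      then have b: "b$1 = 0" "b$2 > 0" using lb by auto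
      then have "c$1 < 0" using bc by (auto simp: cross2_def mult_less_0_iff)
      then show ?thesis using lc by auto
    qed
    then show ?thesis by (simp add: R_def a_def c_def)
  qed
  obtain xs where xs: "set xs = ?A" "distinct xs" "sorted_wrt R xs"
    using finite_sorted_wrt_list[of ?A R] fin tot tr by blast
  let ?ps = "p # xs"
  have "cross2 (?ps ! j - ?ps ! i) (?ps ! k - ?ps ! i) > 0" if ijk: "i < j" "j < k" "k < length ?ps" for i j k
  proof (cases i)
    case 0
    obtain j' k' where "j = Suc j'" "k = Suc k'" using ijk by (metis less_imp_Suc_add)
    then show ?thesis using 0 ijk sorted_wrt_nth_less[OF xs(3), of j' k'] by (simp add: R_def)
  next
    case (Suc i')
    obtain j' k' where jk: "j = Suc j'" "k = Suc k'" using ijk by (metis less_imp_Suc_add)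
    define a where "a = xs ! i' - p" define b where "b = xs ! j' - p" define c where "c = xs ! k' - p"
    have mem: "p + a \<in> ?A" "p + b \<in> ?A" "p + c \<in> ?A"
      using ijk jk Suc nth_mem[of _ xs] unfolding xs(1)[symmetric] by (auto simp: a_def b_def c_def)
    have "cross2 a b > 0" "cross2 b c > 0" "cross2 a c > 0"
      using ijk jk Suc sorted_wrt_nth_less[OF xs(3)] by (auto simp: R_def a_def b_def c_def)
    have "cross2 (b - a) (c - a) > 0"
    proof (rule ccontr)
      assume "\<not> ?thesis"
      then have le: "cross2 a b + cross2 b c \<le> cross2 a c" by (simp add: cross2_def algebra_simps)
      \<comment> \<open>If the triangle \<open>a\<close>, \<open>b\<close>, \<open>c\<close> is not
        positively oriented, Cramer's rule gives \<open>b\<close> nonnegative coefficients of sum at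
        most 1, which puts the extreme point \<open>p + b\<close> into the triangle
        \<open>p\<close>, \<open>p + a\<close>, \<open>p + c\<close>.\<close>
      define \<alpha> where "\<alpha> = cross2 b c / cross2 a c" define \<gamma> where "\<gamma> = cross2 a b / cross2 a c"
      have "cross2 a c *\<^sub>R b = cross2 b c *\<^sub>R a + cross2 a b *\<^sub>R c"
        by (simp add: cross2_def vec_eq_iff forall_2 algebra_simps)
      then have "b = (1 / cross2 a c) *\<^sub>R (cross2 b c *\<^sub>R a + cross2 a b *\<^sub>R c)"
        using \<open>cross2 a c > 0\<close> by (simp flip: \<open>cross2 a c *\<^sub>R b = _\<close>)
      then have "b = \<alpha> *\<^sub>R a + \<gamma> *\<^sub>R c"
        by (simp add: \<alpha>_def \<gamma>_def scaleR_add_right)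
      then have "p + b = p + \<alpha> *\<^sub>R a + \<gamma> *\<^sub>R c" by simp
      moreover have "\<alpha> \<ge> 0" "\<gamma> \<ge> 0" "\<alpha> + \<gamma> \<le> 1"
        using le \<open>cross2 a b > 0\<close> \<open>cross2 b c > 0\<close> \<open>cross2 a c > 0\<close> by (auto simp: \<alpha>_def \<gamma>_def field_simps)
      ultimately have "p + b \<in> {p, p + a, p + c}"
        using mem pV ext by (intro extreme_not_in_triangle) auto
      then have "cross2 a b = 0 \<or> cross2 b c = 0" by (auto simp: cross2_def)
      then show False using \<open>cross2 a b > 0\<close> \<open>cross2 b c > 0\<close> by auto
    qed
    then show ?thesis using jk Suc by (simp add: a_def b_def c_def)
  qed
  moreover have "distinct ?ps" using xs by auto
  ultimately have "convex_polygon ?ps" unfolding convex_polygon_def by blast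
  moreover have set: "set ?ps = V" using xs pV by auto
  moreover have "S \<subseteq> convex hull (set ?ps)"
    unfolding set using hull_subset[of S convex] by (simp only: hull)
  ultimately show ?thesis using VS by (intro exI[of _ ?ps]) (simp only: simp_thms list.distinct)
qed

section \<open>Support functions and integration over directions\<close>

definition direction :: "real \<Rightarrow> real^2" where
  "direction \<theta> = vector [cos \<theta>, sin \<theta>]"

definition support :: "(real^2) set \<Rightarrow> real^2 \<Rightarrow> real" where
  "support K u = (SUP x\<in>K. x \<bullet> u)"

lemma inner_direction: "x \<bullet> direction \<theta> = x $ 1 * cos \<theta> + x $ 2 * sin \<theta>"
  by (simp add: direction_def inner_vec_def sum_2)

lemma norm_direction [simp]: "norm (direction \<theta>) = 1"
  by (simp add: norm_eq_sqrt_inner inner_direction) (simp add: direction_def power2_eq_square[symmetric])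

lemma direction_add_pi: "direction (\<theta> + pi) = - direction \<theta>"
  by (simp add: direction_def vec_eq_iff forall_2)

lemma direction_periodic: "direction (\<theta> + 2 * pi) = direction \<theta>"
  by (simp add: direction_def)

lemma continuous_on_direction [continuous_intros]: "continuous_on A direction"
proof -
  have "direction = (\<lambda>\<theta>. \<chi> i. if i = 1 then cos \<theta> else sin \<theta>)"
    by (auto simp: direction_def vec_eq_iff forall_2)
  moreover have "continuous_on A (\<lambda>\<theta>. \<chi> i::2. if i = 1 then cos \<theta> else sin \<theta>)"
    by (rule continuous_on_vec_lambda, rename_tac i, case_tac "i = 1") (auto intro!: continuous_intros)
  ultimately show ?thesis by (simp only:)
qed

lemma integral_periodic_shift:
  fixes f :: "real \<Rightarrow> real"
  assumes "continuous_on UNIV f" "\<And>x. f (x + 2 * pi) = f x" "0 \<le> c" "c \<le> 2 * pi"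
  shows "integral {0..2 * pi} (\<lambda>x. f (x + c)) = integral {0..2 * pi} f"
proof -
  have int: "f integrable_on {a..b}" for a b
    using assms(1) continuous_on_subset integrable_continuous_interval by blast
  have "integral {0..2 * pi} (\<lambda>x. f (x + c)) = integral {c..2 * pi + c} f"
    using integral_shift_Icc_real[of 0 "2 * pi" f c] by (simp add: o_def add.commute)
  also have "\<dots> = integral {c..2 * pi} f + integral {0 + 2 * pi..c + 2 * pi} f"
    using assms(3,4) Henstock_Kurzweil_Integration.integral_combine[OF _ _ int, of c "2 * pi" "2 * pi + c"]
    by (simp add: add.commute)
  also have "integral {0 + 2 * pi..c + 2 * pi} f = integral {0..c} f"
    using integral_shift_Icc_real[of 0 c f "2 * pi"] assms(2) by (simp add: o_def add.commute)
  also have "integral {c..2 * pi} f + integral {0..c} f = integral {0..2 * pi} f"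
    using assms(3,4) int Henstock_Kurzweil_Integration.integral_combine[of 0 c "2 * pi" f] by simp
  finally show ?thesis .
qed

lemma integral_abs_cos: "integral {0..2 * pi} (\<lambda>x. \<bar>cos x\<bar>) = 4"
proof -
  have "integral {0..2 * pi} (\<lambda>x. \<bar>cos x\<bar>) = integral {0..2 * pi} (\<lambda>x. \<bar>sin (x + pi / 2)\<bar>)"
    by (simp add: sin_add)
  also have "\<dots> = integral {0..2 * pi} (\<lambda>x. \<bar>sin x\<bar>)"
    by (rule integral_periodic_shift) (auto intro!: continuous_intros)
  also have "\<dots> = 4"
  proof (rule integral_unique)
    have "(sin has_integral (- cos pi - (- cos 0))) {0..pi}"
      by (rule fundamental_theorem_of_calculus)
         (auto intro!: derivative_eq_intros simp flip: has_real_derivative_iff_has_vector_derivative)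
    then have 1: "((\<lambda>x. \<bar>sin x\<bar>) has_integral 2) {0..pi}"
      by (subst has_integral_cong[where g = sin]) (auto simp: sin_ge_zero)
    have "((\<lambda>x. - sin x) has_integral (cos (2 * pi) - cos pi)) {pi..2 * pi}"
      by (rule fundamental_theorem_of_calculus)
         (auto intro!: derivative_eq_intros simp flip: has_real_derivative_iff_has_vector_derivative)
    then have 2: "((\<lambda>x. \<bar>sin x\<bar>) has_integral 2) {pi..2 * pi}"
    proof (subst has_integral_cong[where g = "\<lambda>x. - sin x"])
      show "\<bar>sin x\<bar> = - sin x" if "x \<in> {pi..2 * pi}" for x
        using that sin_le_zero[of x] by (cases "x = 2 * pi") (auto intro: abs_of_nonpos)
    qed simp
    show "((\<lambda>x. \<bar>sin x\<bar>) has_integral 4) {0..2 * pi}"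
      using has_integral_combine[OF _ _ 1 2] by simp
  qed
  finally show ?thesis .
qed

text \<open>In polar form the inner product is \<open>norm v\<close> times the cosine of \<theta> -
  t, and the absolute cosine integrates to 4 over a period. The shift by -t is written as
  \<open>2 * pi - t\<close> to lie in the range of \<open>integral_periodic_shift\<close>.\<close>

lemma integral_abs_inner_direction:
  "integral {0..2 * pi} (\<lambda>\<theta>. \<bar>v \<bullet> direction \<theta>\<bar>) = 4 * norm v"
proof (cases "v = 0")
  case False
  define r where "r = norm v"
  have "r > 0" using False by (simp add: r_def)
  have "r\<^sup>2 = (v$1)\<^sup>2 + (v$2)\<^sup>2"
    by (simp add: r_def norm_eq_sqrt_inner inner_vec_def sum_2 power2_eq_square)
  then have "(v$1 / r)\<^sup>2 + (v$2 / r)\<^sup>2 = 1" using \<open>r > 0\<close>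
    by (metis add_divide_distrib divide_self less_irrefl power_divide zero_eq_power2)
  then obtain t where t: "0 \<le> t" "t < 2 * pi" "v$1 / r = cos t" "v$2 / r = sin t"
    by (rule sincos_total_2pi)
  then have v: "v$1 = r * cos t" "v$2 = r * sin t" using \<open>r > 0\<close> by (auto simp: field_simps)
  have "\<bar>v \<bullet> direction \<theta>\<bar> = r * \<bar>cos (\<theta> + (2 * pi - t))\<bar>" for \<theta>
  proof -
    have "v \<bullet> direction \<theta> = r * cos (\<theta> - t)"
      by (simp add: inner_direction v cos_diff algebra_simps)
    also have "cos (\<theta> - t) = cos (\<theta> + (2 * pi - t))"
      using cos_periodic[of "\<theta> - t"] by (simp add: algebra_simps)
    finally show ?thesis using \<open>r > 0\<close> by (simp add: abs_mult)
  qed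
  then have "integral {0..2 * pi} (\<lambda>\<theta>. \<bar>v \<bullet> direction \<theta>\<bar>)
      = r * integral {0..2 * pi} (\<lambda>\<theta>. \<bar>cos (\<theta> + (2 * pi - t))\<bar>)"
    by simp
  also have "integral {0..2 * pi} (\<lambda>\<theta>. \<bar>cos (\<theta> + (2 * pi - t))\<bar>) = integral {0..2 * pi} (\<lambda>\<theta>. \<bar>cos \<theta>\<bar>)"
    using t by (intro integral_periodic_shift) (auto intro!: continuous_intros)
  finally show ?thesis by (simp add: integral_abs_cos r_def)
qed simp

context
  fixes K :: "(real^2) set"
  assumes K: "compact K" "K \<noteq> {}"
begin

lemma support_attained: "\<exists>x\<in>K. support K u = x \<bullet> u \<and> (\<forall>y\<in>K. y \<bullet> u \<le> x \<bullet> u)"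
proof -
  have "continuous_on K (\<lambda>x. x \<bullet> u)" by (intro continuous_intros)
  from continuous_attains_sup[OF K this] obtain x where x: "x \<in> K" "\<forall>y\<in>K. y \<bullet> u \<le> x \<bullet> u" by blast
  then have "support K u = x \<bullet> u" unfolding support_def by (intro cSup_eq_maximum) auto
  then show ?thesis using x by blast
qed

lemma inner_le_support: "x \<in> K \<Longrightarrow> x \<bullet> u \<le> support K u"
  using support_attained[of u] by fastforce

lemma support_leI: "(\<And>x. x \<in> K \<Longrightarrow> x \<bullet> u \<le> c) \<Longrightarrow> support K u \<le> c"
  using support_attained[of u] by fastforce

text \<open>By Cauchy-Schwarz the support function is Lipschitz, the constant being the radius of a
  ball around 0 that contains \<open>K\<close>.\<close>

lemma continuous_on_support: "continuous_on A (support K)"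
proof -
  obtain R where R: "\<And>x. x \<in> K \<Longrightarrow> norm x \<le> R"
    using K(1) compact_imp_bounded bounded_iff by metis
  have *: "support K u \<le> support K v + R * norm (u - v)" for u v
  proof (rule support_leI)
    fix x assume x: "x \<in> K"
    have "x \<bullet> u = x \<bullet> v + x \<bullet> (u - v)" by (simp add: inner_diff_right)
    also have "x \<bullet> (u - v) \<le> norm x * norm (u - v)" by (rule norm_cauchy_schwarz)
    also have "\<dots> \<le> R * norm (u - v)" using R[OF x] by (rule mult_right_mono) simp
    finally show "x \<bullet> u \<le> support K v + R * norm (u - v)" using inner_le_support[OF x, of v] by linarith
  qed
  have "0 \<le> R" using R K(2) norm_ge_zero order_trans by blast
  have "\<bar>support K u - support K v\<bar> \<le> R * norm (u - v)" for u v
    using *[of u v] *[of v u] by (simp add: norm_minus_commute abs_le_iff)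
  then have "R-lipschitz_on A (support K)"
    using \<open>0 \<le> R\<close> by (intro lipschitz_onI) (auto simp: dist_norm)
  then show ?thesis by (rule lipschitz_on_continuous_on)
qed

lemma continuous_on_support_direction: "continuous_on A (\<lambda>\<theta>. support K (direction \<theta>))"
  using continuous_on_compose2[OF continuous_on_support continuous_on_direction] by blast

text \<open>Inscribed polygons have their vertices on the frontier, so maximisers are needed there.
  From an interior point a small step along \<open>u\<close> would increase the functional.\<close>

lemma support_attained_frontier:
  assumes "u \<noteq> 0"
  shows "\<exists>x\<in>frontier K. support K u = x \<bullet> u"
proof -
  obtain x where x: "x \<in> K" "support K u = x \<bullet> u" "\<forall>y\<in>K. y \<bullet> u \<le> x \<bullet> u"
    using support_attained by blast
  have "x \<notin> interior K"
  proof
    assume "x \<in> interior K"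
    then obtain e where e: "e > 0" "cball x e \<subseteq> K" by (meson mem_interior_cball)
    let ?y = "x + (e / norm u) *\<^sub>R u"
    have "?y \<in> cball x e" using e assms by (simp add: dist_norm)
    then have "?y \<bullet> u \<le> x \<bullet> u" using e x by blast
    moreover have "?y \<bullet> u = x \<bullet> u + (e / norm u) * (u \<bullet> u)" by (simp add: inner_add_left)
    moreover have "(e / norm u) * (u \<bullet> u) > 0" using e assms by simp
    ultimately show False by linarith
  qed
  then have "x \<in> frontier K" using x K(1) by (simp add: frontier_def closure_closed compact_imp_closed)
  then show ?thesis using x by blast
qed

end

text \<open>The projection identity is integrated over all directions. Each edge yields 4 times its
  length. On the other side stands twice the width, the sum of the support function at
  \<open>u\<close> and at \<open>- u\<close>, and both terms have the same integral, which again
  gives a factor 4.\<close>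

lemma polygon_length_support:
  assumes "convex_polygon ps" "ps \<noteq> []"
  shows "polygon_length ps = integral {0..2 * pi} (\<lambda>\<theta>. support (set ps) (direction \<theta>))"
proof -
  obtain n where n: "length ps = Suc n" using assms(2) by (cases ps) auto
  let ?h = "\<lambda>\<theta>. support (set ps) (direction \<theta>)"
  have set: "compact (set ps)" "set ps \<noteq> {}" using assms(2) by (auto simp: finite_imp_compact)
  have cont: "continuous_on A ?h" for A by (rule continuous_on_support_direction[OF set])
  have int: "f integrable_on {0..2 * pi}" if "continuous_on UNIV f" for f :: "real \<Rightarrow> real"
    using that continuous_on_subset integrable_continuous_interval by blast
  have cont_abs: "continuous_on UNIV (\<lambda>\<theta>. \<bar>v \<bullet> direction \<theta>\<bar>)" for v by (intro continuous_intros)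
  have "support (set ps) u = Max ((\<lambda>x. x \<bullet> u) ` set ps)" for u
    unfolding support_def using set by (intro cSup_eq_Max) auto
  moreover have "support (set ps) (- u) = - Min ((\<lambda>x. x \<bullet> u) ` set ps)" for u
  proof -
    obtain x where x: "x \<in> set ps" "support (set ps) (- u) = x \<bullet> (- u)" "\<forall>y\<in>set ps. y \<bullet> (- u) \<le> x \<bullet> (- u)"
      using support_attained[OF set] by blast
    have "Min ((\<lambda>x. x \<bullet> u) ` set ps) = x \<bullet> u" using x by (intro Min_eqI) auto
    then show ?thesis using x by simp
  qed
  ultimately have proj: "(\<Sum>i<n. \<bar>(ps ! Suc i - ps ! i) \<bullet> u\<bar>) + \<bar>(ps ! n - ps ! 0) \<bullet> u\<bar>
      = 2 * (support (set ps) u + support (set ps) (- u))" for u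
    using convex_polygon_projection[OF assms(1) n, of u] by simp
  have "4 * polygon_length ps
      = (\<Sum>i<n. integral {0..2 * pi} (\<lambda>\<theta>. \<bar>(ps ! Suc i - ps ! i) \<bullet> direction \<theta>\<bar>))
        + integral {0..2 * pi} (\<lambda>\<theta>. \<bar>(ps ! n - ps ! 0) \<bullet> direction \<theta>\<bar>)"
    unfolding polygon_length_Suc[OF n] integral_abs_inner_direction
    by (simp add: dist_norm norm_minus_commute sum_distrib_left)
  also have "\<dots> = integral {0..2 * pi} (\<lambda>\<theta>. (\<Sum>i<n. \<bar>(ps ! Suc i - ps ! i) \<bullet> direction \<theta>\<bar>)
        + \<bar>(ps ! n - ps ! 0) \<bullet> direction \<theta>\<bar>)"
    by (subst Henstock_Kurzweil_Integration.integral_add; (subst Henstock_Kurzweil_Integration.integral_sum)?)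
       (auto intro!: int cont_abs continuous_on_sum)
  also have "\<dots> = integral {0..2 * pi} (\<lambda>\<theta>. 2 * (?h \<theta> + ?h (\<theta> + pi)))"
    unfolding proj by (simp add: direction_add_pi)
  also have "\<dots> = 2 * (integral {0..2 * pi} ?h + integral {0..2 * pi} (\<lambda>\<theta>. ?h (\<theta> + pi)))"
    by (subst Henstock_Kurzweil_Integration.integral_mult_right, subst Henstock_Kurzweil_Integration.integral_add)
       (auto intro!: int cont continuous_on_compose2[OF cont] continuous_intros)
  also have "integral {0..2 * pi} (\<lambda>\<theta>. ?h (\<theta> + pi)) = integral {0..2 * pi} ?h"
    by (rule integral_periodic_shift) (auto intro: cont simp: direction_periodic)
  finally show ?thesis by simp
qed

text \<open>An inscribed polygon has a smaller support function than \<open>K\<close>, which gives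
  the upper bound. For the lower bound, the hull of a finite \<open>e\<close>-net of the frontier is
  spanned by a convex polygon, and its support function is within \<open>e\<close> of that of
  \<open>K\<close> because the latter is attained on the frontier.\<close>

lemma perim_eq_integral_support:
  assumes K: "compact K" "K \<noteq> {}"
  shows "perim K = integral {0..2 * pi} (\<lambda>\<theta>. support K (direction \<theta>))"
proof -
  let ?P = "{polygon_length ps | ps. set ps \<subseteq> frontier K \<and> convex_polygon ps}"
  let ?I = "\<lambda>K. integral {0..2 * pi} (\<lambda>\<theta>. support K (direction \<theta>))"
  have int: "(\<lambda>\<theta>. support S (direction \<theta>)) integrable_on {0..2 * pi}" if "compact S" "S \<noteq> {}" for S
    by (intro integrable_continuous_interval continuous_on_support_direction that)
  have fr: "frontier K \<subseteq> K" using K by (simp add: compact_imp_closed frontier_subset_closed)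
  have upper: "L \<le> ?I K" if L: "L \<in> ?P" for L
  proof -
    obtain ps where ps: "L = polygon_length ps" "set ps \<subseteq> frontier K" "convex_polygon ps" using L by blast
    show ?thesis
    proof (cases "ps = []")
      case True
      \<comment> \<open>The empty list counts as a convex polygon of length 0, so the integral has
        to be shown nonnegative; it dominates the integral of a one-point subset, which vanishes by
        the polygon formula.\<close>
      obtain x where "x \<in> K" using K by blast
      have "0 = ?I {x}"
        using polygon_length_support[of "[x]"] by (simp add: convex_polygon_def polygon_length_def)
      also have "\<dots> \<le> ?I K"
        using \<open>x \<in> K\<close> inner_le_support[OF K] by (intro integral_le int K) (auto intro!: support_leI)
      finally show ?thesis using True ps by (simp add: polygon_length_def)
    next
      case False
      have "L = ?I (set ps)" using polygon_length_support[OF ps(3) False] ps(1) by simp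
      also have "\<dots> \<le> ?I K"
        using False ps(2) fr inner_le_support[OF K]
        by (intro integral_le int K) (auto intro!: support_leI finite_imp_compact)
      finally show ?thesis .
    qed
  qed
  have lower: "\<exists>L\<in>?P. ?I K - 2 * pi * e \<le> L" if "e > 0" for e
  proof -
    have "compact (frontier K)" using K by (simp add: compact_frontier)
    then obtain S where S: "finite S" "S \<subseteq> frontier K" "frontier K \<subseteq> (\<Union>x\<in>S. ball x e)"
      using compactE_image[of "frontier K" "frontier K" "\<lambda>x. ball x e"] \<open>e > 0\<close> by (metis UN_I centre_in_ball open_ball subsetI)
    have "frontier K \<noteq> {}"
      using support_attained_frontier[OF K, of "direction 0"] norm_direction[of 0] by fastforce
    then have "S \<noteq> {}" using S by auto
    from finite_hull_convex_polygon[OF S(1) this] obtain ps where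
      ps: "convex_polygon ps" "ps \<noteq> []" "set ps \<subseteq> S" "S \<subseteq> convex hull (set ps)" by blast
    have cps: "compact (set ps)" "set ps \<noteq> {}" using ps by (auto intro: finite_imp_compact)
    have "support K (direction \<theta>) - e \<le> support (set ps) (direction \<theta>)" for \<theta>
    proof -
      let ?u = "direction \<theta>"
      have "?u \<noteq> 0" using norm_direction[of \<theta>] by fastforce
      then obtain x where x: "x \<in> frontier K" "support K ?u = x \<bullet> ?u"
        using support_attained_frontier[OF K] by blast
      then obtain y where y: "y \<in> S" "dist y x < e" using S by auto
      have "convex hull (set ps) \<subseteq> {z. z \<bullet> ?u \<le> support (set ps) ?u}"
      proof (rule hull_minimal)
        show "set ps \<subseteq> {z. z \<bullet> ?u \<le> support (set ps) ?u}" using inner_le_support[OF cps] by blast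
        show "convex {z. z \<bullet> ?u \<le> support (set ps) ?u}"
          using convex_halfspace_le[of ?u] by (simp add: inner_commute)
      qed
      then have "y \<bullet> ?u \<le> support (set ps) ?u" using y ps by blast
      moreover have "(x - y) \<bullet> ?u \<le> norm (x - y) * norm ?u" by (rule norm_cauchy_schwarz)
      then have "x \<bullet> ?u - y \<bullet> ?u \<le> e" using y by (simp add: inner_diff_left dist_norm norm_minus_commute)
      ultimately show ?thesis using x by linarith
    qed
    then have "integral {0..2 * pi} (\<lambda>\<theta>. support K (direction \<theta>) - e) \<le> ?I (set ps)"
      by (intro integral_le integrable_diff int K cps) auto
    also have "integral {0..2 * pi} (\<lambda>\<theta>. support K (direction \<theta>) - e) = ?I K - 2 * pi * e"
      by (subst Henstock_Kurzweil_Integration.integral_diff) (rule int[OF K], rule integrable_const_ivl, simp)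
    also have "?I (set ps) = polygon_length ps" using polygon_length_support[OF ps(1,2)] by simp
    finally show ?thesis using ps S by blast
  qed
  show ?thesis unfolding perim_def
  proof (rule cSup_eq_non_empty)
    show "?P \<noteq> {}" using lower[of 1] by auto
    show "L \<le> ?I K" if "L \<in> ?P" for L by (rule upper[OF that])
    fix y assume y: "\<And>L. L \<in> ?P \<Longrightarrow> L \<le> y"
    have "?I K \<le> y + e" if "e > 0" for e
    proof -
      have "e / (2 * pi) > 0" using that by simp
      from lower[OF this] obtain L where "L \<in> ?P" "?I K - 2 * pi * (e / (2 * pi)) \<le> L" by blast
      then show ?thesis using y[of L] by simp
    qed
    then show "?I K \<le> y" by (rule field_le_epsilon)
  qed
qed

subsection \<open>Jointly Gaussian variables\<close>

lemma integrable_mult_of_squares: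
  fixes f g :: "'a \<Rightarrow> real"
  assumes [measurable]: "f \<in> borel_measurable M" "g \<in> borel_measurable M"
    and int: "integrable M (\<lambda>x. (f x)\<^sup>2)" "integrable M (\<lambda>x. (g x)\<^sup>2)"
  shows "integrable M (\<lambda>x. f x * g x)"
proof (rule Bochner_Integration.integrable_bound[OF Bochner_Integration.integrable_add[OF int]])
  have *: "p * q \<le> p\<^sup>2 + q\<^sup>2" if "0 \<le> p" "0 \<le> q" for p q :: real
    using sum_squares_bound[of p q] mult_nonneg_nonneg[OF that] by simp
  have "\<bar>a * b\<bar> \<le> a\<^sup>2 + b\<^sup>2" for a b :: real
    using *[of "\<bar>a\<bar>" "\<bar>b\<bar>"] by (simp add: abs_mult)
  then show "AE x in M. norm (f x * g x) \<le> norm ((f x)\<^sup>2 + (g x)\<^sup>2)" by simp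
qed measurable

text \<open>The covariance of a bridge vanishes at both ends of the time interval; this turns it
  into almost sure vanishing of the end values.\<close>

lemma AE_zero_of_square_integral:
  fixes f :: "'a \<Rightarrow> real"
  assumes "integrable M (\<lambda>x. f x * f x)" "(\<integral>x. f x * f x \<partial>M) = 0"
  shows "AE x in M. f x = 0"
proof -
  have "AE x in M. f x * f x = 0" using assms by (subst integral_nonneg_eq_0_iff_AE[symmetric]) auto
  then show ?thesis by simp
qed

text \<open>Since \<open>2 + U\<close> is positive, it is up to normalisation the density of a probability measure, and
  the hypothesis says that \<open>X\<close> has the same characteristic function under both measures.\<close>

lemma (in prob_space) factor_char_indicator_real:
  fixes X U :: "'a \<Rightarrow> real"
  assumes [measurable]: "X \<in> borel_measurable M" "U \<in> borel_measurable M"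
    and bound: "\<And>\<omega>. \<bar>U \<omega>\<bar> \<le> 1"
    and factor: "\<And>s. (CLINT \<omega>|M. of_real (U \<omega>) * iexp (s * X \<omega>)) = of_real (expectation U) * (CLINT \<omega>|M. iexp (s * X \<omega>))"
    and [measurable]: "A \<in> sets borel"
  shows "expectation (\<lambda>\<omega>. U \<omega> * indicator A (X \<omega>)) = expectation U * expectation (\<lambda>\<omega>. indicator A (X \<omega>))"
proof -
  define E where "E = (\<lambda>s \<omega>. iexp (s * X \<omega>))"
  have [measurable]: "E s \<in> borel_measurable M" for s unfolding E_def by measurable
  have normE: "norm (E s \<omega>) = 1" for s \<omega> unfolding E_def by (rule norm_exp_i_times)
  have factor: "(CLINT \<omega>|M. of_real (U \<omega>) * E s \<omega>) = of_real (expectation U) * (CLINT \<omega>|M. E s \<omega>)" for s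
    unfolding E_def by (rule factor)
  have U: "integrable M U" by (rule integrable_const_bound[of _ 1]) (use bound in auto)
  have I: "integrable M (E s)" for s
    by (rule integrable_const_bound[of _ 1]) (auto simp: normE)
  have UI: "integrable M (\<lambda>\<omega>. of_real (U \<omega>) * E s \<omega>)" for s
    by (rule integrable_const_bound[of _ 1]) (use bound in \<open>auto simp: norm_mult normE\<close>)
  define c where "c = 2 + expectation U"
  have "expectation (\<lambda>_. -1) \<le> expectation U"
    by (rule integral_mono) (use U bound in \<open>auto simp: abs_le_iff minus_le_iff\<close>)
  then have c: "c > 0" by (simp add: c_def prob_space)
  have U2: "0 \<le> 2 + U \<omega>" for \<omega> using bound[of \<omega>] by linarith
  define D where "D = density M (\<lambda>\<omega>. ennreal ((2 + U \<omega>) / c))"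
  have nn: "AE \<omega> in M. 0 \<le> (2 + U \<omega>) / c" using U2 c by simp
  have int2: "expectation (\<lambda>\<omega>. (2 + U \<omega>) / c) = 1"
    using c U by (simp add: c_def prob_space)
  have "emeasure D (space D) = (\<integral>\<^sup>+\<omega>. ennreal ((2 + U \<omega>) / c) \<partial>M)"
    by (simp add: D_def emeasure_density cong: nn_integral_cong)
  also have "\<dots> = ennreal (expectation (\<lambda>\<omega>. (2 + U \<omega>) / c))"
    using U nn by (intro nn_integral_eq_integral) auto
  finally have "emeasure D (space D) = 1" unfolding int2 by simp
  then interpret D: prob_space D by (rule prob_spaceI)
  interpret D': real_distribution "distr D borel X"
    by (rule D.real_distribution_distr) (simp add: D_def)
  interpret M': real_distribution "distr M borel X"
    by (rule real_distribution_distr) simp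
  have "char (distr D borel X) s = char (distr M borel X) s" for s
  proof -
    have "char (distr D borel X) s = (CLINT \<omega>|D. E s \<omega>)"
      unfolding char_def E_def by (rule integral_distr) (simp_all add: D_def)
    also have "\<dots> = (CLINT \<omega>|M. ((2 + U \<omega>) / c) *\<^sub>R E s \<omega>)"
      unfolding D_def using nn by (intro integral_density) simp_all
    also have "\<dots> = (CLINT \<omega>|M. (2 * E s \<omega> + of_real (U \<omega>) * E s \<omega>) / of_real c)"
      by (simp add: scaleR_conv_of_real add_divide_distrib distrib_right)
    also have "\<dots> = (2 * (CLINT \<omega>|M. E s \<omega>) + of_real (expectation U) * (CLINT \<omega>|M. E s \<omega>)) / of_real c"
      using I[of s] UI[of s] by (simp add: factor)
    also have "\<dots> = of_real c * (CLINT \<omega>|M. E s \<omega>) / of_real c"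
      by (simp add: c_def distrib_right)
    also have "\<dots> = (CLINT \<omega>|M. E s \<omega>)" using c by simp
    also have "\<dots> = char (distr M borel X) s"
      unfolding char_def E_def by (rule integral_distr[symmetric]) simp_all
    finally show ?thesis .
  qed
  then have eq: "distr D borel X = distr M borel X"
    by (intro Levy_uniqueness D'.real_distribution_axioms M'.real_distribution_axioms) auto
  have "(\<integral>x. indicator A x \<partial>distr D borel X) = (\<integral>\<omega>. (indicator A (X \<omega>) :: real) \<partial>D)"
    by (rule integral_distr) (simp_all add: D_def)
  also have "\<dots> = (\<integral>\<omega>. ((2 + U \<omega>) / c) *\<^sub>R (indicator A (X \<omega>)::real) \<partial>M)"
    unfolding D_def using nn by (intro integral_density) simp_all
  also have "\<dots> = (\<integral>\<omega>. (2 * indicator A (X \<omega>) + U \<omega> * indicator A (X \<omega>)) / c \<partial>M)"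
    by (simp add: add_divide_distrib distrib_right)
  also have "\<dots> = (2 * expectation (\<lambda>\<omega>. indicator A (X \<omega>)) + expectation (\<lambda>\<omega>. U \<omega> * indicator A (X \<omega>))) / c"
  proof -
    have "integrable M (\<lambda>\<omega>. U \<omega> * indicator A (X \<omega>))" "integrable M (\<lambda>\<omega>. indicator A (X \<omega>) :: real)"
      by (rule integrable_const_bound[of _ 1]; use bound in \<open>auto simp: indicator_def\<close>)+
    then show ?thesis by simp
  qed
  finally have "(2 * expectation (\<lambda>\<omega>. indicator A (X \<omega>)) + expectation (\<lambda>\<omega>. U \<omega> * indicator A (X \<omega>))) / c
      = (\<integral>x. indicator A x \<partial>distr M borel X)"
    unfolding eq by simp
  also have "\<dots> = expectation (\<lambda>\<omega>. indicator A (X \<omega>))"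
    by (rule integral_distr) simp_all
  finally have "(2 * expectation (\<lambda>\<omega>. indicator A (X \<omega>)) + expectation (\<lambda>\<omega>. U \<omega> * indicator A (X \<omega>))) / c
      = expectation (\<lambda>\<omega>. indicator A (X \<omega>))" .
  then show ?thesis using c by (simp add: c_def field_simps)
qed

text \<open>Reduction to the real case, applied to the real and the imaginary part of
  \<open>Y\<close>. Both are combinations of \<open>Y\<close> and its conjugate, and the
  factorisation for the conjugate is the conjugate of the assumption at \<open>- s\<close>.\<close>

lemma (in prob_space) factor_char_indicator:
  fixes X :: "'a \<Rightarrow> real" and Y :: "'a \<Rightarrow> complex"
  assumes [measurable]: "X \<in> borel_measurable M" "Y \<in> borel_measurable M"
    and bound: "\<And>\<omega>. norm (Y \<omega>) \<le> 1"
    and factor: "\<And>s. (CLINT \<omega>|M. Y \<omega> * iexp (s * X \<omega>)) = (CLINT \<omega>|M. Y \<omega>) * (CLINT \<omega>|M. iexp (s * X \<omega>))"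
    and [measurable]: "A \<in> sets borel"
  shows "(CLINT \<omega>|M. Y \<omega> * indicator A (X \<omega>)) = (CLINT \<omega>|M. Y \<omega>) * of_real (expectation (\<lambda>\<omega>. indicator A (X \<omega>)))"
proof -
  define E where "E = (\<lambda>s \<omega>. iexp (s * X \<omega>))"
  have [measurable]: "E s \<in> borel_measurable M" for s unfolding E_def by measurable
  have normE: "norm (E s \<omega>) = 1" for s \<omega> unfolding E_def by (rule norm_exp_i_times)
  have cnjE: "cnj (E s \<omega>) = E (- s) \<omega>" for s \<omega> by (simp add: E_def exp_cnj)
  have factor: "(CLINT \<omega>|M. Y \<omega> * E s \<omega>) = (CLINT \<omega>|M. Y \<omega>) * (CLINT \<omega>|M. E s \<omega>)" for s
    unfolding E_def by (rule factor)
  have [measurable]: "(\<lambda>\<omega>. cnj (Y \<omega>)) \<in> borel_measurable M"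
    by (rule borel_measurable_continuous_on[OF _ assms(2)]) (intro continuous_intros)
  have Y: "integrable M Y" by (rule integrable_const_bound[of _ 1]) (use bound in auto)
  have YE: "integrable M (\<lambda>\<omega>. Y \<omega> * E s \<omega>)" for s
    by (rule integrable_const_bound[of _ 1]) (use bound in \<open>auto simp: norm_mult normE\<close>)
  have cYE: "integrable M (\<lambda>\<omega>. cnj (Y \<omega>) * E s \<omega>)" for s
    by (rule integrable_const_bound[of _ 1]) (use bound in \<open>auto simp: norm_mult normE\<close>)
  have YA: "integrable M (\<lambda>\<omega>. Y \<omega> * indicator A (X \<omega>))"
    by (rule integrable_const_bound[of _ 1]) (use bound in \<open>auto simp: norm_mult indicator_def\<close>)
  have cnj_factor: "(CLINT \<omega>|M. cnj (Y \<omega>) * E s \<omega>) = cnj (CLINT \<omega>|M. Y \<omega>) * (CLINT \<omega>|M. E s \<omega>)" for s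
  proof -
    have "(CLINT \<omega>|M. cnj (Y \<omega>) * E s \<omega>) = (CLINT \<omega>|M. cnj (Y \<omega> * E (- s) \<omega>))"
      by (simp add: cnjE)
    also have "\<dots> = cnj (CLINT \<omega>|M. Y \<omega> * E (- s) \<omega>)" by (rule Bochner_Integration.integral_cnj)
    also have "\<dots> = cnj (CLINT \<omega>|M. Y \<omega>) * cnj (CLINT \<omega>|M. E (- s) \<omega>)" by (simp add: factor)
    also have "cnj (CLINT \<omega>|M. E (- s) \<omega>) = (CLINT \<omega>|M. cnj (E (- s) \<omega>))"
      by (rule Bochner_Integration.integral_cnj[symmetric])
    finally show ?thesis by (simp add: cnjE)
  qed
  have Re: "expectation (\<lambda>\<omega>. Re (Y \<omega>) * indicator A (X \<omega>)) = expectation (\<lambda>\<omega>. Re (Y \<omega>)) * expectation (\<lambda>\<omega>. indicator A (X \<omega>))"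
  proof (rule factor_char_indicator_real)
    show "\<bar>Re (Y \<omega>)\<bar> \<le> 1" for \<omega> using bound abs_Re_le_cmod order_trans by blast
    fix s
    have "(CLINT \<omega>|M. of_real (Re (Y \<omega>)) * E s \<omega>) = (CLINT \<omega>|M. (Y \<omega> * E s \<omega> + cnj (Y \<omega>) * E s \<omega>) / 2)"
      by (rule Bochner_Integration.integral_cong) (simp_all add: complex_add_cnj flip: distrib_right)
    also have "\<dots> = ((CLINT \<omega>|M. Y \<omega>) + cnj (CLINT \<omega>|M. Y \<omega>)) / 2 * (CLINT \<omega>|M. E s \<omega>)"
      using YE[of s] cYE[of s] by (simp add: factor cnj_factor distrib_right)
    also have "((CLINT \<omega>|M. Y \<omega>) + cnj (CLINT \<omega>|M. Y \<omega>)) / 2 = of_real (expectation (\<lambda>\<omega>. Re (Y \<omega>)))"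
      using Y by (simp add: complex_add_cnj)
    finally show "(CLINT \<omega>|M. of_real (Re (Y \<omega>)) * iexp (s * X \<omega>)) = of_real (expectation (\<lambda>\<omega>. Re (Y \<omega>))) * (CLINT \<omega>|M. iexp (s * X \<omega>))"
      by (simp only: E_def)
  qed simp_all
  have Im: "expectation (\<lambda>\<omega>. Im (Y \<omega>) * indicator A (X \<omega>)) = expectation (\<lambda>\<omega>. Im (Y \<omega>)) * expectation (\<lambda>\<omega>. indicator A (X \<omega>))"
  proof (rule factor_char_indicator_real)
    show "\<bar>Im (Y \<omega>)\<bar> \<le> 1" for \<omega> using bound abs_Im_le_cmod order_trans by blast
    have Im_cnj: "of_real (Im z) = - (\<i> / 2) * (z - cnj z)" for z by (simp add: complex_eq_iff)
    fix s
    have "(CLINT \<omega>|M. of_real (Im (Y \<omega>)) * E s \<omega>) = (CLINT \<omega>|M. - (\<i> / 2) * (Y \<omega> * E s \<omega> - cnj (Y \<omega>) * E s \<omega>))"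
      by (rule Bochner_Integration.integral_cong) (simp_all only: Im_cnj, simp add: algebra_simps)
    also have "\<dots> = - (\<i> / 2) * ((CLINT \<omega>|M. Y \<omega> * E s \<omega>) - (CLINT \<omega>|M. cnj (Y \<omega>) * E s \<omega>))"
      by (simp only: integral_mult_right_zero Bochner_Integration.integral_diff[OF YE cYE])
    also have "\<dots> = - (\<i> / 2) * ((CLINT \<omega>|M. Y \<omega>) - cnj (CLINT \<omega>|M. Y \<omega>)) * (CLINT \<omega>|M. E s \<omega>)"
      by (simp add: factor cnj_factor algebra_simps)
    also have "\<dots> = of_real (expectation (\<lambda>\<omega>. Im (Y \<omega>))) * (CLINT \<omega>|M. E s \<omega>)"
      using Y by (simp only: Im_cnj[symmetric] Bochner_Integration.integral_Im)
    finally show "(CLINT \<omega>|M. of_real (Im (Y \<omega>)) * iexp (s * X \<omega>)) = of_real (expectation (\<lambda>\<omega>. Im (Y \<omega>))) * (CLINT \<omega>|M. iexp (s * X \<omega>))"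
      by (simp only: E_def)
  qed simp_all
  have ind: "(indicator A z :: complex) = of_real (indicator A z)" for z :: real by (simp add: indicator_def)
  show ?thesis
  proof (rule complex_eqI)
    show "Re (CLINT \<omega>|M. Y \<omega> * indicator A (X \<omega>)) = Re ((CLINT \<omega>|M. Y \<omega>) * of_real (expectation (\<lambda>\<omega>. indicator A (X \<omega>))))"
      using Re unfolding Bochner_Integration.integral_Re[OF YA, symmetric] Re_complex_of_real Bochner_Integration.integral_Re[OF Y]
      by (simp add: ind)
    show "Im (CLINT \<omega>|M. Y \<omega> * indicator A (X \<omega>)) = Im ((CLINT \<omega>|M. Y \<omega>) * of_real (expectation (\<lambda>\<omega>. indicator A (X \<omega>))))"
      using Im unfolding Bochner_Integration.integral_Im[OF YA, symmetric] Bochner_Integration.integral_Im[OF Y]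
      by (simp add: ind)
  qed
qed

text \<open>One after the other, each factor \<open>exp (i t X)\<close> is replaced by an indicator of \<open>X\<close>.\<close>

lemma (in prob_space) indep_vars_char:
  fixes X :: "'i \<Rightarrow> 'a \<Rightarrow> real"
  assumes I: "finite I" "I \<noteq> {}" and X [measurable]: "\<And>i. i \<in> I \<Longrightarrow> X i \<in> borel_measurable M"
    and char: "\<And>t. (CLINT \<omega>|M. (\<Prod>i\<in>I. iexp (t i * X i \<omega>))) = (\<Prod>i\<in>I. CLINT \<omega>|M. iexp (t i * X i \<omega>))"
  shows "indep_vars (\<lambda>_. borel) X I"
proof -
  have step: "(CLINT \<omega>|M. (\<Prod>j\<in>J. indicator (A j) (X j \<omega>)) * (\<Prod>i\<in>I-J. iexp (t i * X i \<omega>)))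
      = (\<Prod>j\<in>J. of_real (expectation (\<lambda>\<omega>. indicator (A j) (X j \<omega>)))) * (\<Prod>i\<in>I-J. CLINT \<omega>|M. iexp (t i * X i \<omega>))"
    if A: "\<And>i. i \<in> I \<Longrightarrow> A i \<in> sets borel" and "J \<subseteq> I" for J A t
    using finite_subset[OF that(2) I(1)] that(2)
  proof (induction J arbitrary: t rule: finite_induct)
    case empty
    then show ?case using char by (simp only: prod.empty Diff_empty mult_1)
  next
    case (insert k J)
    have k: "k \<in> I" and J: "J \<subseteq> I" "finite J" using insert by auto
    have rest: "I - J = insert k (I - insert k J)" using k insert.hyps by auto
    have fin: "finite (I - insert k J)" using I by simp
    have [measurable]: "\<And>j. j \<in> J \<Longrightarrow> X j \<in> borel_measurable M" "\<And>j. j \<in> I - insert k J \<Longrightarrow> X j \<in> borel_measurable M"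
      "\<And>j. j \<in> J \<Longrightarrow> A j \<in> sets borel" "X k \<in> borel_measurable M"
      using J k X A by auto
    define Y :: "'a \<Rightarrow> complex" where "Y = (\<lambda>\<omega>. (\<Prod>j\<in>J. indicator (A j) (X j \<omega>)) * (\<Prod>i\<in>I-insert k J. iexp (t i * X i \<omega>)))"
    define c where "c = (\<Prod>j\<in>J. of_real (expectation (\<lambda>\<omega>. indicator (A j) (X j \<omega>)))) * (\<Prod>i\<in>I-insert k J. CLINT \<omega>|M. iexp (t i * X i \<omega>))"
    have [measurable]: "Y \<in> borel_measurable M" unfolding Y_def by measurable
    have *: "(CLINT \<omega>|M. Y \<omega> * iexp (s * X k \<omega>)) = c * (CLINT \<omega>|M. iexp (s * X k \<omega>))" for s
    proof -
      \<comment> \<open>The frequency at \<open>k\<close> is freed by updating \<open>t\<close> at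
        \<open>k\<close> alone, which the remaining factors do not see.\<close>
      have "(\<Prod>i\<in>I - insert k J. iexp ((t(k := s)) i * X i \<omega>)) = (\<Prod>i\<in>I - insert k J. iexp (t i * X i \<omega>))" for \<omega>
        by (rule prod.cong) auto
      moreover have "(\<Prod>i\<in>I - insert k J. CLINT \<omega>|M. iexp ((t(k := s)) i * X i \<omega>)) = (\<Prod>i\<in>I - insert k J. CLINT \<omega>|M. iexp (t i * X i \<omega>))"
        by (rule prod.cong) auto
      ultimately show ?thesis
        using insert.IH[OF J(1), of "t(k := s)"] fin unfolding rest
        by (simp add: Y_def c_def mult_ac del: fun_upd_apply) (simp add: mult_ac)
    qed
    \<comment> \<open>At frequency 0 the constant is identified as the mean of \<open>Y\<close>,
      which turns \<open>*\<close> into the assumption of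
      \<open>factor_char_indicator\<close>.\<close>
    have Yc: "(CLINT \<omega>|M. Y \<omega>) = c" using *[of 0] by (simp add: prob_space)
    have "(CLINT \<omega>|M. Y \<omega> * indicator (A k) (X k \<omega>)) = c * of_real (expectation (\<lambda>\<omega>. indicator (A k) (X k \<omega>)))"
    proof (subst factor_char_indicator)
      show "norm (Y \<omega>) \<le> 1" for \<omega>
        unfolding Y_def norm_mult prod_norm[symmetric]
        by (intro mult_le_one prod_le_1 prod_nonneg) (auto simp: indicator_def)
      show "A k \<in> sets borel" using A k by blast
    qed (use * Yc in simp_all)
    then show ?case using insert.hyps by (simp add: Y_def c_def mult_ac)
  qed
  show ?thesis
  proof (subst indep_vars_finite[where E = "\<lambda>_. sets borel"])
    show "\<forall>A\<in>I \<rightarrow> sets borel. prob (\<Inter>j\<in>I. X j -` A j \<inter> space M) = (\<Prod>j\<in>I. prob (X j -` A j \<inter> space M))"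
    proof
      fix A :: "'i \<Rightarrow> real set" assume "A \<in> I \<rightarrow> sets borel"
      then have A [measurable]: "\<And>i. i \<in> I \<Longrightarrow> A i \<in> sets borel" by auto
      have ind: "(\<Prod>j\<in>I. indicator (A j) (X j \<omega>)) = (indicator (\<Inter>j\<in>I. X j -` A j \<inter> space M) \<omega> :: real)"
        if "\<omega> \<in> space M" for \<omega>
        using that I by (auto simp: indicator_def prod_zero_iff)
      have pr: "expectation (\<lambda>\<omega>. indicator (A j) (X j \<omega>)) = prob (X j -` A j \<inter> space M)" if "j \<in> I" for j
      proof -
        have "expectation (\<lambda>\<omega>. indicator (A j) (X j \<omega>)) = expectation (indicator (X j -` A j \<inter> space M))"
          by (rule Bochner_Integration.integral_cong) (auto simp: indicator_def)
        also have "\<dots> = prob (X j -` A j \<inter> space M)"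
          using X[OF that] A[OF that] by (subst Bochner_Integration.integral_indicator) (auto simp: measurable_sets)
        finally show ?thesis .
      qed
      have "complex_of_real (prob (\<Inter>j\<in>I. X j -` A j \<inter> space M))
          = of_real (expectation (indicator (\<Inter>j\<in>I. X j -` A j \<inter> space M)))"
        using I by (auto simp: Int_absorb2 intro!: arg_cong[where f = prob])
      also have "\<dots> = of_real (expectation (\<lambda>\<omega>. \<Prod>j\<in>I. indicator (A j) (X j \<omega>)))"
        using ind by (intro arg_cong[where f = of_real] Bochner_Integration.integral_cong) auto
      also have "\<dots> = (CLINT \<omega>|M. of_real (\<Prod>j\<in>I. indicator (A j) (X j \<omega>)))"
        by (rule integral_complex_of_real[symmetric])
      also have "\<dots> = (CLINT \<omega>|M. (\<Prod>j\<in>I. indicator (A j) (X j \<omega>)))"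
        by (intro Bochner_Integration.integral_cong) (auto simp: of_real_prod indicator_def intro!: prod.cong)
      also have "\<dots> = of_real (\<Prod>j\<in>I. prob (X j -` A j \<inter> space M))"
        using step[of A I] A pr by simp
      finally show "prob (\<Inter>j\<in>I. X j -` A j \<inter> space M) = (\<Prod>j\<in>I. prob (X j -` A j \<inter> space M))"
        by (simp only: of_real_eq_iff)
    qed
  qed (use I X in \<open>auto simp: sets.sigma_sets_eq[where M = borel, simplified] Int_stable_def\<close>)
qed

section \<open>Centred Gaussian variables: law, characteristic function, exponential moments\<close>

text \<open>A zero mean forces the shift \<open>m\<close> to be 0. The scale \<open>s\<close> may
  have either sign and the second moment determines only its absolute value; that suffices, because
  the standard normal law is symmetric.\<close>

lemma (in prob_space) gaussian_centered:
  assumes "gaussian_rv M Y" "expectation Y = 0"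
  shows "integrable M Y" "integrable M (\<lambda>\<omega>. (Y \<omega>)\<^sup>2)"
    and "distr M borel Y = distr std_normal_distribution borel (\<lambda>x. sqrt (expectation (\<lambda>\<omega>. (Y \<omega>)\<^sup>2)) * x)"
proof -
  obtain m s where [measurable]: "Y \<in> borel_measurable M"
    and d: "distr M borel Y = distr std_normal_distribution borel (\<lambda>x. m + s * x)"
    using assms(1) unfolding gaussian_rv_def by blast
  have i1: "integrable std_normal_distribution (\<lambda>x. x)"
    using integrable_std_normal_distribution_moment[of 1] by simp
  have i2: "integrable std_normal_distribution (\<lambda>x. x\<^sup>2)"
    by (rule integrable_std_normal_distribution_moment)
  interpret N: real_distribution std_normal_distribution by (rule real_dist_normal_dist)
  have e1: "(\<integral>x. x \<partial>std_normal_distribution) = 0"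
    using integral_std_normal_distribution_moment_odd[of 1] by simp
  have e2: "(\<integral>x. x\<^sup>2 \<partial>std_normal_distribution) = 1"
    using std_normal_distribution_even_moments(1)[of 1] by (simp add: numeral_eq_Suc)
  have i_affine: "integrable std_normal_distribution (\<lambda>x. m + s * x)"
    by (intro Bochner_Integration.integrable_add integrable_mult_right N.integrable_const i1)
  have e_affine: "(\<integral>x. m + s * x \<partial>std_normal_distribution) = m"
    by (subst Bochner_Integration.integral_add[OF N.integrable_const integrable_mult_right[OF i1]])
       (simp only: integral_mult_right_zero e1 N.prob_space lebesgue_integral_const, simp)
  have int1: "integrable (distr M borel Y) (\<lambda>x. x)"
    unfolding d by (subst integrable_distr_eq) (use i_affine in simp_all)
  then show "integrable M Y" by (simp add: integrable_distr_eq)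
  have "expectation Y = (\<integral>x. x \<partial>distr M borel Y)" by (simp add: integral_distr)
  also have "\<dots> = m" unfolding d by (subst integral_distr) (use e_affine in simp_all)
  finally have m: "m = 0" using assms(2) by simp
  have int2: "integrable (distr M borel Y) (\<lambda>x. x\<^sup>2)"
    unfolding d m using i2 by (subst integrable_distr_eq) (auto simp: power_mult_distrib)
  then show "integrable M (\<lambda>\<omega>. (Y \<omega>)\<^sup>2)" by (simp add: integrable_distr_eq)
  have "expectation (\<lambda>\<omega>. (Y \<omega>)\<^sup>2) = (\<integral>x. x\<^sup>2 \<partial>distr M borel Y)" by (simp add: integral_distr)
  also have "\<dots> = s\<^sup>2" unfolding d m using i2 e2 by (subst integral_distr) (auto simp: power_mult_distrib)
  finally have v: "sqrt (expectation (\<lambda>\<omega>. (Y \<omega>)\<^sup>2)) = \<bar>s\<bar>" by simp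
  show "distr M borel Y = distr std_normal_distribution borel (\<lambda>x. sqrt (expectation (\<lambda>\<omega>. (Y \<omega>)\<^sup>2)) * x)"
  proof (cases "s \<ge> 0")
    case True
    then show ?thesis unfolding d m v by simp
  next
    case False
    have sym: "distr std_normal_distribution borel uminus = std_normal_distribution"
    proof (rule Levy_uniqueness)
      show "real_distribution (distr std_normal_distribution borel uminus)"
        by (rule N.real_distribution_distr) simp
      show "char (distr std_normal_distribution borel uminus) = char std_normal_distribution"
      proof
        fix t
        have "char (distr std_normal_distribution borel uminus) t = char std_normal_distribution (- t)"
          unfolding char_def by (subst integral_distr) auto
        then show "char (distr std_normal_distribution borel uminus) t = char std_normal_distribution t"
          by (simp add: char_std_normal_distribution)
      qed
    qed (rule real_dist_normal_dist)
    have "distr std_normal_distribution borel (\<lambda>x. s * x) = distr (distr std_normal_distribution borel uminus) borel (\<lambda>x. \<bar>s\<bar> * x)"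
      using False by (subst distr_distr) (auto simp: o_def)
    then show ?thesis unfolding d m v sym by simp
  qed
qed

lemma (in prob_space) gaussian_char:
  assumes "gaussian_rv M Y" "expectation Y = 0"
  shows "(CLINT \<omega>|M. iexp (Y \<omega>)) = of_real (exp (- expectation (\<lambda>\<omega>. (Y \<omega>)\<^sup>2) / 2))"
proof -
  have [measurable]: "Y \<in> borel_measurable M" using assms(1) by (simp add: gaussian_rv_def)
  have "0 \<le> expectation (\<lambda>\<omega>. (Y \<omega>)\<^sup>2)" by (rule integral_nonneg_AE) simp
  have "(CLINT \<omega>|M. iexp (Y \<omega>)) = (CLINT x|distr M borel Y. iexp x)" by (simp add: integral_distr)
  also have "\<dots> = char std_normal_distribution (sqrt (expectation (\<lambda>\<omega>. (Y \<omega>)\<^sup>2)))"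
    unfolding gaussian_centered(3)[OF assms] char_def by (subst integral_distr) auto
  finally show ?thesis
    using \<open>0 \<le> _\<close> by (simp add: char_std_normal_distribution)
qed


text \<open>Completing the square: an exponential weight translates the normal density. This yields
  the exponential moments here and, later, the shifted argument of \<open>Phi\<close> in the law of
  the maximum.\<close>

lemma std_normal_density_tilt:
  "std_normal_density x * exp (l * x) = exp (l\<^sup>2 / 2) * std_normal_density (x - l)"
proof -
  have "- x\<^sup>2 / 2 + l * x = l\<^sup>2 / 2 + (- (x - l)\<^sup>2 / 2)" by (simp add: power2_eq_square field_simps)
  then have "exp (- x\<^sup>2 / 2) * exp (l * x) = exp (l\<^sup>2 / 2) * exp (- (x - l)\<^sup>2 / 2)" by (metis exp_add)
  then show ?thesis by (simp add: std_normal_density_def)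
qed

lemma std_normal_mgf:
  "has_bochner_integral lborel (\<lambda>x. std_normal_density x * exp (l * x)) (exp (l\<^sup>2 / 2))"
proof -
  have "std_normal_density (x - l) = normal_density l 1 x" for x by (simp add: normal_density_def)
  moreover have "has_bochner_integral lborel (\<lambda>x. exp (l\<^sup>2 / 2) * normal_density l 1 x) (exp (l\<^sup>2 / 2) * 1)"
    by (intro has_bochner_integral_mult_right) (simp add: has_bochner_integral_iff)
  ultimately show ?thesis by (simp only: std_normal_density_tilt mult_1_right)
qed

lemma (in prob_space) gaussian_mgf:
  assumes "gaussian_rv M Y" "expectation Y = 0"
  shows "integrable M (\<lambda>\<omega>. exp (l * Y \<omega>))"
    and "expectation (\<lambda>\<omega>. exp (l * Y \<omega>)) = exp (l\<^sup>2 * expectation (\<lambda>\<omega>. (Y \<omega>)\<^sup>2) / 2)"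
proof -
  have [measurable]: "Y \<in> borel_measurable M" using assms(1) by (simp add: gaussian_rv_def)
  define s where "s = sqrt (expectation (\<lambda>\<omega>. (Y \<omega>)\<^sup>2))"
  have "0 \<le> expectation (\<lambda>\<omega>. (Y \<omega>)\<^sup>2)" by (rule integral_nonneg_AE) simp
  then have s2: "s\<^sup>2 = expectation (\<lambda>\<omega>. (Y \<omega>)\<^sup>2)" by (simp add: s_def)
  have mgf: "has_bochner_integral std_normal_distribution (\<lambda>x. exp (l * s * x)) (exp ((l * s)\<^sup>2 / 2))"
    by (rule has_bochner_integral_density) (use std_normal_mgf in auto)
  note d = gaussian_centered(3)[OF assms, folded s_def]
  have "integrable (distr M borel Y) (\<lambda>x. exp (l * x))"
    unfolding d using mgf[THEN has_bochner_integral_iff[THEN iffD1], THEN conjunct1] by (subst integrable_distr_eq) (auto simp: mult_ac)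
  then show "integrable M (\<lambda>\<omega>. exp (l * Y \<omega>))" by (simp add: integrable_distr_eq)
  have "expectation (\<lambda>\<omega>. exp (l * Y \<omega>)) = (\<integral>x. exp (l * x) \<partial>distr M borel Y)" by (simp add: integral_distr)
  also have "\<dots> = (\<integral>x. exp (l * s * x) \<partial>std_normal_distribution)"
    unfolding d by (subst integral_distr) (auto simp: mult_ac)
  also have "\<dots> = exp ((l * s)\<^sup>2 / 2)" using mgf by (rule has_bochner_integral_integral_eq)
  finally show "expectation (\<lambda>\<omega>. exp (l * Y \<omega>)) = exp (l\<^sup>2 * expectation (\<lambda>\<omega>. (Y \<omega>)\<^sup>2) / 2)"
    by (simp add: power_mult_distrib s2)
qed

subsection \<open>Brownian bridges below a line\<close>

text \<open>The martingale property without conditional expectations: \<open>F\<close> depends on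
  the first \<open>k\<close> variables only and will be the indicator of an event known at time
  \<open>k\<close>. The later factors are independent of that past and have mean 1, so they can be
  removed one at a time.\<close>

lemma (in prob_space) product_martingale:
  fixes \<xi> :: "nat \<Rightarrow> 'a \<Rightarrow> real" and g :: "real \<Rightarrow> real"
  assumes indep: "indep_vars (\<lambda>_. borel) \<xi> {..<m}"
    and g [measurable]: "g \<in> borel_measurable borel"
    and int: "\<And>i. i < m \<Longrightarrow> integrable M (\<lambda>\<omega>. g (\<xi> i \<omega>))"
    and mean: "\<And>i. i < m \<Longrightarrow> expectation (\<lambda>\<omega>. g (\<xi> i \<omega>)) = 1"
    and F [measurable]: "F \<in> borel_measurable (Pi\<^sub>M {..<k} (\<lambda>_. borel))"
    and bound: "\<And>v. \<bar>F v\<bar> \<le> 1" and "k \<le> n" "n \<le> m"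
  shows "integrable M (\<lambda>\<omega>. F (\<lambda>i\<in>{..<k}. \<xi> i \<omega>) * (\<Prod>i<n. g (\<xi> i \<omega>))) \<and>
    expectation (\<lambda>\<omega>. F (\<lambda>i\<in>{..<k}. \<xi> i \<omega>) * (\<Prod>i<n. g (\<xi> i \<omega>)))
      = expectation (\<lambda>\<omega>. F (\<lambda>i\<in>{..<k}. \<xi> i \<omega>) * (\<Prod>i<k. g (\<xi> i \<omega>)))"
proof -
  define R where "R = (\<lambda>k \<omega>. \<lambda>i\<in>{..<k}. \<xi> i \<omega>)"
  have "integrable M (\<lambda>\<omega>. F (R k \<omega>) * (\<Prod>i<n. g (\<xi> i \<omega>))) \<and>
    expectation (\<lambda>\<omega>. F (R k \<omega>) * (\<Prod>i<n. g (\<xi> i \<omega>)))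
      = expectation (\<lambda>\<omega>. F (R k \<omega>) * (\<Prod>i<k. g (\<xi> i \<omega>)))"
    using \<open>k \<le> n\<close> \<open>n \<le> m\<close>
  proof (induction n rule: dec_induct)
  case base
  have [measurable]: "\<And>i. i < k \<Longrightarrow> \<xi> i \<in> borel_measurable M"
    using indep base by (auto simp: indep_vars_def)
  have "integrable M (\<lambda>\<omega>. \<Prod>i\<in>{..<k}. g (\<xi> i \<omega>))"
  proof (rule indep_vars_integrable)
    show "indep_vars (\<lambda>_. borel) (\<lambda>i \<omega>. g (\<xi> i \<omega>)) {..<k}"
      by (rule indep_vars_compose2[OF indep_vars_subset[OF indep]]) (use base in auto)
    show "integrable M (\<lambda>\<omega>. g (\<xi> i \<omega>))" if "i \<in> {..<k}" for i using int that base by auto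
  qed simp
  moreover have [measurable]: "(\<lambda>\<omega>. F (R k \<omega>)) \<in> borel_measurable M"
    unfolding R_def by (rule measurable_compose[OF _ F], rule measurable_restrict) auto
  ultimately have "integrable M (\<lambda>\<omega>. F (R k \<omega>) * (\<Prod>i<k. g (\<xi> i \<omega>)))"
    by (intro Bochner_Integration.integrable_bound[where g = "\<lambda>\<omega>. F (R k \<omega>) * (\<Prod>i<k. g (\<xi> i \<omega>))"])
       (use bound in \<open>auto simp: abs_mult intro!: mult_left_le_one_le AE_I2\<close>)
  then show ?case by simp
next
  case (step n)
  have n: "n < m" "k \<le> n" using step by auto
  let ?G = "\<lambda>v. F (restrict v {..<k}) * (\<Prod>i<n. g (v i))"
  have G: "?G \<in> borel_measurable (Pi\<^sub>M {..<n} (\<lambda>_. borel))"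
    by (intro borel_measurable_times borel_measurable_prod measurable_compose[OF _ F] measurable_compose[OF _ g]
        measurable_component_singleton measurable_restrict_subset) (use n in auto)
  have g': "(\<lambda>v. g (v n)) \<in> borel_measurable (Pi\<^sub>M {n} (\<lambda>_. borel))"
    by (intro measurable_compose[OF _ g] measurable_component_singleton) auto
  have "indep_var (Pi\<^sub>M {..<n} (\<lambda>_. borel)) (R n) (Pi\<^sub>M {n} (\<lambda>_. borel)) (\<lambda>\<omega>. \<lambda>i\<in>{n}. \<xi> i \<omega>)"
    unfolding R_def by (rule indep_var_restrict[OF indep]) (use n in auto)
  from indep_var_compose[OF this G g']
  have "indep_var borel (\<lambda>\<omega>. ?G (R n \<omega>)) borel (\<lambda>\<omega>. g (\<xi> n \<omega>))"
    by (simp add: o_def)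
  moreover have "?G (R n \<omega>) = F (R k \<omega>) * (\<Prod>i<n. g (\<xi> i \<omega>))" for \<omega>
  proof -
    have "restrict (R n \<omega>) {..<k} = R k \<omega>" using n by (auto simp: R_def restrict_def fun_eq_iff)
    moreover have "(\<Prod>i<n. g (R n \<omega> i)) = (\<Prod>i<n. g (\<xi> i \<omega>))" by (rule prod.cong) (auto simp: R_def)
    ultimately show ?thesis by simp
  qed
  ultimately have ind: "indep_var borel (\<lambda>\<omega>. F (R k \<omega>) * (\<Prod>i<n. g (\<xi> i \<omega>))) borel (\<lambda>\<omega>. g (\<xi> n \<omega>))"
    by simp
  have IH: "integrable M (\<lambda>\<omega>. F (R k \<omega>) * (\<Prod>i<n. g (\<xi> i \<omega>)))"
    "expectation (\<lambda>\<omega>. F (R k \<omega>) * (\<Prod>i<n. g (\<xi> i \<omega>)))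
      = expectation (\<lambda>\<omega>. F (R k \<omega>) * (\<Prod>i<k. g (\<xi> i \<omega>)))"
    using step.IH n by auto
  show ?case
    using indep_var_lebesgue_integral[OF ind IH(1) int[OF n(1)]] indep_var_integrable[OF ind IH(1) int[OF n(1)]]
    unfolding IH(2) mean[OF n(1)] by (simp add: mult.assoc)
qed
  then show ?thesis unfolding R_def .
qed

text \<open>Optional stopping for the martingale \<open>exp (2 \<mu> V k)\<close> at the first \<open>k\<close> with \<open>V k > x\<close>, where
  its value is at least \<open>exp (2 \<mu> x)\<close>, and at most \<open>exp (2 \<mu> (x + \<epsilon>))\<close> unless \<open>V\<close> has jumped by
  more than \<open>\<epsilon>\<close>.\<close>

lemma (in prob_space) grid_overshoot:
  fixes \<xi> :: "nat \<Rightarrow> 'a \<Rightarrow> real" and \<mu> h x \<epsilon> :: real and m :: nat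
  assumes indep: "indep_vars (\<lambda>_. borel) \<xi> {..<m}"
    and int: "\<And>i. i < m \<Longrightarrow> integrable M (\<lambda>\<omega>. exp (2 * \<mu> * \<xi> i \<omega>))"
    and mgf: "\<And>i. i < m \<Longrightarrow> expectation (\<lambda>\<omega>. exp (2 * \<mu> * \<xi> i \<omega>)) = exp (2 * \<mu>\<^sup>2 * h)"
    and pos: "\<mu> > 0" "x \<ge> 0" "\<epsilon> \<ge> 0"
    and V: "\<And>k \<omega>. k \<le> m \<Longrightarrow> V k \<omega> = (\<Sum>i<k. \<xi> i \<omega>) - \<mu> * (real k * h)"
  defines "hit \<equiv> {\<omega> \<in> space M. \<exists>k\<le>m. V k \<omega> > x}"
    and "over \<equiv> {\<omega> \<in> space M. \<exists>k<m. V (Suc k) \<omega> - V k \<omega> > \<epsilon>}"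
  shows "hit \<in> events" "over \<in> events"
    and "integrable M (\<lambda>\<omega>. exp (2 * \<mu> * V m \<omega>))" "expectation (\<lambda>\<omega>. exp (2 * \<mu> * V m \<omega>)) = 1"
    and "exp (2 * \<mu> * x) * prob hit \<le> expectation (\<lambda>\<omega>. exp (2 * \<mu> * V m \<omega>) * indicator hit \<omega>)"
    and "expectation (\<lambda>\<omega>. exp (2 * \<mu> * V m \<omega>) * indicator hit \<omega>)
      \<le> exp (2 * \<mu> * (x + \<epsilon>)) * prob hit + expectation (\<lambda>\<omega>. exp (2 * \<mu> * V m \<omega>) * indicator over \<omega>)"
proof -
  define R where "R = (\<lambda>k \<omega>. \<lambda>i\<in>{..<k}. \<xi> i \<omega>)"
  \<comment> \<open>The increments normalised to mean 1; the product of the first \<open>k\<close>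
    is exp (2 \<mu> V k). For increments of variance \<open>h\<close> the exponent 2 \<mu> is the
    one at which half its square times \<open>h\<close> equals 2 \<mu> times the drift \<mu>
    \<open>h\<close>.\<close>
  define g where "g = (\<lambda>r. exp (2 * \<mu> * r - 2 * \<mu>\<^sup>2 * h))"
  have g [measurable]: "g \<in> borel_measurable borel" unfolding g_def by measurable
  have g_eq: "g r = exp (2 * \<mu> * r) / exp (2 * \<mu>\<^sup>2 * h)" for r by (simp add: g_def exp_diff)
  have gint: "integrable M (\<lambda>\<omega>. g (\<xi> i \<omega>))" "expectation (\<lambda>\<omega>. g (\<xi> i \<omega>)) = 1" if "i < m" for i
    using int[OF that] mgf[OF that] by (simp_all add: g_eq)
  have \<xi> [measurable]: "\<xi> i \<in> borel_measurable M" if "i < m" for i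
    using indep that by (auto simp: indep_vars_def)
  have Vm [measurable]: "V k \<in> borel_measurable M" if "k \<le> m" for k
  proof -
    have "(\<lambda>\<omega>. (\<Sum>i<k. \<xi> i \<omega>) - \<mu> * (real k * h)) \<in> borel_measurable M"
      using that by (intro borel_measurable_diff borel_measurable_sum) auto
    then show ?thesis using V[OF that] by presburger
  qed
  define Q where "Q = (\<lambda>k \<omega>. exp (2 * \<mu> * V k \<omega>))"
  have Q: "(\<Prod>i<k. g (\<xi> i \<omega>)) = Q k \<omega>" if "k \<le> m" for k \<omega>
  proof -
    have "(\<Prod>i<k. g (\<xi> i \<omega>)) = exp (\<Sum>i<k. 2 * \<mu> * \<xi> i \<omega> - 2 * \<mu>\<^sup>2 * h)"
      by (simp add: g_def exp_sum)
    also have "(\<Sum>i<k. 2 * \<mu> * \<xi> i \<omega> - 2 * \<mu>\<^sup>2 * h) = 2 * \<mu> * V k \<omega>"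
      unfolding V[OF that] by (simp add: sum_subtractf sum_distrib_left algebra_simps power2_eq_square)
    finally show ?thesis by (simp add: Q_def)
  qed
  have Q_meas [measurable]: "Q k \<in> borel_measurable M" if "k \<le> m" for k
    unfolding Q_def using that by measurable
  have mart: "integrable M (\<lambda>\<omega>. F (R k \<omega>) * Q m \<omega>)"
     "integrable M (\<lambda>\<omega>. F (R k \<omega>) * Q k \<omega>)"
    "expectation (\<lambda>\<omega>. F (R k \<omega>) * Q m \<omega>) = expectation (\<lambda>\<omega>. F (R k \<omega>) * Q k \<omega>)"
    if "k \<le> m" "F \<in> borel_measurable (Pi\<^sub>M {..<k} (\<lambda>_. borel))" "\<And>v. \<bar>F v\<bar> \<le> 1" for k F
    using product_martingale[OF indep g gint that(2,3,1) order_refl] product_martingale[OF indep g gint that(2,3) order_refl that(1)]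
    unfolding Q[OF that(1)] Q[OF order_refl] R_def by blast+
  have Qm: "integrable M (Q m)" "expectation (Q m) = 1"
    using mart[of 0 "\<lambda>_. 1"] by (simp_all add: Q_def V prob_space)
  then show "integrable M (\<lambda>\<omega>. exp (2 * \<mu> * V m \<omega>))" "expectation (\<lambda>\<omega>. exp (2 * \<mu> * V m \<omega>)) = 1"
    unfolding Q_def by auto
  show [measurable]: "hit \<in> events" "over \<in> events"
  proof -
    have "hit = (\<Union>k\<in>{..m}. {\<omega> \<in> space M. x < V k \<omega>})"
      and "over = (\<Union>k\<in>{..<m}. {\<omega> \<in> space M. \<epsilon> < V (Suc k) \<omega> - V k \<omega>})"
      unfolding hit_def over_def by blast+
    moreover have "{\<omega> \<in> space M. x < V k \<omega>} \<in> events" if "k \<in> {..m}" for k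
      using Vm[of k] that by simp
    moreover have "{\<omega> \<in> space M. \<epsilon> < V (Suc k) \<omega> - V k \<omega>} \<in> events" if "k \<in> {..<m}" for k
      using Vm[of k] Vm[of "Suc k"] that by simp
    ultimately show "hit \<in> events" "over \<in> events" by (simp_all only: sets.finite_UN finite_atMost finite_lessThan)
  qed
  \<comment> \<open>\<open>A k\<close> says that the first crossing happens at index
    \<open>k\<close>, so these events partition \<open>hit\<close>; \<open>A' k\<close> is the part
    where the overshoot is at most \<epsilon>.\<close>
  define A where "A = (\<lambda>k. {\<omega> \<in> space M. (\<forall>j<k. V j \<omega> \<le> x) \<and> x < V k \<omega>})"
  define A' where "A' = (\<lambda>k. {\<omega> \<in> A k. V k \<omega> \<le> x + \<epsilon>})"
  have A_meas [measurable]: "A k \<in> events" "A' k \<in> events" if "k \<le> m" for k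
  proof -
    have lt: "{\<omega> \<in> space M. x < V j \<omega>} \<in> events" if "j \<le> k" for j
      using Vm[of j] that \<open>k \<le> m\<close> by simp
    have "A k = {\<omega> \<in> space M. x < V k \<omega>} - (\<Union>j\<in>{..<k}. {\<omega> \<in> space M. x < V j \<omega>})"
      unfolding A_def by (auto simp: not_less)
    moreover have "(\<Union>j\<in>{..<k}. {\<omega> \<in> space M. x < V j \<omega>}) \<in> events"
      by (rule sets.finite_UN) (use lt in auto)
    ultimately show A: "A k \<in> events" using lt[OF order_refl] by (simp only: sets.Diff)
    have "A' k = A k \<inter> {\<omega> \<in> space M. V k \<omega> \<le> x + \<epsilon>}" by (auto simp: A'_def A_def)
    moreover have "{\<omega> \<in> space M. V k \<omega> \<le> x + \<epsilon>} \<in> events" using Vm[OF that] by simp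
    ultimately show "A' k \<in> events" using A by (simp only: sets.Int)
  qed
  have split: "(\<Sum>k\<le>m. indicator (A k) \<omega>) = (indicator hit \<omega> :: real)" for \<omega>
  proof (cases "\<omega> \<in> hit")
    case True
    define k where "k = (LEAST k. V k \<omega> > x)"
    obtain k' where k': "k' \<le> m" "V k' \<omega> > x" using True by (auto simp: hit_def)
    have "V k \<omega> > x" unfolding k_def using k'(2) by (rule LeastI)
    have "k \<le> k'" unfolding k_def using k'(2) by (rule Least_le)
    have less: "V j \<omega> \<le> x" if "j < k" for j using not_less_Least[of j "\<lambda>k. V k \<omega> > x"] that by (auto simp: k_def)
    have "indicator (A j) \<omega> = (if j = k then 1 else 0 :: real)" for j
    proof -
      have "\<omega> \<in> A j \<longleftrightarrow> j = k"
      proof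
        assume j: "\<omega> \<in> A j"
        show "j = k"
        proof (rule ccontr)
          assume "j \<noteq> k"
          then consider "j < k" | "k < j" by linarith
          then show False using j less \<open>V k \<omega> > x\<close> by cases (force simp: A_def)+
        qed
      next
        assume "j = k"
        then show "\<omega> \<in> A j" using less \<open>V k \<omega> > x\<close> True by (auto simp: A_def hit_def)
      qed
      then show ?thesis by (simp add: indicator_def)
    qed
    then show ?thesis using True \<open>k \<le> k'\<close> k' by simp
  next
    case False
    have "\<omega> \<notin> A k" if "k \<le> m" for k
    proof
      assume "\<omega> \<in> A k"
      then have "\<omega> \<in> hit" using that by (auto simp: hit_def A_def)
      then show False using False by simp
    qed
    then have "(\<Sum>k\<le>m. indicator (A k) \<omega>) = (0 :: real)" by (intro sum.neutral) simp
    then show ?thesis using False by simp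
  qed
  have intQ: "integrable M (\<lambda>\<omega>. Q m \<omega> * indicator B \<omega>)" if [measurable]: "B \<in> events" for B
    using Qm(1) by (intro integrable_mult_indicator[where 'b = real, simplified, unfolded mult.commute[of "indicator _ _"]]) auto
  define S where "S = (\<lambda>(v :: nat \<Rightarrow> real) k. (\<Sum>i<k. v i) - \<mu> * (real k * h))"
  have S: "S (R k \<omega>) j = V j \<omega>" if "j \<le> k" "k \<le> m" for j k \<omega>
  proof -
    have "(\<Sum>i<j. (R k \<omega>) i) = (\<Sum>i<j. \<xi> i \<omega>)"
      by (rule sum.cong) (use that in \<open>auto simp: R_def\<close>)
    then show ?thesis using V[of j \<omega>] that by (simp add: S_def)
  qed
  have S_meas [measurable]: "(\<lambda>v. S v j) \<in> borel_measurable (Pi\<^sub>M {..<k} (\<lambda>_. borel))" if "j \<le> k" for j k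
    unfolding S_def using that
    by (intro borel_measurable_diff borel_measurable_sum measurable_component_singleton) auto
  \<comment> \<open>Optional stopping, one index at a time: whether \<open>B\<close> occurs is
    decided by the first \<open>k\<close> increments, so its indicator can be the factor
    \<open>F\<close> of the martingale property.\<close>
  have stop: "expectation (\<lambda>\<omega>. Q m \<omega> * indicator B \<omega>) = expectation (\<lambda>\<omega>. Q k \<omega> * indicator B \<omega>)
      \<and> integrable M (\<lambda>\<omega>. Q k \<omega> * indicator B \<omega>)"
    if k: "k \<le> m" and P: "Measurable.pred (Pi\<^sub>M {..<k} (\<lambda>_. borel)) P"
      and B: "\<And>\<omega>. \<omega> \<in> space M \<Longrightarrow> \<omega> \<in> B \<longleftrightarrow> P (R k \<omega>)" for k P B
  proof
    define F :: "(nat \<Rightarrow> real) \<Rightarrow> real" where "F = (\<lambda>v. if P v then 1 else 0)"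
    have F: "F \<in> borel_measurable (Pi\<^sub>M {..<k} (\<lambda>_. borel))" unfolding F_def using P by measurable
    have Fb: "\<bar>F v\<bar> \<le> 1" for v by (simp add: F_def)
    have FB: "F (R k \<omega>) * Q n \<omega> = Q n \<omega> * indicator B \<omega>" if "\<omega> \<in> space M" for n \<omega>
      using B[OF that] by (simp add: F_def indicator_def)
    have "expectation (\<lambda>\<omega>. F (R k \<omega>) * Q n \<omega>) = expectation (\<lambda>\<omega>. Q n \<omega> * indicator B \<omega>)" for n
      by (intro Bochner_Integration.integral_cong refl FB)
    then show "expectation (\<lambda>\<omega>. Q m \<omega> * indicator B \<omega>) = expectation (\<lambda>\<omega>. Q k \<omega> * indicator B \<omega>)"
      using mart(3)[OF k F Fb] by simp
    have "integrable M (\<lambda>\<omega>. F (R k \<omega>) * Q k \<omega>) = integrable M (\<lambda>\<omega>. Q k \<omega> * indicator B \<omega>)"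
      by (intro Bochner_Integration.integrable_cong refl FB)
    then show "integrable M (\<lambda>\<omega>. Q k \<omega> * indicator B \<omega>)" using mart(2)[OF k F Fb] by simp
  qed
  have QA: "expectation (\<lambda>\<omega>. Q m \<omega> * indicator (A k) \<omega>) = expectation (\<lambda>\<omega>. Q k \<omega> * indicator (A k) \<omega>)
      \<and> integrable M (\<lambda>\<omega>. Q k \<omega> * indicator (A k) \<omega>)" if k: "k \<le> m" for k
    by (rule stop[of k "\<lambda>v. (\<forall>j<k. S v j \<le> x) \<and> x < S v k", OF k])
       (measurable, auto simp: A_def S k)
  have QA': "expectation (\<lambda>\<omega>. Q m \<omega> * indicator (A' k) \<omega>) = expectation (\<lambda>\<omega>. Q k \<omega> * indicator (A' k) \<omega>)
      \<and> integrable M (\<lambda>\<omega>. Q k \<omega> * indicator (A' k) \<omega>)" if k: "k \<le> m" for k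
    by (rule stop[of k "\<lambda>v. (\<forall>j<k. S v j \<le> x) \<and> x < S v k \<and> S v k \<le> x + \<epsilon>", OF k])
       (measurable, auto simp: A'_def A_def S k)
  have indA: "integrable M (\<lambda>\<omega>. indicator (A k) \<omega> :: real)" if "k \<le> m" for k
    by (rule integrable_const_bound[of _ 1]) (use that in \<open>auto simp: indicator_def\<close>)
  have prob_hit: "prob hit = (\<Sum>k\<le>m. prob (A k))"
  proof -
    have "prob hit = expectation (\<lambda>\<omega>. indicator hit \<omega>)" by simp
    also have "\<dots> = expectation (\<lambda>\<omega>. \<Sum>k\<le>m. indicator (A k) \<omega>)" unfolding split ..
    also have "\<dots> = (\<Sum>k\<le>m. expectation (\<lambda>\<omega>. indicator (A k) \<omega>))"
      by (rule Bochner_Integration.integral_sum) (use indA in auto)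
    finally show ?thesis by simp
  qed
  have E_hit: "expectation (\<lambda>\<omega>. Q m \<omega> * indicator hit \<omega>) = (\<Sum>k\<le>m. expectation (\<lambda>\<omega>. Q m \<omega> * indicator (A k) \<omega>))"
    unfolding split[symmetric] sum_distrib_left
    by (rule Bochner_Integration.integral_sum) (use intQ in auto)
  have "exp (2 * \<mu> * x) * prob hit = (\<Sum>k\<le>m. exp (2 * \<mu> * x) * prob (A k))"
    unfolding prob_hit sum_distrib_left ..
  also have "\<dots> \<le> (\<Sum>k\<le>m. expectation (\<lambda>\<omega>. Q m \<omega> * indicator (A k) \<omega>))"
  proof (rule sum_mono)
    fix k assume "k \<in> {..m}"
    then have k: "k \<le> m" by simp
    have "exp (2 * \<mu> * x) * prob (A k) = expectation (\<lambda>\<omega>. exp (2 * \<mu> * x) * indicator (A k) \<omega>)"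
      using k by simp
    also have "\<dots> \<le> expectation (\<lambda>\<omega>. Q k \<omega> * indicator (A k) \<omega>)"
    proof (rule integral_mono)
      show "integrable M (\<lambda>\<omega>. exp (2 * \<mu> * x) * indicator (A k) \<omega>)" using indA[OF k] by simp
      show "integrable M (\<lambda>\<omega>. Q k \<omega> * indicator (A k) \<omega>)" using QA[OF k] by simp
      show "exp (2 * \<mu> * x) * indicator (A k) \<omega> \<le> Q k \<omega> * indicator (A k) \<omega>" for \<omega>
        using pos(1) by (cases "\<omega> \<in> A k") (simp_all add: Q_def A_def)
    qed
    finally show "exp (2 * \<mu> * x) * prob (A k) \<le> expectation (\<lambda>\<omega>. Q m \<omega> * indicator (A k) \<omega>)"
      using QA[OF k] by simp
  qed
  finally show "exp (2 * \<mu> * x) * prob hit \<le> expectation (\<lambda>\<omega>. exp (2 * \<mu> * V m \<omega>) * indicator hit \<omega>)"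
    unfolding E_hit[symmetric] unfolding Q_def .
  have step: "expectation (\<lambda>\<omega>. Q m \<omega> * indicator (A k) \<omega>)
      \<le> exp (2 * \<mu> * (x + \<epsilon>)) * prob (A k) + expectation (\<lambda>\<omega>. Q m \<omega> * indicator (A k \<inter> over) \<omega>)" if k: "k \<le> m" for k
  proof -
    \<comment> \<open>Outside \<open>A' k\<close> the process jumps from at most \<open>x\<close> to
      above x + \<epsilon> in a single step. Index 0 is excluded, since \<open>V\<close> starts at
      0.\<close>
    have ptw: "indicator (A k) \<omega> \<le> (indicator (A' k) \<omega> + indicator (A k \<inter> over) \<omega> :: real)" for \<omega>
    proof (cases "\<omega> \<in> A k \<and> \<omega> \<notin> A' k")
      case True
      then have "\<omega> \<in> space M" "V k \<omega> > x + \<epsilon>" "\<forall>j<k. V j \<omega> \<le> x" by (auto simp: A_def A'_def)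
      moreover have "V 0 \<omega> = 0" using V[of 0 \<omega>] by simp
      ultimately obtain j where j: "k = Suc j" using pos by (cases k) auto
      then have "V (Suc j) \<omega> - V j \<omega> > \<epsilon>" using \<open>V k \<omega> > x + \<epsilon>\<close> \<open>\<forall>j<k. V j \<omega> \<le> x\<close> by fastforce
      then have "\<omega> \<in> over" using j k \<open>\<omega> \<in> space M\<close> unfolding over_def by (auto intro!: exI[of _ j])
      then show ?thesis using True by (simp add: indicator_def)
    qed (auto simp: indicator_def A'_def)
    have "expectation (\<lambda>\<omega>. Q m \<omega> * indicator (A k) \<omega>)
        \<le> expectation (\<lambda>\<omega>. Q m \<omega> * indicator (A' k) \<omega> + Q m \<omega> * indicator (A k \<inter> over) \<omega>)"
    proof (rule integral_mono)
      show "Q m \<omega> * indicator (A k) \<omega> \<le> Q m \<omega> * indicator (A' k) \<omega> + Q m \<omega> * indicator (A k \<inter> over) \<omega>" for \<omega>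
        unfolding distrib_left[symmetric] by (rule mult_left_mono[OF ptw]) (simp add: Q_def)
    qed (use k in \<open>auto intro!: intQ A_meas sets.Int Bochner_Integration.integrable_add \<open>over \<in> events\<close>\<close>)
    also have "\<dots> = expectation (\<lambda>\<omega>. Q k \<omega> * indicator (A' k) \<omega>) + expectation (\<lambda>\<omega>. Q m \<omega> * indicator (A k \<inter> over) \<omega>)"
      using QA'[OF k] k by (subst Bochner_Integration.integral_add) (auto intro!: intQ A_meas sets.Int \<open>over \<in> events\<close>)
    also have "expectation (\<lambda>\<omega>. Q k \<omega> * indicator (A' k) \<omega>) \<le> expectation (\<lambda>\<omega>. exp (2 * \<mu> * (x + \<epsilon>)) * indicator (A k) \<omega>)"
    proof (rule integral_mono)
      show "integrable M (\<lambda>\<omega>. exp (2 * \<mu> * (x + \<epsilon>)) * indicator (A k) \<omega>)" using indA[OF k] by simp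
      show "integrable M (\<lambda>\<omega>. Q k \<omega> * indicator (A' k) \<omega>)" using QA'[OF k] by simp
      show "Q k \<omega> * indicator (A' k) \<omega> \<le> exp (2 * \<mu> * (x + \<epsilon>)) * indicator (A k) \<omega>" for \<omega>
        using pos(1) by (cases "\<omega> \<in> A' k") (simp_all add: Q_def A'_def)
    qed
    finally show ?thesis using k by simp
  qed
  have "(\<Sum>k\<le>m. expectation (\<lambda>\<omega>. Q m \<omega> * indicator (A k \<inter> over) \<omega>))
      = expectation (\<lambda>\<omega>. \<Sum>k\<le>m. Q m \<omega> * indicator (A k \<inter> over) \<omega>)"
    by (rule Bochner_Integration.integral_sum[symmetric]) (auto intro!: intQ)
  also have "\<dots> = expectation (\<lambda>\<omega>. Q m \<omega> * indicator (hit \<inter> over) \<omega>)"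
    unfolding indicator_inter_arith split[symmetric] by (simp only: sum_distrib_left sum_distrib_right)
  also have "\<dots> \<le> expectation (\<lambda>\<omega>. Q m \<omega> * indicator over \<omega>)"
  proof (rule integral_mono)
    show "integrable M (\<lambda>\<omega>. Q m \<omega> * indicator (hit \<inter> over) \<omega>)" by (rule intQ) simp
    show "integrable M (\<lambda>\<omega>. Q m \<omega> * indicator over \<omega>)" by (rule intQ) simp
    show "Q m \<omega> * indicator (hit \<inter> over) \<omega> \<le> Q m \<omega> * indicator over \<omega>" for \<omega>
      by (rule mult_left_mono) (simp_all add: indicator_def Q_def)
  qed
  finally have over: "(\<Sum>k\<le>m. expectation (\<lambda>\<omega>. Q m \<omega> * indicator (A k \<inter> over) \<omega>)) \<le> expectation (\<lambda>\<omega>. Q m \<omega> * indicator over \<omega>)" .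
  have "expectation (\<lambda>\<omega>. Q m \<omega> * indicator hit \<omega>)
      \<le> (\<Sum>k\<le>m. exp (2 * \<mu> * (x + \<epsilon>)) * prob (A k) + expectation (\<lambda>\<omega>. Q m \<omega> * indicator (A k \<inter> over) \<omega>))"
    unfolding E_hit by (intro sum_mono step) simp
  also have "\<dots> \<le> exp (2 * \<mu> * (x + \<epsilon>)) * prob hit + expectation (\<lambda>\<omega>. Q m \<omega> * indicator over \<omega>)"
    using over by (simp add: sum.distrib prob_hit sum_distrib_left)
  finally show "expectation (\<lambda>\<omega>. exp (2 * \<mu> * V m \<omega>) * indicator hit \<omega>)
      \<le> exp (2 * \<mu> * (x + \<epsilon>)) * prob hit + expectation (\<lambda>\<omega>. exp (2 * \<mu> * V m \<omega>) * indicator over \<omega>)"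
    unfolding Q_def .
qed

section \<open>The one-dimensional bridge and its Brownian motion\<close>

text \<open>The projection of a planar bridge to a line. The start is 0 at every sample point, not
  merely almost surely, so that sums of increments telescope to the time-changed process
  itself.\<close>

locale std_bridge = prob_space M for M :: "'a measure" +
  fixes \<beta> :: "real \<Rightarrow> 'a \<Rightarrow> real"
  assumes meas: "t \<in> {0..1} \<Longrightarrow> \<beta> t \<in> borel_measurable M"
    and gauss: "finite T \<Longrightarrow> T \<subseteq> {0..1} \<Longrightarrow> gaussian_rv M (\<lambda>\<omega>. \<Sum>t\<in>T. c t * \<beta> t \<omega>)"
    and cont: "\<omega> \<in> space M \<Longrightarrow> continuous_on {0..1} (\<lambda>t. \<beta> t \<omega>)"
    and mean: "t \<in> {0..1} \<Longrightarrow> expectation (\<beta> t) = 0"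
    and cov: "s \<in> {0..1} \<Longrightarrow> t \<in> {0..1} \<Longrightarrow> expectation (\<lambda>\<omega>. \<beta> s \<omega> * \<beta> t \<omega>) = min s t - s * t"
    and zero: "\<omega> \<in> space M \<Longrightarrow> \<beta> 0 \<omega> = 0"

text \<open>Repeated times are allowed, their coefficients being collected. This is needed since
  neighbouring increments share an end point.\<close>

lemma (in std_bridge) gauss_family:
  assumes I: "finite I" and \<tau>: "\<And>i. i \<in> I \<Longrightarrow> \<tau> i \<in> {0..1}"
  shows "gaussian_rv M (\<lambda>\<omega>. \<Sum>i\<in>I. c i * \<beta> (\<tau> i) \<omega>)"
proof -
  have "(\<Sum>i\<in>I. c i * \<beta> (\<tau> i) \<omega>) = (\<Sum>t\<in>\<tau> ` I. (\<Sum>i\<in>{i\<in>I. \<tau> i = t}. c i) * \<beta> t \<omega>)" for \<omega>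
  proof -
    have "(\<Sum>i\<in>I. c i * \<beta> (\<tau> i) \<omega>) = (\<Sum>t\<in>\<tau> ` I. \<Sum>i\<in>{i\<in>I. \<tau> i = t}. c i * \<beta> (\<tau> i) \<omega>)"
      by (rule sum.image_gen[OF I])
    also have "\<dots> = (\<Sum>t\<in>\<tau> ` I. (\<Sum>i\<in>{i\<in>I. \<tau> i = t}. c i) * \<beta> t \<omega>)"
      unfolding sum_distrib_right by (intro sum.cong refl) auto
    finally show ?thesis .
  qed
  moreover have "gaussian_rv M (\<lambda>\<omega>. \<Sum>t\<in>\<tau> ` I. (\<Sum>i\<in>{i\<in>I. \<tau> i = t}. c i) * \<beta> t \<omega>)"
    using I \<tau> by (intro gauss) auto
  ultimately show ?thesis by presburger
qed

lemma (in std_bridge) integrable_bridge: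
  assumes "s \<in> {0..1}" "t \<in> {0..1}"
  shows "integrable M (\<beta> s)" "integrable M (\<lambda>\<omega>. \<beta> s \<omega> * \<beta> t \<omega>)"
proof -
  have g: "gaussian_rv M (\<beta> r)" if "r \<in> {0..1}" for r
    using gauss[of "{r}" "\<lambda>_. 1"] that by simp
  have [measurable]: "\<beta> s \<in> borel_measurable M" "\<beta> t \<in> borel_measurable M"
    using meas assms by blast+
  show "integrable M (\<beta> s)" using gaussian_centered(1)[OF g mean] assms by blast
  show "integrable M (\<lambda>\<omega>. \<beta> s \<omega> * \<beta> t \<omega>)"
    using gaussian_centered(2)[OF g mean] assms by (intro integrable_mult_of_squares) auto
qed

text \<open>The change of time \<open>t = s / (1 + s)\<close> turns the bridge into a Brownian motion on \<open>[0,\<infinity>)\<close>, and the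
  bridge staying below the line \<open>x - y t\<close> into the Brownian motion staying below
  \<open>x + (x - y) s\<close>.\<close>

definition (in std_bridge) W :: "real \<Rightarrow> 'a \<Rightarrow> real" where
  "W s \<omega> = (1 + s) * \<beta> (s / (1 + s)) \<omega>"

lemma time_change_mem: "0 \<le> s \<Longrightarrow> s / (1 + s) \<in> {0..1::real}"
  by (auto simp: field_simps)

lemma (in std_bridge) W_0 [simp]: "\<omega> \<in> space M \<Longrightarrow> W 0 \<omega> = 0"
  by (simp add: W_def zero)

lemma (in std_bridge) W_measurable: "0 \<le> s \<Longrightarrow> W s \<in> borel_measurable M"
  unfolding W_def[abs_def] by (intro borel_measurable_times meas time_change_mem) auto

lemma (in std_bridge) W_integrable:
  assumes "0 \<le> s" "0 \<le> r"
  shows "integrable M (W s)" "integrable M (\<lambda>\<omega>. W s \<omega> * W r \<omega>)"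
proof -
  show "integrable M (W s)"
    unfolding W_def[abs_def] by (intro integrable_mult_right integrable_bridge(1)[OF time_change_mem[OF assms(1)] time_change_mem[OF assms(1)]])
  have "integrable M (\<lambda>\<omega>. ((1 + s) * (1 + r)) * (\<beta> (s / (1 + s)) \<omega> * \<beta> (r / (1 + r)) \<omega>))"
    by (intro integrable_mult_right integrable_bridge(2) time_change_mem assms)
  then show "integrable M (\<lambda>\<omega>. W s \<omega> * W r \<omega>)" by (simp add: W_def mult_ac)
qed

lemma (in std_bridge) W_mean: "0 \<le> s \<Longrightarrow> expectation (W s) = 0"
  unfolding W_def[abs_def] using mean[OF time_change_mem] by simp

text \<open>For s at most r the bridge covariance at the changed times is s / (1 + s) times 1 / (1 +
  r), and the prefactors of \<open>W\<close> leave exactly s: the covariance of Brownian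
  motion.\<close>

lemma (in std_bridge) W_cov:
  assumes "0 \<le> s" "0 \<le> r"
  shows "expectation (\<lambda>\<omega>. W s \<omega> * W r \<omega>) = min s r"
proof -
  have "expectation (\<lambda>\<omega>. W s \<omega> * W r \<omega>)
      = expectation (\<lambda>\<omega>. ((1 + s) * (1 + r)) * (\<beta> (s / (1 + s)) \<omega> * \<beta> (r / (1 + r)) \<omega>))"
    by (simp add: W_def mult_ac)
  also have "\<dots> = ((1 + s) * (1 + r)) * (min (s / (1 + s)) (r / (1 + r)) - s / (1 + s) * (r / (1 + r)))"
    using cov[OF time_change_mem time_change_mem, OF assms] by simp
  also have "min (s / (1 + s)) (r / (1 + r)) = min s r / (1 + min s r)"
    using assms by (cases "s \<le> r") (auto simp: min_def field_simps)
  also have "((1 + s) * (1 + r)) * (min s r / (1 + min s r) - s / (1 + s) * (r / (1 + r))) = min s r"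
  proof -
    have *: "(1 + s) * (1 + r) * (s / (1 + s) - s / (1 + s) * (r / (1 + r))) = s * (1 + r - r)"
      "(1 + s) * (1 + r) * (r / (1 + r) - s / (1 + s) * (r / (1 + r))) = r * (1 + s - s)"
      if "1 + s \<noteq> 0" "1 + r \<noteq> 0" for s r :: real
      using that by (simp_all add: right_diff_distrib, simp_all add: algebra_simps)
    have "1 + s \<noteq> 0" "1 + r \<noteq> 0" using assms by auto
    then show ?thesis
      using *[of s r] by (cases "s \<le> r") (simp_all add: min_def)
  qed
  finally show ?thesis .
qed

definition (in std_bridge) inc :: "real \<Rightarrow> nat \<Rightarrow> 'a \<Rightarrow> real" where
  "inc h i \<omega> = W (real (Suc i) * h) \<omega> - W (real i * h) \<omega>"

lemma (in std_bridge) inc_cov: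
  assumes "0 \<le> h"
  shows "integrable M (\<lambda>\<omega>. inc h i \<omega> * inc h j \<omega>)"
    and "expectation (\<lambda>\<omega>. inc h i \<omega> * inc h j \<omega>) = (if i = j then h else 0)"
proof -
  let ?a = "real (Suc i) * h" and ?b = "real i * h" and ?c = "real (Suc j) * h" and ?d = "real j * h"
  have nn: "0 \<le> ?a" "0 \<le> ?b" "0 \<le> ?c" "0 \<le> ?d" using assms by auto
  have eq: "inc h i \<omega> * inc h j \<omega> = (W ?a \<omega> * W ?c \<omega> - W ?a \<omega> * W ?d \<omega>) - (W ?b \<omega> * W ?c \<omega> - W ?b \<omega> * W ?d \<omega>)" for \<omega>
    by (simp add: inc_def algebra_simps)
  show "integrable M (\<lambda>\<omega>. inc h i \<omega> * inc h j \<omega>)"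
    unfolding eq by (intro Bochner_Integration.integrable_diff W_integrable nn)
  have "expectation (\<lambda>\<omega>. inc h i \<omega> * inc h j \<omega>) = (min ?a ?c - min ?a ?d) - (min ?b ?c - min ?b ?d)"
    unfolding eq using nn
    by (simp only: Bochner_Integration.integral_diff Bochner_Integration.integrable_diff W_integrable W_cov)
  also have "\<dots> = (if i = j then h else 0)"
  proof -
    have min: "min (real k * h) (real l * h) = real (min k l) * h" for k l
      using assms by (simp add: min_mult_distrib_right of_nat_min)
    consider "i = j" | "i < j" | "j < i" by linarith
    then show ?thesis
    proof cases
      case 2
      then have "min (Suc i) (Suc j) = Suc i" "min (Suc i) j = Suc i" "min i (Suc j) = i" "min i j = i" by auto
      then show ?thesis using 2 unfolding min by simp
    next
      case 3
      then have "min (Suc i) (Suc j) = Suc j" "min (Suc i) j = j" "min i (Suc j) = Suc j" "min i j = j" by auto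
      then show ?thesis using 3 unfolding min by simp
    next
      case 1
      have "min (Suc j) (Suc j) = Suc j" "min (Suc j) j = j" "min j (Suc j) = j" "min j j = j" by auto
      then show ?thesis unfolding 1 min by (simp add: algebra_simps)
    qed
  qed
  finally show "expectation (\<lambda>\<omega>. inc h i \<omega> * inc h j \<omega>) = (if i = j then h else 0)" .
qed

lemma (in std_bridge) inc_gaussian:
  assumes "0 \<le> h" "finite I"
  shows "gaussian_rv M (\<lambda>\<omega>. \<Sum>i\<in>I. a i * inc h i \<omega>)"
    and "expectation (\<lambda>\<omega>. \<Sum>i\<in>I. a i * inc h i \<omega>) = 0"
    and "expectation (\<lambda>\<omega>. (\<Sum>i\<in>I. a i * inc h i \<omega>)\<^sup>2) = h * (\<Sum>i\<in>I. (a i)\<^sup>2)"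
proof -
  \<comment> \<open>Each increment is a difference of two multiples of bridge values; the index set
    \<open>I \<times> UNIV\<close> pairs it with a boolean that selects the right or the left end of
    its interval.\<close>
  let ?t = "\<lambda>p::nat \<times> bool. real (if snd p then Suc (fst p) else fst p) * h"
  let ?c = "\<lambda>p::nat \<times> bool. (if snd p then a (fst p) else - a (fst p)) * (1 + ?t p)"
  have "(\<Sum>i\<in>I. a i * inc h i \<omega>) = (\<Sum>p\<in>I \<times> UNIV. ?c p * \<beta> (?t p / (1 + ?t p)) \<omega>)" for \<omega>
  proof -
    have "(\<Sum>p\<in>I \<times> UNIV. ?c p * \<beta> (?t p / (1 + ?t p)) \<omega>)
        = (\<Sum>i\<in>I. \<Sum>b\<in>UNIV. ?c (i, b) * \<beta> (?t (i, b) / (1 + ?t (i, b))) \<omega>)"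
      unfolding sum.cartesian_product by (intro sum.cong refl) (simp only: case_prod_beta prod.collapse)
    also have "\<dots> = (\<Sum>i\<in>I. a i * inc h i \<omega>)"
      by (intro sum.cong refl) (simp add: UNIV_bool inc_def W_def algebra_simps)
    finally show ?thesis by (rule sym)
  qed
  moreover have "gaussian_rv M (\<lambda>\<omega>. \<Sum>p\<in>I \<times> UNIV. ?c p * \<beta> (?t p / (1 + ?t p)) \<omega>)"
    by (intro gauss_family time_change_mem) (use assms in simp_all)
  ultimately show "gaussian_rv M (\<lambda>\<omega>. \<Sum>i\<in>I. a i * inc h i \<omega>)" by presburger
  have inc: "integrable M (inc h i)" "expectation (inc h i) = 0" for i
  proof -
    have nn: "0 \<le> real (Suc i) * h" "0 \<le> real i * h" using assms by auto
    show "integrable M (inc h i)"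
      unfolding inc_def[abs_def] by (intro Bochner_Integration.integrable_diff W_integrable(1)[OF _ nn(1)] nn)
    show "expectation (inc h i) = 0"
      unfolding inc_def[abs_def]
      by (subst Bochner_Integration.integral_diff) (use W_integrable(1) W_mean nn in \<open>simp_all del: of_nat_Suc\<close>)
  qed
  then show "expectation (\<lambda>\<omega>. \<Sum>i\<in>I. a i * inc h i \<omega>) = 0"
    by (subst Bochner_Integration.integral_sum) simp_all
  have "(\<Sum>i\<in>I. a i * inc h i \<omega>)\<^sup>2 = (\<Sum>i\<in>I. \<Sum>j\<in>I. (a i * a j) * (inc h i \<omega> * inc h j \<omega>))" for \<omega>
    unfolding power2_eq_square sum_product by (intro sum.cong refl) simp
  then have "expectation (\<lambda>\<omega>. (\<Sum>i\<in>I. a i * inc h i \<omega>)\<^sup>2)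
      = (\<Sum>i\<in>I. \<Sum>j\<in>I. (a i * a j) * (if i = j then h else 0))"
    using inc_cov[OF assms(1)]
    by (simp only: Bochner_Integration.integral_sum Bochner_Integration.integrable_sum integrable_mult_right
        integral_mult_right_zero)
  also have "\<dots> = (\<Sum>i\<in>I. a i * a i * h)"
    by (intro sum.cong refl) (simp add: if_distrib assms(2) sum.delta cong: if_cong)
  also have "\<dots> = h * (\<Sum>i\<in>I. (a i)\<^sup>2)"
    unfolding sum_distrib_left by (intro sum.cong refl) (simp add: power2_eq_square)
  finally show "expectation (\<lambda>\<omega>. (\<Sum>i\<in>I. a i * inc h i \<omega>)\<^sup>2) = h * (\<Sum>i\<in>I. (a i)\<^sup>2)" .
qed

lemma (in std_bridge) inc_char:
  assumes "0 \<le> h" "finite I"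
  shows "(CLINT \<omega>|M. (\<Prod>i\<in>I. iexp (a i * inc h i \<omega>))) = of_real (exp (- (h * (\<Sum>i\<in>I. (a i)\<^sup>2)) / 2))"
proof -
  have "(\<Prod>i\<in>I. iexp (a i * inc h i \<omega>)) = iexp (\<Sum>i\<in>I. a i * inc h i \<omega>)" for \<omega>
    unfolding of_real_sum sum_distrib_left using assms(2) by (rule exp_sum[symmetric])
  then have "(CLINT \<omega>|M. (\<Prod>i\<in>I. iexp (a i * inc h i \<omega>))) = (CLINT \<omega>|M. iexp (\<Sum>i\<in>I. a i * inc h i \<omega>))"
    by presburger
  also have "\<dots> = of_real (exp (- expectation (\<lambda>\<omega>. (\<Sum>i\<in>I. a i * inc h i \<omega>)\<^sup>2) / 2))"
    by (rule gaussian_char[OF inc_gaussian(1,2)[OF assms]])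
  finally show ?thesis unfolding inc_gaussian(3)[OF assms] .
qed

text \<open>The increments are uncorrelated, so the variance of a linear combination is
  \<open>h\<close> times the sum of the squared coefficients, and the joint characteristic function
  factorises.\<close>

lemma (in std_bridge) inc_indep:
  assumes "0 \<le> h" "0 < m"
  shows "indep_vars (\<lambda>_. borel) (inc h) {..<m}"
proof (rule indep_vars_char)
  show "inc h i \<in> borel_measurable M" for i
    unfolding inc_def[abs_def] using assms by (intro borel_measurable_diff W_measurable) auto
  fix t
  have "(CLINT \<omega>|M. iexp (t i * inc h i \<omega>)) = of_real (exp (- (h * (t i)\<^sup>2) / 2))" for i
    using inc_char[OF assms(1), of "{i}" t] by (simp only: prod.insert prod.empty sum.insert sum.empty finite.intros empty_iff not_False_eq_True mult_1_right add_0_right)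
  then have "(\<Prod>i<m. CLINT \<omega>|M. iexp (t i * inc h i \<omega>)) = of_real (\<Prod>i<m. exp (- (h * (t i)\<^sup>2) / 2))"
    by (simp only: of_real_prod)
  also have "(\<Prod>i<m. exp (- (h * (t i)\<^sup>2) / 2)) = exp (- (h * (\<Sum>i<m. (t i)\<^sup>2)) / 2)"
    by (simp add: exp_sum[symmetric] sum_negf sum_divide_distrib sum_distrib_left)
  finally show "(CLINT \<omega>|M. (\<Prod>i<m. iexp (t i * inc h i \<omega>))) = (\<Prod>i<m. CLINT \<omega>|M. iexp (t i * inc h i \<omega>))"
    using inc_char[OF assms(1), of "{..<m}" t] by simp
qed (use assms in auto)

lemma (in std_bridge) inc_mgf:
  assumes "0 \<le> h"
  shows "integrable M (\<lambda>\<omega>. exp (l * inc h i \<omega>))" "expectation (\<lambda>\<omega>. exp (l * inc h i \<omega>)) = exp (l\<^sup>2 * h / 2)"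
proof -
  have g: "gaussian_rv M (inc h i)" "expectation (inc h i) = 0" "expectation (\<lambda>\<omega>. (inc h i \<omega>)\<^sup>2) = h"
    using inc_gaussian[OF assms, of "{i}" "\<lambda>_. 1"] by simp_all
  show "integrable M (\<lambda>\<omega>. exp (l * inc h i \<omega>))" "expectation (\<lambda>\<omega>. exp (l * inc h i \<omega>)) = exp (l\<^sup>2 * h / 2)"
    using gaussian_mgf[OF g(1,2), of l] g(3) by simp_all
qed

lemma (in std_bridge) W_continuous:
  assumes "\<omega> \<in> space M"
  shows "continuous_on {0..} (\<lambda>s. W s \<omega>)"
  unfolding W_def
proof (intro continuous_intros)
  show "continuous_on {0..} (\<lambda>s. \<beta> (s / (1 + s)) \<omega>)"
  proof (rule continuous_on_compose2[OF cont[OF assms]])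
    show "continuous_on {0..} (\<lambda>s::real. s / (1 + s))" by (intro continuous_intros) auto
    show "(\<lambda>s::real. s / (1 + s)) ` {0..} \<subseteq> {0..1}" using time_change_mem by auto
  qed
qed

section \<open>From dyadic grids to continuous paths\<close>

text \<open>The horizon \<open>T\<close> is a natural number so that every dyadic grid ends exactly
  there.\<close>

definition (in std_bridge) hits :: "real \<Rightarrow> real \<Rightarrow> nat \<Rightarrow> 'a set" where
  "hits \<mu> x T = {\<omega> \<in> space M. \<exists>s\<in>{0..real T}. W s \<omega> - \<mu> * s > x}"

definition (in std_bridge) grid_hits :: "real \<Rightarrow> real \<Rightarrow> nat \<Rightarrow> nat \<Rightarrow> 'a set" where
  "grid_hits \<mu> x T n = {\<omega> \<in> space M. \<exists>k\<le>T * 2 ^ n. W (real k * (1 / 2 ^ n)) \<omega> - \<mu> * (real k * (1 / 2 ^ n)) > x}"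

definition (in std_bridge) grid_jumps :: "real \<Rightarrow> real \<Rightarrow> nat \<Rightarrow> nat \<Rightarrow> 'a set" where
  "grid_jumps \<mu> \<epsilon> T n = {\<omega> \<in> space M. \<exists>k<T * 2 ^ n.
    (W (real (Suc k) * (1 / 2 ^ n)) \<omega> - \<mu> * (real (Suc k) * (1 / 2 ^ n)))
      - (W (real k * (1 / 2 ^ n)) \<omega> - \<mu> * (real k * (1 / 2 ^ n))) > \<epsilon>}"

text \<open>\<open>grid_overshoot\<close> for the increments of mesh \<open>1 / 2 ^ n\<close>. The
  final value of the martingale is the same for every \<open>n\<close>, so it can serve as the
  dominating function when the mesh tends to 0.\<close>

lemma (in std_bridge) grid_bounds:
  assumes "\<mu> > 0" "x \<ge> 0" "\<epsilon> \<ge> 0" "0 < T"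
  shows "grid_hits \<mu> x T n \<in> events" "grid_jumps \<mu> \<epsilon> T n \<in> events"
    and "integrable M (\<lambda>\<omega>. exp (2 * \<mu> * (W T \<omega> - \<mu> * T)))" "expectation (\<lambda>\<omega>. exp (2 * \<mu> * (W T \<omega> - \<mu> * T))) = 1"
    and "exp (2 * \<mu> * x) * prob (grid_hits \<mu> x T n) \<le> expectation (\<lambda>\<omega>. exp (2 * \<mu> * (W T \<omega> - \<mu> * T)) * indicator (grid_hits \<mu> x T n) \<omega>)"
    and "expectation (\<lambda>\<omega>. exp (2 * \<mu> * (W T \<omega> - \<mu> * T)) * indicator (grid_hits \<mu> x T n) \<omega>)
      \<le> exp (2 * \<mu> * (x + \<epsilon>)) * prob (grid_hits \<mu> x T n)
        + expectation (\<lambda>\<omega>. exp (2 * \<mu> * (W T \<omega> - \<mu> * T)) * indicator (grid_jumps \<mu> \<epsilon> T n) \<omega>)"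
proof -
  define h :: real where "h = 1 / 2 ^ n"
  define m where "m = T * 2 ^ n"
  define V where "V = (\<lambda>k \<omega>. (\<Sum>i<k. inc h i \<omega>) - \<mu> * (real k * h))"
  have "0 \<le> h" "0 < m" using assms by (auto simp: h_def m_def)
  have mgf: "expectation (\<lambda>\<omega>. exp (2 * \<mu> * inc h i \<omega>)) = exp (2 * \<mu>\<^sup>2 * h)" for i
    using inc_mgf(2)[OF \<open>0 \<le> h\<close>, of "2 * \<mu>" i] by (simp add: power_mult_distrib)
  have V_eq: "V k \<omega> = W (real k * h) \<omega> - \<mu> * (real k * h)" if "\<omega> \<in> space M" for k \<omega>
  proof -
    have "(\<Sum>i<k. inc h i \<omega>) = W (real k * h) \<omega> - W (real 0 * h) \<omega>"
      unfolding inc_def by (rule sum_lessThan_telescope)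
    then show ?thesis using that by (simp add: V_def)
  qed
  have mh: "real m * h = T" by (simp add: m_def h_def)
  have hit: "{\<omega> \<in> space M. \<exists>k\<le>m. V k \<omega> > x} = grid_hits \<mu> x T n"
    unfolding grid_hits_def m_def[symmetric] h_def[symmetric] using V_eq by auto
  have over: "{\<omega> \<in> space M. \<exists>k<m. V (Suc k) \<omega> - V k \<omega> > \<epsilon>} = grid_jumps \<mu> \<epsilon> T n"
    unfolding grid_jumps_def m_def[symmetric] h_def[symmetric] using V_eq by auto
  have V_m: "V m \<omega> = W T \<omega> - \<mu> * T" if "\<omega> \<in> space M" for \<omega>
    using V_eq[OF that, of m] unfolding mh .
  note g = grid_overshoot[OF inc_indep[OF \<open>0 \<le> h\<close> \<open>0 < m\<close>] inc_mgf(1)[OF \<open>0 \<le> h\<close>] mgf assms(1-3), of V, OF V_def[THEN fun_cong, THEN fun_cong],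
      unfolded hit over]
  show "grid_hits \<mu> x T n \<in> events" "grid_jumps \<mu> \<epsilon> T n \<in> events" by (rule g(1), rule g(2))
  have E: "expectation (\<lambda>\<omega>. exp (2 * \<mu> * V m \<omega>) * indicator B \<omega>) = expectation (\<lambda>\<omega>. exp (2 * \<mu> * (W T \<omega> - \<mu> * T)) * indicator B \<omega>)" for B
    by (intro Bochner_Integration.integral_cong refl) (simp add: V_m)
  show "integrable M (\<lambda>\<omega>. exp (2 * \<mu> * (W T \<omega> - \<mu> * T)))"
    using g(3) by (rule Bochner_Integration.integrable_cong[THEN iffD1, rotated 2]) (simp_all add: V_m)
  have "expectation (\<lambda>\<omega>. exp (2 * \<mu> * (W T \<omega> - \<mu> * T))) = expectation (\<lambda>\<omega>. exp (2 * \<mu> * V m \<omega>))"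
    by (intro Bochner_Integration.integral_cong refl) (simp add: V_m)
  then show "expectation (\<lambda>\<omega>. exp (2 * \<mu> * (W T \<omega> - \<mu> * T))) = 1" using g(4) by simp
  show "exp (2 * \<mu> * x) * prob (grid_hits \<mu> x T n) \<le> expectation (\<lambda>\<omega>. exp (2 * \<mu> * (W T \<omega> - \<mu> * T)) * indicator (grid_hits \<mu> x T n) \<omega>)"
    using g(5) unfolding E .
  show "expectation (\<lambda>\<omega>. exp (2 * \<mu> * (W T \<omega> - \<mu> * T)) * indicator (grid_hits \<mu> x T n) \<omega>)
      \<le> exp (2 * \<mu> * (x + \<epsilon>)) * prob (grid_hits \<mu> x T n)
        + expectation (\<lambda>\<omega>. exp (2 * \<mu> * (W T \<omega> - \<mu> * T)) * indicator (grid_jumps \<mu> \<epsilon> T n) \<omega>)"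
    using g(6) unfolding E .
qed

lemma (in std_bridge) grid_hits_subset: "grid_hits \<mu> x T n \<subseteq> hits \<mu> x T"
proof
  fix \<omega> assume "\<omega> \<in> grid_hits \<mu> x T n"
  then obtain k where k: "\<omega> \<in> space M" "k \<le> T * 2 ^ n" "W (real k * (1 / 2 ^ n)) \<omega> - \<mu> * (real k * (1 / 2 ^ n)) > x"
    by (auto simp: grid_hits_def)
  have "real k \<le> real (T * 2 ^ n)" using k(2) by (simp only: of_nat_le_iff)
  then have "real k \<le> real T * 2 ^ n" by simp
  then have "real k * (1 / 2 ^ n) \<in> {0..real T}" by (simp add: pos_divide_le_eq)
  then show "\<omega> \<in> hits \<mu> x T" using k unfolding hits_def by blast
qed

text \<open>A strict excess at \<open>s\<close> persists nearby by continuity. The dyadic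
  approximations are taken from below, by rounding down, which keeps them in the time
  interval.\<close>

lemma (in std_bridge) grid_hits_eventually:
  assumes "\<omega> \<in> hits \<mu> x T"
  shows "\<forall>\<^sub>F n in sequentially. \<omega> \<in> grid_hits \<mu> x T n"
proof -
  obtain s where s: "\<omega> \<in> space M" "0 \<le> s" "s \<le> real T" "W s \<omega> - \<mu> * s > x"
    using assms by (auto simp: hits_def)
  define a where "a = (\<lambda>n::nat. real (nat \<lfloor>s * 2 ^ n\<rfloor>) * (1 / 2 ^ n))"
  have fl: "real (nat \<lfloor>s * 2 ^ n\<rfloor>) = of_int \<lfloor>s * 2 ^ n\<rfloor>" for n using s by simp
  have a_le: "a n \<le> s" and a_ge: "s - (1 / 2) ^ n \<le> a n" and a_nn: "0 \<le> a n" for n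
  proof -
    have "of_int \<lfloor>s * 2 ^ n\<rfloor> \<le> s * 2 ^ n" "s * 2 ^ n - 1 \<le> of_int \<lfloor>s * 2 ^ n\<rfloor>" by linarith+
    then have "of_int \<lfloor>s * 2 ^ n\<rfloor> * (1 / 2 ^ n) \<le> s * 2 ^ n * (1 / 2 ^ n)"
      "(s * 2 ^ n - 1) * (1 / 2 ^ n) \<le> of_int \<lfloor>s * 2 ^ n\<rfloor> * (1 / 2 ^ n)"
      by (intro mult_right_mono; simp)+
    moreover have "s * 2 ^ n * (1 / 2 ^ n) = s" "(s * 2 ^ n - 1) * (1 / 2 ^ n) = s - (1 / 2) ^ n"
      by (simp_all add: diff_divide_distrib power_divide)
    ultimately show "a n \<le> s" "s - (1 / 2) ^ n \<le> a n" unfolding a_def fl by simp_all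
    show "0 \<le> a n" by (simp add: a_def)
  qed
  have "a \<longlonglongrightarrow> s"
  proof (rule tendsto_sandwich[of "\<lambda>n. s - (1 / 2) ^ n" a sequentially "\<lambda>_. s"])
    have "(\<lambda>n. s - (1 / 2) ^ n) \<longlonglongrightarrow> s - 0" by (intro tendsto_intros LIMSEQ_realpow_zero) auto
    then show "(\<lambda>n. s - (1 / 2) ^ n) \<longlonglongrightarrow> s" by simp
  qed (use a_le a_ge in auto)
  moreover have "continuous_on {0..} (\<lambda>s. W s \<omega> - \<mu> * s)"
    by (intro continuous_intros W_continuous s)
  ultimately have "(\<lambda>n. W (a n) \<omega> - \<mu> * a n) \<longlonglongrightarrow> W s \<omega> - \<mu> * s"
    using s a_nn by (auto simp: continuous_on_sequentially o_def)
  from order_tendstoD(1)[OF this s(4)]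
  show ?thesis
  proof eventually_elim
    case (elim n)
    have "of_int \<lfloor>s * 2 ^ n\<rfloor> \<le> real (T * 2 ^ n)"
    proof -
      have "of_int \<lfloor>s * 2 ^ n\<rfloor> \<le> s * 2 ^ n" by linarith
      also have "\<dots> \<le> real T * 2 ^ n" using s by simp
      finally show ?thesis by simp
    qed
    then have "nat \<lfloor>s * 2 ^ n\<rfloor> \<le> T * 2 ^ n" unfolding fl[symmetric] by (simp only: of_nat_le_iff)
    then show ?case using elim s(1) unfolding a_def grid_hits_def by blast
  qed
qed

text \<open>Uniform continuity of the path on the compact time interval.\<close>

lemma (in std_bridge) grid_jumps_eventually:
  assumes "\<epsilon> > 0" "\<omega> \<in> space M"
  shows "\<forall>\<^sub>F n in sequentially. \<omega> \<notin> grid_jumps \<mu> \<epsilon> T n"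
proof -
  let ?f = "\<lambda>s. W s \<omega> - \<mu> * s"
  have "continuous_on {0..real T} ?f"
    using assms(2) by (intro continuous_intros continuous_on_subset[OF W_continuous]) auto
  then have "uniformly_continuous_on {0..real T} ?f" by (rule compact_uniformly_continuous) simp
  then obtain d where d: "d > 0" "\<And>s t. s \<in> {0..real T} \<Longrightarrow> t \<in> {0..real T} \<Longrightarrow> dist t s < d \<Longrightarrow> dist (?f t) (?f s) < \<epsilon>"
    using assms(1) unfolding uniformly_continuous_on_def by meson
  have "(\<lambda>n. (1 / 2 :: real) ^ n) \<longlonglongrightarrow> 0" by (rule LIMSEQ_realpow_zero) auto
  from order_tendstoD(2)[OF this d(1)] show ?thesis
  proof eventually_elim
    case (elim n)
    show ?case
    proof
      assume "\<omega> \<in> grid_jumps \<mu> \<epsilon> T n"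
      then obtain k where k: "k < T * 2 ^ n" "?f (real (Suc k) * (1 / 2 ^ n)) - ?f (real k * (1 / 2 ^ n)) > \<epsilon>"
        unfolding grid_jumps_def by blast
      have "real (Suc k) \<le> real (T * 2 ^ n)" using k(1) by (simp only: of_nat_le_iff Suc_le_eq)
      then have "real (Suc k) * (1 / 2 ^ n) \<in> {0..real T}" by (simp add: field_simps)
      moreover have "real k * (1 / 2 ^ n) \<in> {0..real T}" using \<open>real (Suc k) \<le> _\<close> by (simp add: field_simps)
      moreover have "dist (real (Suc k) * (1 / 2 ^ n)) (real k * (1 / 2 ^ n)) < d"
        using elim by (simp add: dist_real_def field_simps)
      ultimately have "dist (?f (real (Suc k) * (1 / 2 ^ n))) (?f (real k * (1 / 2 ^ n))) < \<epsilon>" by (intro d(2))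
      then show False using k(2) by (simp add: dist_real_def)
    qed
  qed
qed

lemma (in std_bridge) indicator_grid_hits_tendsto:
  "(\<lambda>n. indicator (grid_hits \<mu> x T n) \<omega> :: real) \<longlonglongrightarrow> indicator (hits \<mu> x T) \<omega>"
proof (cases "\<omega> \<in> hits \<mu> x T")
  case True
  then show ?thesis
    by (intro tendsto_eventually eventually_mono[OF grid_hits_eventually[OF True]]) simp
next
  case False
  then have "indicator (grid_hits \<mu> x T n) \<omega> = (0 :: real)" for n
    using grid_hits_subset by (intro indicator_simps(2)) blast
  then show ?thesis using False by simp
qed

lemma (in std_bridge) hits_measurable:
  assumes "\<mu> > 0" "x \<ge> 0" "0 < T"
  shows "hits \<mu> x T \<in> events"
proof -
  have "hits \<mu> x T = (\<Union>n. grid_hits \<mu> x T n)"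
  proof (intro equalityI subsetI)
    fix \<omega> assume "\<omega> \<in> hits \<mu> x T"
    from grid_hits_eventually[OF this] show "\<omega> \<in> (\<Union>n. grid_hits \<mu> x T n)"
      by (auto simp: eventually_sequentially)
  qed (use grid_hits_subset in blast)
  then show ?thesis using grid_bounds(1)[OF assms(1,2) order_refl assms(3)] by auto
qed

text \<open>For fixed \<epsilon>, dominated convergence along the grids removes the term with the
  jumps and leaves two bounds whose quotient is exp (2 \<mu> \<epsilon>); then \<epsilon> tends to
  0.\<close>

lemma (in std_bridge) hits_stopping:
  assumes "\<mu> > 0" "x \<ge> 0" "0 < T"
  shows "expectation (\<lambda>\<omega>. exp (2 * \<mu> * (W T \<omega> - \<mu> * T)) * indicator (hits \<mu> x T) \<omega>)
    = exp (2 * \<mu> * x) * prob (hits \<mu> x T)"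
proof -
  define Q where "Q = (\<lambda>\<omega>. exp (2 * \<mu> * (W T \<omega> - \<mu> * T)))"
  note gb = grid_bounds[OF assms(1,2) _ assms(3), folded Q_def]
  have Q: "integrable M Q" using gb(3)[of 0] by simp
  then have [measurable]: "Q \<in> borel_measurable M" by simp
  have [measurable]: "hits \<mu> x T \<in> events" "grid_hits \<mu> x T n \<in> events" for n
    using hits_measurable[OF assms] gb(1)[of 0] by auto
  have lim_hit: "(\<lambda>n. expectation (\<lambda>\<omega>. Q \<omega> * indicator (grid_hits \<mu> x T n) \<omega>)) \<longlonglongrightarrow> expectation (\<lambda>\<omega>. Q \<omega> * indicator (hits \<mu> x T) \<omega>)"
  proof (rule integral_dominated_convergence[where w = Q])
    show "AE \<omega> in M. (\<lambda>n. Q \<omega> * indicator (grid_hits \<mu> x T n) \<omega>) \<longlonglongrightarrow> Q \<omega> * indicator (hits \<mu> x T) \<omega>"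
      by (intro AE_I2 tendsto_mult tendsto_const indicator_grid_hits_tendsto)
    show "AE \<omega> in M. norm (Q \<omega> * indicator (grid_hits \<mu> x T n) \<omega>) \<le> Q \<omega>" for n
      by (intro AE_I2) (simp add: Q_def indicator_def)
  qed (use Q in measurable)
  have lim_prob: "(\<lambda>n. prob (grid_hits \<mu> x T n)) \<longlonglongrightarrow> prob (hits \<mu> x T)"
  proof -
    have "(\<lambda>n. expectation (\<lambda>\<omega>. indicator (grid_hits \<mu> x T n) \<omega> :: real)) \<longlonglongrightarrow> expectation (\<lambda>\<omega>. indicator (hits \<mu> x T) \<omega>)"
    proof (rule integral_dominated_convergence[where w = "\<lambda>_. 1"])
      show "AE \<omega> in M. (\<lambda>n. indicator (grid_hits \<mu> x T n) \<omega> :: real) \<longlonglongrightarrow> indicator (hits \<mu> x T) \<omega>"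
        by (intro AE_I2 indicator_grid_hits_tendsto)
    qed (auto simp: indicator_def)
    then show ?thesis by simp
  qed
  have lim_jump: "(\<lambda>n. expectation (\<lambda>\<omega>. Q \<omega> * indicator (grid_jumps \<mu> \<epsilon> T n) \<omega>)) \<longlonglongrightarrow> 0" if "\<epsilon> > 0" for \<epsilon>
  proof -
    have [measurable]: "grid_jumps \<mu> \<epsilon> T n \<in> events" for n using gb(2)[of \<epsilon>] that by simp
    have "(\<lambda>n. expectation (\<lambda>\<omega>. Q \<omega> * indicator (grid_jumps \<mu> \<epsilon> T n) \<omega>)) \<longlonglongrightarrow> expectation (\<lambda>\<omega>. 0)"
    proof (rule integral_dominated_convergence[where w = Q])
      show "AE \<omega> in M. (\<lambda>n. Q \<omega> * indicator (grid_jumps \<mu> \<epsilon> T n) \<omega>) \<longlonglongrightarrow> 0"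
      proof (rule AE_I2)
        fix \<omega> assume "\<omega> \<in> space M"
        from grid_jumps_eventually[OF that this, of \<mu> T]
        have "\<forall>\<^sub>F n in sequentially. Q \<omega> * indicator (grid_jumps \<mu> \<epsilon> T n) \<omega> = 0"
          by eventually_elim simp
        then show "(\<lambda>n. Q \<omega> * indicator (grid_jumps \<mu> \<epsilon> T n) \<omega>) \<longlonglongrightarrow> 0"
          by (rule tendsto_eventually)
      qed
      show "AE \<omega> in M. norm (Q \<omega> * indicator (grid_jumps \<mu> \<epsilon> T n) \<omega>) \<le> Q \<omega>" for n
        by (intro AE_I2) (simp add: Q_def indicator_def)
    qed (use Q in measurable)
    then show ?thesis by simp
  qed
  have lower: "exp (2 * \<mu> * x) * prob (hits \<mu> x T) \<le> expectation (\<lambda>\<omega>. Q \<omega> * indicator (hits \<mu> x T) \<omega>)"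
    by (rule LIMSEQ_le[OF tendsto_mult[OF tendsto_const lim_prob] lim_hit]) (use gb(5)[of 0] in \<open>auto simp: Q_def\<close>)
  have upper: "expectation (\<lambda>\<omega>. Q \<omega> * indicator (hits \<mu> x T) \<omega>) \<le> exp (2 * \<mu> * (x + \<epsilon>)) * prob (hits \<mu> x T)" if "\<epsilon> > 0" for \<epsilon>
  proof -
    have "expectation (\<lambda>\<omega>. Q \<omega> * indicator (hits \<mu> x T) \<omega>) \<le> exp (2 * \<mu> * (x + \<epsilon>)) * prob (hits \<mu> x T) + 0"
      by (rule LIMSEQ_le[OF lim_hit tendsto_add[OF tendsto_mult[OF tendsto_const lim_prob] lim_jump[OF that]]])
         (use gb(6)[of \<epsilon>] that in \<open>auto simp: Q_def\<close>)
    then show ?thesis by simp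
  qed
  have "((\<lambda>\<epsilon>. exp (2 * \<mu> * (x + \<epsilon>)) * prob (hits \<mu> x T)) \<longlongrightarrow> exp (2 * \<mu> * (x + 0)) * prob (hits \<mu> x T)) (at_right 0)"
    by (intro tendsto_intros)
  then have "expectation (\<lambda>\<omega>. Q \<omega> * indicator (hits \<mu> x T) \<omega>) \<le> exp (2 * \<mu> * (x + 0)) * prob (hits \<mu> x T)"
    by (rule tendsto_lowerbound) (use upper in \<open>auto simp: eventually_at_right_less intro: eventually_at_rightI[of 0 1]\<close>)
  then show ?thesis using lower by (simp add: Q_def)
qed

text \<open>The martingale has mean \<open>1\<close> at time \<open>T\<close>.  Its mean over the paths that have crossed the line is
  \<open>exp (2 \<mu> x)\<close> times their probability; over the others it vanishes as \<open>T \<rightarrow> \<infinity>\<close>, because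
  \<open>\<beta> 1 = 0\<close> makes \<open>W T - \<mu> T\<close> tend to \<open>-\<infinity>\<close>.\<close>

lemma (in std_bridge) prob_below_line:
  assumes "x > 0" "y < x"
  shows "{\<omega> \<in> space M. \<forall>t\<in>{0..1}. \<beta> t \<omega> + y * t \<le> x} \<in> events"
    and "prob {\<omega> \<in> space M. \<forall>t\<in>{0..1}. \<beta> t \<omega> + y * t \<le> x} = 1 - exp (- 2 * x * (x - y))"
proof -
  define \<mu> where "\<mu> = x - y"
  have pos: "\<mu> > 0" "x \<ge> 0" using assms by (auto simp: \<mu>_def)
  define N where "N = {\<omega> \<in> space M. \<forall>t\<in>{0..1}. \<beta> t \<omega> + y * t \<le> x}"
  define Q where "Q = (\<lambda>T \<omega>. exp (2 * \<mu> * (W (real T) \<omega> - \<mu> * real T)))"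
  \<comment> \<open>Multiplication by 1 + s turns the condition at time t = s / (1 + s) into
    \<open>W s \<omega> - \<mu> * s \<le> x\<close>. The time t = 1 has no counterpart s and is
    recovered by continuity.\<close>
  have N: "N = space M - (\<Union>T. hits \<mu> x (Suc T))"
  proof (intro equalityI subsetI)
    fix \<omega> assume \<omega>: "\<omega> \<in> N"
    have "W s \<omega> - \<mu> * s \<le> x" if "s \<ge> 0" for s
    proof -
      have "\<forall>t\<in>{0..1}. \<beta> t \<omega> + y * t \<le> x" using \<omega> by (simp add: N_def)
      then have "\<beta> (s / (1 + s)) \<omega> + y * (s / (1 + s)) \<le> x"
        by (rule bspec[OF _ time_change_mem[OF that]])
      then have "(1 + s) * (\<beta> (s / (1 + s)) \<omega> + y * (s / (1 + s))) \<le> (1 + s) * x"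
        using that by (intro mult_left_mono) auto
      moreover have "(1 + s) * (y * (s / (1 + s))) = y * s" using that by (simp add: field_simps)
      ultimately show ?thesis by (simp add: W_def \<mu>_def algebra_simps)
    qed
    then show "\<omega> \<in> space M - (\<Union>T. hits \<mu> x (Suc T))" using \<omega> by (fastforce simp: N_def hits_def)
  next
    fix \<omega> assume "\<omega> \<in> space M - (\<Union>T. hits \<mu> x (Suc T))"
    then have \<omega>: "\<omega> \<in> space M" "\<And>T. \<omega> \<notin> hits \<mu> x (Suc T)" by auto
    have le: "W s \<omega> - \<mu> * s \<le> x" if "s \<ge> 0" for s
    proof -
      obtain T where "s \<le> real (Suc T)" by (metis Suc_n_not_le_n nat_le_linear of_nat_le_iff order_trans real_arch_simple)
      then show ?thesis using \<omega>(1) \<omega>(2)[of T] that unfolding hits_def by (auto simp: not_less simp del: of_nat_Suc)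
    qed
    have lt1: "\<beta> t \<omega> + y * t \<le> x" if t: "t \<in> {0..<1}" for t
    proof -
      define s where "s = t / (1 - t)"
      have s: "s \<ge> 0" "s / (1 + s) = t" "1 + s = 1 / (1 - t)" using t by (auto simp: s_def field_simps)
      have "(1 - t) * (W s \<omega> - \<mu> * s) \<le> (1 - t) * x" using le[OF s(1)] t by (intro mult_left_mono) auto
      moreover have "(1 - t) * W s \<omega> = \<beta> t \<omega>" using t unfolding W_def s(2) unfolding s(3) by simp
      moreover have "(1 - t) * s = t" using t by (simp add: s_def)
      moreover have "(1 - t) * (W s \<omega> - \<mu> * s) = (1 - t) * W s \<omega> - \<mu> * ((1 - t) * s)" by (simp add: algebra_simps)
      ultimately have "\<beta> t \<omega> - \<mu> * t \<le> (1 - t) * x" by simp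
      then show ?thesis by (simp add: \<mu>_def algebra_simps)
    qed
    have "\<beta> t \<omega> + y * t \<le> x" if "t \<in> {0..1}" for t
    proof (rule continuous_le_on_closure[of "{0..<1}" "\<lambda>t. \<beta> t \<omega> + y * t"])
      show "continuous_on (closure {0..<1::real}) (\<lambda>t. \<beta> t \<omega> + y * t)"
        using cont[OF \<omega>(1)] by (auto intro!: continuous_intros)
    qed (use that lt1 in auto)
    then show "\<omega> \<in> N" using \<omega>(1) by (simp add: N_def)
  qed
  have hits_ev [measurable]: "hits \<mu> x (Suc T) \<in> events" for T by (rule hits_measurable[OF pos]) simp
  have mono: "hits \<mu> x (Suc T) \<subseteq> hits \<mu> x (Suc T')" if "T \<le> T'" for T T'
  proof
    fix \<omega> assume "\<omega> \<in> hits \<mu> x (Suc T)"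
    then obtain s where s: "\<omega> \<in> space M" "s \<in> {0..real (Suc T)}" "W s \<omega> - \<mu> * s > x" unfolding hits_def by blast
    moreover have "s \<in> {0..real (Suc T')}" using s(2) that by auto
    ultimately show "\<omega> \<in> hits \<mu> x (Suc T')" unfolding hits_def by blast
  qed
  show "N \<in> events" unfolding N by simp
  have Q: "integrable M (Q (Suc T))" "expectation (Q (Suc T)) = 1" for T
    using grid_bounds(3,4)[OF pos order_refl, of "Suc T"] by (simp_all only: Q_def zero_less_Suc)
  then have Qm [measurable]: "Q (Suc T) \<in> borel_measurable M" for T by blast
  have intQ: "integrable M (\<lambda>\<omega>. Q (Suc T) \<omega> * indicator A \<omega>)" if [measurable]: "A \<in> events" for A T
  proof (rule Bochner_Integration.integrable_bound[OF Q(1)[of T]])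
    show "AE \<omega> in M. norm (Q (Suc T) \<omega> * indicator A \<omega>) \<le> norm (Q (Suc T) \<omega>)"
      by (simp add: Q_def indicator_def)
  qed measurable
  have prob_hits: "exp (2 * \<mu> * x) * prob (hits \<mu> x (Suc T))
      = 1 - expectation (\<lambda>\<omega>. Q (Suc T) \<omega> * indicator (space M - hits \<mu> x (Suc T)) \<omega>)" for T
  proof -
    have "1 = expectation (\<lambda>\<omega>. Q (Suc T) \<omega> * indicator (hits \<mu> x (Suc T)) \<omega>
        + Q (Suc T) \<omega> * indicator (space M - hits \<mu> x (Suc T)) \<omega>)"
      unfolding Q(2)[of T, symmetric]
      by (intro Bochner_Integration.integral_cong refl) (simp add: indicator_def)
    also have "\<dots> = expectation (\<lambda>\<omega>. Q (Suc T) \<omega> * indicator (hits \<mu> x (Suc T)) \<omega>)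
        + expectation (\<lambda>\<omega>. Q (Suc T) \<omega> * indicator (space M - hits \<mu> x (Suc T)) \<omega>)"
      by (intro Bochner_Integration.integral_add intQ) auto
    also have "expectation (\<lambda>\<omega>. Q (Suc T) \<omega> * indicator (hits \<mu> x (Suc T)) \<omega>) = exp (2 * \<mu> * x) * prob (hits \<mu> x (Suc T))"
      unfolding Q_def by (rule hits_stopping[OF pos]) simp
    finally show ?thesis by simp
  qed
  have "AE \<omega> in M. \<beta> 1 \<omega> = 0"
  proof -
    have one: "1 \<in> {0..1::real}" by simp
    have "integrable M (\<lambda>\<omega>. \<beta> 1 \<omega> * \<beta> 1 \<omega>)" "expectation (\<lambda>\<omega>. \<beta> 1 \<omega> * \<beta> 1 \<omega>) = 0"
      using integrable_bridge(2)[OF one one] cov[OF one one] by auto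
    then show ?thesis by (rule AE_zero_of_square_integral)
  qed
  then have lim0: "AE \<omega> in M. (\<lambda>T. Q (Suc T) \<omega> * indicator (space M - hits \<mu> x (Suc T)) \<omega>) \<longlonglongrightarrow> 0"
  proof (rule AE_mp, intro AE_I2 impI)
    fix \<omega> assume \<omega>: "\<omega> \<in> space M" "\<beta> 1 \<omega> = 0"
    let ?r = "\<lambda>T. real (Suc T) / (1 + real (Suc T))"
    have r: "?r \<longlonglongrightarrow> 1"
    proof -
      have "(\<lambda>T. 1 - inverse (real (Suc (Suc T)))) \<longlonglongrightarrow> 1 - 0"
        by (intro tendsto_diff tendsto_const LIMSEQ_Suc[OF LIMSEQ_inverse_real_of_nat])
      moreover have "1 - inverse (real (Suc (Suc T))) = ?r T" for T by (simp add: field_simps)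
      ultimately show ?thesis by simp
    qed
    have "?r T \<in> {0..1}" for T by (rule time_change_mem) simp
    then have "(\<lambda>T. \<beta> (?r T) \<omega>) \<longlonglongrightarrow> \<beta> 1 \<omega>"
      by (intro continuous_on_tendsto_compose[OF cont[OF \<omega>(1)] r] always_eventually allI) auto
    then have "(\<lambda>T. \<beta> (?r T) \<omega> - \<mu> * ?r T) \<longlonglongrightarrow> 0 - \<mu> * 1" unfolding \<omega>(2) by (intro tendsto_intros r)
    then have neg: "(\<lambda>T. 2 * \<mu> * (\<beta> (?r T) \<omega> - \<mu> * ?r T)) \<longlonglongrightarrow> 2 * \<mu> * (0 - \<mu> * 1)" by (rule tendsto_mult_left)
    \<comment> \<open>\<open>W T - \<mu> * T\<close> is 1 + T times a bracket that converges to
      -\<mu>, so it tends to minus infinity.\<close>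
    have "filterlim (\<lambda>T. 1 + real (Suc T)) at_top sequentially"
      by (intro filterlim_tendsto_add_at_top[OF tendsto_const] filterlim_compose[OF filterlim_real_sequentially filterlim_Suc])
    from filterlim_tendsto_neg_mult_at_bot[OF neg _ this]
    have bot: "filterlim (\<lambda>T. 2 * \<mu> * (\<beta> (?r T) \<omega> - \<mu> * ?r T) * (1 + real (Suc T))) at_bot sequentially"
      using pos by (simp add: mult_pos_neg)
    have eq: "2 * \<mu> * (\<beta> (?r T) \<omega> - \<mu> * ?r T) * (1 + real (Suc T)) = 2 * \<mu> * (W (real (Suc T)) \<omega> - \<mu> * real (Suc T))" for T
    proof -
      have "?r T * (1 + real (Suc T)) = real (Suc T)" by simp
      moreover have "2 * \<mu> * (b - \<mu> * r) * q = 2 * \<mu> * (q * b - \<mu> * (r * q))" for b r q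
        by (simp add: algebra_simps)
      ultimately show ?thesis unfolding W_def by presburger
    qed
    have "(\<lambda>T. Q (Suc T) \<omega>) \<longlonglongrightarrow> 0"
      using filterlim_compose[OF exp_at_bot bot] unfolding Q_def eq .
    then show "(\<lambda>T. Q (Suc T) \<omega> * indicator (space M - hits \<mu> x (Suc T)) \<omega>) \<longlonglongrightarrow> 0"
      by (rule Lim_null_comparison[rotated]) (simp add: Q_def indicator_def)
  qed
  \<comment> \<open>On paths that have not crossed by time \<open>Suc T\<close> the process is still
    at most \<open>x\<close> at that time, so the martingale is bounded there by exp (2 \<mu> x),
    uniformly in \<open>T\<close>.\<close>
  have "(\<lambda>T. expectation (\<lambda>\<omega>. Q (Suc T) \<omega> * indicator (space M - hits \<mu> x (Suc T)) \<omega>)) \<longlonglongrightarrow> expectation (\<lambda>\<omega>. 0)"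
  proof (rule integral_dominated_convergence[where w = "\<lambda>_. exp (2 * \<mu> * x)", OF _ _ _ lim0])
    show "AE \<omega> in M. norm (Q (Suc T) \<omega> * indicator (space M - hits \<mu> x (Suc T)) \<omega>) \<le> exp (2 * \<mu> * x)" for T
    proof (rule AE_I2)
      fix \<omega> assume "\<omega> \<in> space M"
      show "norm (Q (Suc T) \<omega> * indicator (space M - hits \<mu> x (Suc T)) \<omega>) \<le> exp (2 * \<mu> * x)"
      proof (cases "\<omega> \<in> hits \<mu> x (Suc T)")
        case False
        have "real (Suc T) \<in> {0..real (Suc T)}" by simp
        moreover have "\<forall>s\<in>{0..real (Suc T)}. W s \<omega> - \<mu> * s \<le> x"
          using False \<open>\<omega> \<in> space M\<close> by (simp add: hits_def not_less del: of_nat_Suc)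
        ultimately have "W (real (Suc T)) \<omega> - \<mu> * real (Suc T) \<le> x" by (rule bspec[rotated])
        then show ?thesis using pos \<open>\<omega> \<in> space M\<close> False by (simp add: Q_def del: of_nat_Suc)
      qed simp
    qed
  qed measurable
  then have "(\<lambda>T. exp (- (2 * \<mu> * x)) * (1 - expectation (\<lambda>\<omega>. Q (Suc T) \<omega> * indicator (space M - hits \<mu> x (Suc T)) \<omega>)))
      \<longlonglongrightarrow> exp (- (2 * \<mu> * x)) * (1 - 0)"
    by (intro tendsto_intros) simp
  then have "(\<lambda>T. prob (hits \<mu> x (Suc T))) \<longlonglongrightarrow> exp (- (2 * \<mu> * x))"
    unfolding prob_hits[symmetric] by (simp add: exp_minus field_simps)
  moreover have "(\<lambda>T. prob (hits \<mu> x (Suc T))) \<longlonglongrightarrow> prob (\<Union>T. hits \<mu> x (Suc T))"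
    by (rule finite_Lim_measure_incseq) (use mono in \<open>auto simp: incseq_def\<close>)
  ultimately have "prob (\<Union>T. hits \<mu> x (Suc T)) = exp (- (2 * \<mu> * x))" using LIMSEQ_unique by blast
  moreover have "prob N = 1 - prob (\<Union>T. hits \<mu> x (Suc T))" unfolding N by (rule prob_compl) simp
  ultimately show "prob N = 1 - exp (- 2 * x * (x - y))" by (simp add: \<mu>_def mult_ac)
qed

subsection \<open>Integrals of normal distribution functions\<close>

definition Phi :: "real \<Rightarrow> real" where
  "Phi x = measure std_normal_distribution {..x}"

lemma Phi_bounds: "0 \<le> Phi x" "Phi x \<le> 1"
proof -
  interpret real_distribution std_normal_distribution by (rule real_dist_normal_dist)
  show "0 \<le> Phi x" "Phi x \<le> 1" by (auto simp: Phi_def)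
qed

lemma abs_Phi_le [simp]: "\<bar>Phi x\<bar> \<le> 1"
  using Phi_bounds[of x] by simp

lemma Phi_at_top: "(Phi \<longlongrightarrow> 1) at_top"
proof -
  interpret real_distribution std_normal_distribution by (rule real_dist_normal_dist)
  show ?thesis using cdf_lim_at_top_prob by (simp add: Phi_def[abs_def] cdf_def[abs_def])
qed

lemma Phi_at_bot: "(Phi \<longlongrightarrow> 0) at_bot"
proof -
  interpret real_distribution std_normal_distribution by (rule real_dist_normal_dist)
  show ?thesis using cdf_lim_at_bot by (simp add: Phi_def[abs_def] cdf_def[abs_def])
qed

lemma continuous_std_normal_density: "continuous_on A std_normal_density"
  unfolding normal_density_def by (intro continuous_intros) auto

text \<open>To the right of the base point \<open>a = x - 1\<close> the function is a constant plus
  an integral over a compact interval, to which the fundamental theorem applies.\<close>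

lemma DERIV_Phi: "(Phi has_real_derivative std_normal_density x) (at x)"
proof -
  interpret real_distribution std_normal_distribution by (rule real_dist_normal_dist)
  define a where "a = x - 1"
  have Phi_eq: "Phi y = Phi a + integral {a..y} std_normal_density" if "y \<ge> a" for y
  proof -
    have "{..y} = {..a} \<union> {a<..y}" using that by auto
    then have "Phi y = Phi a + measure std_normal_distribution {a<..y}"
      unfolding Phi_def by (simp only:) (rule finite_measure_Union; auto)
    also have "measure std_normal_distribution {a<..y} = integral {a..y} std_normal_density"
    proof -
      have int: "integrable lborel (\<lambda>t. indicator {a..y} t *\<^sub>R std_normal_density t)"
        by (intro integrable_mult_indicator) auto
      have "emeasure std_normal_distribution {a<..y} = (\<integral>\<^sup>+t. ennreal (std_normal_density t) * indicator {a<..y} t \<partial>lborel)"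
        by (rule emeasure_density) auto
      also have "\<dots> = (\<integral>\<^sup>+t. ennreal (indicator {a..y} t *\<^sub>R std_normal_density t) \<partial>lborel)"
      proof (rule nn_integral_cong_AE)
        show "AE t in lborel. ennreal (std_normal_density t) * indicator {a<..y} t
            = ennreal (indicator {a..y} t *\<^sub>R std_normal_density t)"
          using AE_lborel_singleton[of a]
        proof eventually_elim
          case (elim t)
          then have "t \<in> {a<..y} \<longleftrightarrow> t \<in> {a..y}" by auto
          then show ?case by (cases "t \<in> {a..y}") (simp_all only: indicator_simps mult_1_right mult_zero_right scaleR_one scaleR_zero_left ennreal_0 simp_thms)
        qed
      qed
      also have "\<dots> = ennreal (\<integral>t. indicator {a..y} t *\<^sub>R std_normal_density t \<partial>lborel)"
        by (intro nn_integral_eq_integral int) (auto simp: indicator_def)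
      also have "(\<integral>t. indicator {a..y} t *\<^sub>R std_normal_density t \<partial>lborel) = integral {a..y} std_normal_density"
        using set_borel_integral_eq_integral(2)[of "{a..y}" std_normal_density] int
        by (simp add: set_integrable_def set_lebesgue_integral_def)
      finally show ?thesis
        unfolding measure_def
        by (simp add: integral_nonneg integrable_continuous_interval continuous_std_normal_density)
    qed
    finally show ?thesis .
  qed
  have "((\<lambda>y. integral {a..y} std_normal_density) has_real_derivative std_normal_density x) (at x within {a..x + 1})"
    by (rule integral_has_real_derivative) (auto simp: a_def continuous_std_normal_density)
  then have "((\<lambda>y. integral {a..y} std_normal_density) has_real_derivative std_normal_density x) (at x)"
    by (simp add: at_within_Icc_at a_def)
  then have "((\<lambda>y. Phi a + integral {a..y} std_normal_density) has_real_derivative std_normal_density x) (at x)"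
    by (auto intro!: derivative_eq_intros)
  note d = this
  have "\<forall>\<^sub>F y in nhds x. y \<in> {a<..}" by (rule eventually_nhds_in_open) (auto simp: a_def)
  then have ev: "\<forall>\<^sub>F y in nhds x. Phi a + integral {a..y} std_normal_density = Phi y"
    by eventually_elim (rule Phi_eq[symmetric], simp)
  show ?thesis by (rule DERIV_cong_ev[OF refl ev refl, THEN iffD1, OF d])
qed

lemma DERIV_Phi_mult:
  "((\<lambda>x. Phi (c * x)) has_real_derivative c * std_normal_density (c * x)) (at x)"
  by (rule DERIV_chain'[OF _ DERIV_Phi, THEN DERIV_cong]) (auto intro!: derivative_eq_intros)

lemma borel_measurable_Phi [measurable]: "Phi \<in> borel_measurable borel"
  by (intro borel_measurable_continuous_onI DERIV_continuous_on[where D = std_normal_density])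
     (auto intro: DERIV_subset[OF DERIV_Phi])

text \<open>The density is even, so Phi x + Phi (-x) has derivative 0; its constant value is the
  limit at infinity.\<close>

lemma Phi_minus: "Phi (- x) = 1 - Phi x"
proof -
  define f where "f = (\<lambda>x. Phi x + Phi (- x))"
  have "DERIV f y :> 0" for y
    unfolding f_def using DERIV_Phi_mult[of "-1" y] DERIV_Phi[of y]
    by (auto intro!: derivative_eq_intros simp: normal_density_def)
  then have const: "f y = f 0" for y using DERIV_isconst_all by blast
  have "(f \<longlongrightarrow> 1 + 0) at_top"
    unfolding f_def by (intro tendsto_add Phi_at_top filterlim_compose[OF Phi_at_bot filterlim_uminus_at_bot_at_top])
  moreover have "(f \<longlongrightarrow> f 0) at_top"
    by (intro tendsto_eventually always_eventually allI const)
  ultimately have "f 0 = 1 + 0" by (intro tendsto_unique[of at_top f]) auto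
  then show ?thesis using const[of x] by (simp add: f_def)
qed

lemma Phi_0 [simp]: "Phi 0 = 1 / 2"
  using Phi_minus[of 0] by simp

lemma Phi_mult_at_top:
  "c > 0 \<Longrightarrow> ((\<lambda>x. Phi (c * x)) \<longlongrightarrow> 1) at_top"
  "c < 0 \<Longrightarrow> ((\<lambda>x. Phi (c * x)) \<longlongrightarrow> 0) at_top"
proof -
  show "((\<lambda>x. Phi (c * x)) \<longlongrightarrow> 1) at_top" if "c > 0"
    by (rule filterlim_compose[OF Phi_at_top filterlim_tendsto_pos_mult_at_top[OF tendsto_const that filterlim_ident]])
  show "((\<lambda>x. Phi (c * x)) \<longlongrightarrow> 0) at_top" if "c < 0"
    by (rule filterlim_compose[OF Phi_at_bot filterlim_tendsto_neg_mult_at_bot[OF tendsto_const that filterlim_ident]])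
qed

text \<open>Chebyshev's inequality. The crude rate is enough to annihilate the boundary terms in the
  integrations by parts below.\<close>

lemma Phi_tail: 
  assumes "x > 0" shows "1 - Phi x \<le> 1 / x\<^sup>2"
proof -
  interpret real_distribution std_normal_distribution by (rule real_dist_normal_dist)
  have "1 - Phi x = prob (space std_normal_distribution - {..x})"
    unfolding Phi_def by (subst prob_compl) auto
  also have "\<dots> = expectation (\<lambda>y. indicator {x<..} y)"
    by (auto intro!: arg_cong[where f = prob])
  also have "\<dots> \<le> expectation (\<lambda>y. y\<^sup>2 / x\<^sup>2)"
  proof (rule integral_mono)
    show "integrable std_normal_distribution (\<lambda>y. y\<^sup>2 / x\<^sup>2)"
      by (intro integrable_divide integrable_std_normal_distribution_moment)
    show "indicator {x<..} y \<le> y\<^sup>2 / x\<^sup>2" for y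
      using assms by (auto simp: indicator_def)
    show "integrable std_normal_distribution (indicator {x<..} :: real \<Rightarrow> real)"
      by (rule integrable_const_bound[of _ 1]) (auto simp: indicator_def)
  qed
  also have "\<dots> = 1 / x\<^sup>2"
    using std_normal_distribution_even_moments(1)[of 1] by (simp add: numeral_eq_Suc)
  finally show ?thesis .
qed

lemma mult_Phi_tail:
  assumes "c > 0"
  shows "((\<lambda>x. x * (1 - Phi (c * x))) \<longlongrightarrow> 0) at_top" "((\<lambda>x. x * Phi (- c * x)) \<longlongrightarrow> 0) at_top"
proof -
  show "((\<lambda>x. x * (1 - Phi (c * x))) \<longlongrightarrow> 0) at_top"
  proof (rule tendsto_sandwich[OF _ _ tendsto_const])
    show "\<forall>\<^sub>F x in at_top. 0 \<le> x * (1 - Phi (c * x))"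
      using eventually_ge_at_top[of 0] by eventually_elim (use Phi_bounds in auto)
    show "\<forall>\<^sub>F x in at_top. x * (1 - Phi (c * x)) \<le> inverse c ^ 2 * inverse x"
      using eventually_gt_at_top[of 0]
    proof eventually_elim
      case (elim x)
      have "x * (1 - Phi (c * x)) \<le> x * (1 / (c * x)\<^sup>2)"
        using elim assms by (intro mult_left_mono Phi_tail) auto
      also have "\<dots> = inverse c ^ 2 * inverse x"
        using elim assms by (simp add: field_simps power2_eq_square)
      finally show ?case .
    qed
    have "((\<lambda>x. inverse c ^ 2 * inverse x) \<longlongrightarrow> inverse c ^ 2 * 0) at_top"
      by (intro tendsto_mult tendsto_const tendsto_inverse_0_at_top filterlim_ident)
    then show "((\<lambda>x. inverse c ^ 2 * inverse x) \<longlongrightarrow> 0) at_top" by simp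
  qed
  then show "((\<lambda>x. x * Phi (- c * x)) \<longlongrightarrow> 0) at_top" by (simp add: Phi_minus)
qed

section \<open>Primitives for Gaussian moments and products of distribution functions\<close>

text \<open>The result of integrating x exp (- a x^2) Phi (c x) by parts: what remains is exp (- a
  x^2) times the density at c x, which is again a normal density, with scaling factor sqrt (2 a +
  c^2).\<close>

definition moment_primitive :: "real \<Rightarrow> real \<Rightarrow> real \<Rightarrow> real" where
  "moment_primitive a c x = (c / sqrt (2 * a + c\<^sup>2) * Phi (sqrt (2 * a + c\<^sup>2) * x) - exp (- a * x\<^sup>2) * Phi (c * x)) / (2 * a)"

lemma DERIV_moment_primitive:
  assumes "a > 0"
  shows "(moment_primitive a c has_real_derivative x * exp (- a * x\<^sup>2) * Phi (c * x)) (at x)"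
proof -
  define k where "k = sqrt (2 * a + c\<^sup>2)"
  have k: "k > 0" "k\<^sup>2 = 2 * a + c\<^sup>2" using assms by (auto simp: k_def intro: add_pos_nonneg)
  have dens: "std_normal_density (k * x) = exp (- a * x\<^sup>2) * std_normal_density (c * x)"
    by (simp add: std_normal_density_def power_mult_distrib k(2) exp_add[symmetric] field_simps)
  have "((\<lambda>x. (c / k * Phi (k * x) - exp (- a * x\<^sup>2) * Phi (c * x)) / (2 * a)) has_real_derivative
      (c / k * (k * std_normal_density (k * x))
        - (exp (- a * x\<^sup>2) * (- a * (2 * x)) * Phi (c * x) + exp (- a * x\<^sup>2) * (c * std_normal_density (c * x)))) / (2 * a)) (at x)"
  proof (rule DERIV_cdivide, rule DERIV_diff)
    show "((\<lambda>x. c / k * Phi (k * x)) has_real_derivative c / k * (k * std_normal_density (k * x))) (at x)"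
      by (rule DERIV_cmult[OF DERIV_Phi_mult])
    have "((\<lambda>x. exp (- a * x\<^sup>2)) has_real_derivative exp (- a * x\<^sup>2) * (- a * (2 * x))) (at x)"
      by (auto intro!: derivative_eq_intros)
    from DERIV_mult[OF this DERIV_Phi_mult[of c x]]
    show "((\<lambda>x. exp (- a * x\<^sup>2) * Phi (c * x)) has_real_derivative
        exp (- a * x\<^sup>2) * (- a * (2 * x)) * Phi (c * x) + exp (- a * x\<^sup>2) * (c * std_normal_density (c * x))) (at x)"
      by (rule DERIV_cong) (simp add: mult_ac)
  qed
  also have "(c / k * (k * std_normal_density (k * x))
        - (exp (- a * x\<^sup>2) * (- a * (2 * x)) * Phi (c * x) + exp (- a * x\<^sup>2) * (c * std_normal_density (c * x)))) / (2 * a)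
      = x * exp (- a * x\<^sup>2) * Phi (c * x)"
    unfolding dens using k(1) assms by (simp add: field_simps)
  finally show ?thesis unfolding moment_primitive_def[abs_def] k_def .
qed

lemma gauss_factor_at_top: "a > 0 \<Longrightarrow> ((\<lambda>x::real. exp (- a * x\<^sup>2)) \<longlongrightarrow> 0) at_top"
  by real_asymp

lemma moment_primitive_limits:
  assumes "a > 0"
  shows "(moment_primitive a c \<longlongrightarrow> c / sqrt (2 * a + c\<^sup>2) / (2 * a)) at_top"
    and "moment_primitive a c 0 = (c / sqrt (2 * a + c\<^sup>2) - 1) / (4 * a)"
proof -
  have k: "sqrt (2 * a + c\<^sup>2) > 0" using assms by (auto intro: add_pos_nonneg)
  have "((\<lambda>x. exp (- a * x\<^sup>2) * Phi (c * x)) \<longlongrightarrow> 0) at_top"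
    by (rule Lim_null_comparison[OF _ gauss_factor_at_top[OF assms]])
       (auto simp: abs_mult intro!: always_eventually mult_left_le)
  then have "(moment_primitive a c \<longlongrightarrow> (c / sqrt (2 * a + c\<^sup>2) * 1 - 0) / (2 * a)) at_top"
    unfolding moment_primitive_def[abs_def] using Phi_mult_at_top(1)[OF k] assms by (intro tendsto_intros) auto
  then show "(moment_primitive a c \<longlongrightarrow> c / sqrt (2 * a + c\<^sup>2) / (2 * a)) at_top" by simp
  show "moment_primitive a c 0 = (c / sqrt (2 * a + c\<^sup>2) - 1) / (4 * a)"
    using assms by (simp add: moment_primitive_def field_simps)
qed

lemma nn_integral_moment:
  assumes "a > 0"
  shows "(\<integral>\<^sup>+x. ennreal (x * exp (- a * x\<^sup>2) * Phi (c * x)) * indicator {0..} x \<partial>lborel)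
    = ennreal ((1 + c / sqrt (2 * a + c\<^sup>2)) / (4 * a))"
proof -
  have "(\<integral>\<^sup>+x. ennreal (x * exp (- a * x\<^sup>2) * Phi (c * x)) * indicator {0..} x \<partial>lborel)
    = ennreal (c / sqrt (2 * a + c\<^sup>2) / (2 * a) - moment_primitive a c 0)"
    by (rule nn_integral_FTC_atLeast[OF _ DERIV_moment_primitive[OF assms] _ moment_primitive_limits(1)[OF assms]])
       (auto intro!: mult_nonneg_nonneg Phi_bounds)
  also have "c / sqrt (2 * a + c\<^sup>2) / (2 * a) - moment_primitive a c 0 = (1 + c / sqrt (2 * a + c\<^sup>2)) / (4 * a)"
    unfolding moment_primitive_limits(2)[OF assms] using assms by (simp add: field_simps)
  finally show ?thesis .
qed

text \<open>Since the integrand is nonnegative on the half line, a limit of the primitive is all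
  that integrability requires.\<close>

lemma has_integral_FTC_atLeast:
  fixes f F :: "real \<Rightarrow> real"
  assumes [measurable]: "f \<in> borel_measurable borel" and F: "\<And>x. DERIV F x :> f x"
    and nn: "\<And>x. 0 \<le> x \<Longrightarrow> 0 \<le> f x" and lim: "(F \<longlongrightarrow> L) at_top" and v: "L - F 0 = v"
  shows "has_bochner_integral lborel (\<lambda>x. indicator {0..} x * f x) v"
proof (rule has_bochner_integral_nn_integral)
  have "F 0 \<le> L"
  proof (rule tendsto_lowerbound[OF lim])
    show "\<forall>\<^sub>F x in at_top. F 0 \<le> F x"
      using eventually_ge_at_top[of 0]
      by eventually_elim (use DERIV_nonneg_imp_nondecreasing[of 0 _ F] F nn in blast)
  qed simp
  then show "0 \<le> v" using v by simp
  have "(\<integral>\<^sup>+x. ennreal (indicator {0..} x * f x) \<partial>lborel) = (\<integral>\<^sup>+x. ennreal (f x) * indicator {0..} x \<partial>lborel)"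
    by (intro nn_integral_cong) (simp add: indicator_def)
  also have "\<dots> = ennreal (L - F 0)" by (rule nn_integral_FTC_atLeast) (use assms in auto)
  finally show "(\<integral>\<^sup>+x. ennreal (indicator {0..} x * f x) \<partial>lborel) = ennreal v" unfolding v .
qed (auto simp: indicator_def nn)

text \<open>Integration by parts of \<open>\<Phi>(b x) \<Phi>(c x)\<close> leaves \<open>x\<close> times the derivative of that product, of which
  this is a primitive.\<close>

definition ibp_term :: "real \<Rightarrow> real \<Rightarrow> real \<Rightarrow> real" where
  "ibp_term b c x = (b * moment_primitive (b\<^sup>2 / 2) c x + c * moment_primitive (c\<^sup>2 / 2) b x) / sqrt (2 * pi)"

text \<open>Each of the two summands in the derivative of the product is a moment integrand, of rate
  b^2 / 2 or c^2 / 2. The same total increment over the half line gives \<open>I1\<close> and, with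
  the opposite sign, \<open>G\<close> at \<open>a = 0\<close>.\<close>

lemma ibp_term:
  assumes "b \<noteq> 0" "c \<noteq> 0"
  shows "((\<lambda>x. Phi (b * x) * Phi (c * x)) has_real_derivative D) (at x) \<Longrightarrow> (ibp_term b c has_real_derivative x * D) (at x)"
    and "(ibp_term b c \<longlongrightarrow> l) at_top \<Longrightarrow> l - ibp_term b c 0 = 1 / (b * c * sqrt (8 * pi)) * (b + c + sqrt (b\<^sup>2 + c\<^sup>2))"
    and "\<exists>l. (ibp_term b c \<longlongrightarrow> l) at_top"
proof -
  have pos: "b\<^sup>2 / 2 > 0" "c\<^sup>2 / 2 > 0" using assms by auto
  have dens: "std_normal_density (r * x) = exp (- (r\<^sup>2 / 2) * x\<^sup>2) / sqrt (2 * pi)" for r x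
    by (simp add: std_normal_density_def power_mult_distrib)
  have "(ibp_term b c has_real_derivative
      (b * (x * exp (- (b\<^sup>2 / 2) * x\<^sup>2) * Phi (c * x)) + c * (x * exp (- (c\<^sup>2 / 2) * x\<^sup>2) * Phi (b * x))) / sqrt (2 * pi)) (at x)"
    unfolding ibp_term_def[abs_def]
    by (intro DERIV_cdivide DERIV_add DERIV_cmult DERIV_moment_primitive pos)
  also have "(b * (x * exp (- (b\<^sup>2 / 2) * x\<^sup>2) * Phi (c * x)) + c * (x * exp (- (c\<^sup>2 / 2) * x\<^sup>2) * Phi (b * x))) / sqrt (2 * pi)
      = x * (b * std_normal_density (b * x) * Phi (c * x) + c * std_normal_density (c * x) * Phi (b * x))"
    unfolding dens by (simp add: field_simps)
  finally have d: "(ibp_term b c has_real_derivative x * (b * std_normal_density (b * x) * Phi (c * x) + c * std_normal_density (c * x) * Phi (b * x))) (at x)" .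
  show "(ibp_term b c has_real_derivative x * D) (at x)" if "((\<lambda>x. Phi (b * x) * Phi (c * x)) has_real_derivative D) (at x)"
  proof -
    have "((\<lambda>x. Phi (b * x) * Phi (c * x)) has_real_derivative b * std_normal_density (b * x) * Phi (c * x) + c * std_normal_density (c * x) * Phi (b * x)) (at x)"
      by (rule DERIV_mult[OF DERIV_Phi_mult DERIV_Phi_mult])
    then show ?thesis using d DERIV_unique[OF that] by simp
  qed
  define s where "s = sqrt (b\<^sup>2 + c\<^sup>2)"
  have s: "s > 0" "s\<^sup>2 = b\<^sup>2 + c\<^sup>2" "sqrt (c\<^sup>2 + b\<^sup>2) = s" using assms by (auto simp: s_def sum_power2_gt_zero_iff add.commute)
  have lim: "(ibp_term b c \<longlongrightarrow> (b * (c / s / b\<^sup>2) + c * (b / s / c\<^sup>2)) / sqrt (2 * pi)) at_top"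
    unfolding ibp_term_def[abs_def]
    using moment_primitive_limits(1)[OF pos(1), of c] moment_primitive_limits(1)[OF pos(2), of b]
    by (intro tendsto_intros) (simp_all add: s_def[symmetric] s(3))
  have zero: "ibp_term b c 0 = (b * ((c / s - 1) / (2 * b\<^sup>2)) + c * ((b / s - 1) / (2 * c\<^sup>2))) / sqrt (2 * pi)"
    unfolding ibp_term_def moment_primitive_limits(2)[OF pos(1)] moment_primitive_limits(2)[OF pos(2)]
    by (simp add: s_def[symmetric] s(3))
  have diff: "(b * (c / s / b\<^sup>2) + c * (b / s / c\<^sup>2)) / sqrt (2 * pi)
      - (b * ((c / s - 1) / (2 * b\<^sup>2)) + c * ((b / s - 1) / (2 * c\<^sup>2))) / sqrt (2 * pi)
      = 1 / (b * c * sqrt (8 * pi)) * (b + c + s)"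
  proof -
    have "sqrt (8 * pi) = 2 * sqrt (2 * pi)" using real_sqrt_mult[of 4 "2 * pi"] by simp
    moreover have "(b * (c / s / b\<^sup>2) + c * (b / s / c\<^sup>2)) - (b * ((c / s - 1) / (2 * b\<^sup>2)) + c * ((b / s - 1) / (2 * c\<^sup>2)))
        = (b + c + s\<^sup>2 / s) / (b * c * 2)"
      unfolding s(2) using assms s(1) by (simp add: field_simps power2_eq_square)
    ultimately show ?thesis
      using s(1) unfolding diff_divide_distrib[symmetric] by (simp add: power2_eq_square mult_ac)
  qed
  show "\<exists>l. (ibp_term b c \<longlongrightarrow> l) at_top" using lim by (rule exI)
  show "l - ibp_term b c 0 = 1 / (b * c * sqrt (8 * pi)) * (b + c + sqrt (b\<^sup>2 + c\<^sup>2))" if "(ibp_term b c \<longlongrightarrow> l) at_top"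
  proof -
    have "l = (b * (c / s / b\<^sup>2) + c * (b / s / c\<^sup>2)) / sqrt (2 * pi)"
      by (rule tendsto_unique[OF _ that lim]) simp
    then show ?thesis using diff unfolding zero s_def by simp
  qed
qed

lemma integral_I1_finite:
  assumes "b > 0" "c > 0"
  shows "has_bochner_integral lborel (\<lambda>x. indicator {0..} x * (1 - Phi (b * x) * Phi (c * x)))
    (1 / (b * c * sqrt (8 * pi)) * (b + c + sqrt (b\<^sup>2 + c\<^sup>2)))"
proof -
  have nz: "b \<noteq> 0" "c \<noteq> 0" using assms by auto
  obtain l where l: "(ibp_term b c \<longlongrightarrow> l) at_top" using ibp_term(3)[OF nz] by blast
  let ?P = "\<lambda>x. Phi (b * x) * Phi (c * x)"
  show ?thesis
  proof (rule has_integral_FTC_atLeast[where F = "\<lambda>x. x * (1 - ?P x) + ibp_term b c x"])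
    fix x
    have d: "(?P has_real_derivative b * std_normal_density (b * x) * Phi (c * x) + c * std_normal_density (c * x) * Phi (b * x)) (at x)"
      by (rule DERIV_mult[OF DERIV_Phi_mult DERIV_Phi_mult])
    show "((\<lambda>x. x * (1 - ?P x) + ibp_term b c x) has_real_derivative 1 - ?P x) (at x)"
      by (rule DERIV_cong[OF DERIV_add[OF DERIV_mult[OF DERIV_ident DERIV_diff[OF DERIV_const d]] ibp_term(1)[OF nz d]]])
         (simp add: algebra_simps)
    show "0 \<le> 1 - ?P x" using Phi_bounds[of "b * x"] Phi_bounds[of "c * x"] by (simp add: mult_le_one)
  next
    have "((\<lambda>x. x * (1 - Phi (b * x)) + Phi (b * x) * (x * (1 - Phi (c * x)))) \<longlongrightarrow> 0 + 1 * 0) at_top"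
      by (intro tendsto_add tendsto_mult Phi_mult_at_top mult_Phi_tail assms)
    moreover have "x * (1 - Phi (b * x)) + Phi (b * x) * (x * (1 - Phi (c * x))) = x * (1 - ?P x)" for x
      by (simp add: algebra_simps)
    ultimately have "((\<lambda>x. x * (1 - ?P x)) \<longlongrightarrow> 0) at_top" by simp
    from tendsto_add[OF this l] show "((\<lambda>x. x * (1 - ?P x) + ibp_term b c x) \<longlongrightarrow> l) at_top" by simp
  qed (use ibp_term(2)[OF nz l] in simp_all)
qed

text \<open>One negative argument suffices: x Phi (b x) already tends to 0 and dominates the
  boundary term.\<close>

lemma integral_G_zero_finite:
  assumes "b < 0" "c \<noteq> 0"
  shows "has_bochner_integral lborel (\<lambda>x. indicator {0..} x * (Phi (b * x) * Phi (c * x)))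
    (- 1 / (b * c * sqrt (8 * pi)) * (b + c + sqrt (b\<^sup>2 + c\<^sup>2)))"
proof -
  have nz: "b \<noteq> 0" "c \<noteq> 0" using assms by auto
  obtain l where l: "(ibp_term b c \<longlongrightarrow> l) at_top" using ibp_term(3)[OF nz] by blast
  let ?P = "\<lambda>x. Phi (b * x) * Phi (c * x)"
  show ?thesis
  proof (rule has_integral_FTC_atLeast[where F = "\<lambda>x. x * ?P x - ibp_term b c x"])
    fix x
    have d: "(?P has_real_derivative b * std_normal_density (b * x) * Phi (c * x) + c * std_normal_density (c * x) * Phi (b * x)) (at x)"
      by (rule DERIV_mult[OF DERIV_Phi_mult DERIV_Phi_mult])
    show "((\<lambda>x. x * ?P x - ibp_term b c x) has_real_derivative ?P x) (at x)"
      by (rule DERIV_cong[OF DERIV_diff[OF DERIV_mult[OF DERIV_ident d] ibp_term(1)[OF nz d]]])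
         (simp add: algebra_simps)
    show "0 \<le> ?P x" by (intro mult_nonneg_nonneg Phi_bounds)
  next
    have "((\<lambda>x. x * Phi (- (- b) * x)) \<longlongrightarrow> 0) at_top" by (rule mult_Phi_tail) (use assms in simp)
    then have t: "((\<lambda>x. x * Phi (b * x)) \<longlongrightarrow> 0) at_top" by simp
    have "((\<lambda>x. x * ?P x) \<longlongrightarrow> 0) at_top"
    proof (rule Lim_null_comparison[OF _ t])
      show "\<forall>\<^sub>F x in at_top. norm (x * ?P x) \<le> x * Phi (b * x)"
        using eventually_ge_at_top[of 0]
      proof eventually_elim
        case (elim x)
        have "x * Phi (b * x) * Phi (c * x) \<le> x * Phi (b * x)"
          using elim Phi_bounds by (intro mult_left_le) auto
        then show ?case using elim Phi_bounds by (simp add: abs_mult mult.assoc)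
      qed
    qed
    from tendsto_diff[OF this l] show "((\<lambda>x. x * ?P x - ibp_term b c x) \<longlongrightarrow> - l) at_top" by simp
  qed (use ibp_term(2)[OF nz l] in simp_all)
qed

lemma integral_I1_infinite:
  assumes "c > 0"
  shows "has_bochner_integral lborel (\<lambda>x. indicator {0..} x * (1 - Phi (c * x))) (1 / (c * sqrt (2 * pi)))"
proof (rule has_integral_FTC_atLeast[where F = "\<lambda>x. x * (1 - Phi (c * x)) - std_normal_density (c * x) / c"])
  fix x
  have "((\<lambda>x. std_normal_density (c * x) / c) has_real_derivative - (c * x) * std_normal_density (c * x)) (at x)"
    unfolding std_normal_density_def using assms
    by (auto intro!: derivative_eq_intros simp: power2_eq_square)
  from DERIV_diff[OF DERIV_mult[OF DERIV_ident DERIV_diff[OF DERIV_const DERIV_Phi_mult]] this]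
  show "((\<lambda>x. x * (1 - Phi (c * x)) - std_normal_density (c * x) / c) has_real_derivative 1 - Phi (c * x)) (at x)"
    by (rule DERIV_cong) (simp add: algebra_simps)
  show "0 \<le> 1 - Phi (c * x)" using Phi_bounds by simp
next
  have "((\<lambda>x. std_normal_density (c * x) / c) \<longlongrightarrow> 0) at_top"
    unfolding std_normal_density_def using assms by real_asymp
  from tendsto_diff[OF mult_Phi_tail(1)[OF assms] this]
  show "((\<lambda>x. x * (1 - Phi (c * x)) - std_normal_density (c * x) / c) \<longlongrightarrow> 0) at_top" by simp
qed (simp_all add: std_normal_density_def)

lemma integral_gauss_half_line:
  assumes "a > 0"
  shows "has_bochner_integral lborel (\<lambda>x. indicator {0..} x * exp (- a * x\<^sup>2)) (sqrt pi / (2 * sqrt a))"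
proof (rule has_integral_FTC_atLeast[where F = "\<lambda>x. sqrt pi / sqrt a * Phi (sqrt (2 * a) * x)"])
  have k: "sqrt (2 * a) > 0" using assms by simp
  fix x
  have "((\<lambda>x. sqrt pi / sqrt a * Phi (sqrt (2 * a) * x)) has_real_derivative
      sqrt pi / sqrt a * (sqrt (2 * a) * std_normal_density (sqrt (2 * a) * x))) (at x)"
    by (rule DERIV_cmult[OF DERIV_Phi_mult])
  also have "sqrt pi / sqrt a * (sqrt (2 * a) * std_normal_density (sqrt (2 * a) * x)) = exp (- a * x\<^sup>2)"
    using assms by (simp add: std_normal_density_def power_mult_distrib real_sqrt_mult)
  finally show "((\<lambda>x. sqrt pi / sqrt a * Phi (sqrt (2 * a) * x)) has_real_derivative exp (- a * x\<^sup>2)) (at x)" .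
  have "((\<lambda>x. sqrt pi / sqrt a * Phi (sqrt (2 * a) * x)) \<longlongrightarrow> sqrt pi / sqrt a * 1) at_top"
    by (intro tendsto_intros Phi_mult_at_top k)
  then show "((\<lambda>x. sqrt pi / sqrt a * Phi (sqrt (2 * a) * x)) \<longlongrightarrow> sqrt pi / sqrt a) at_top" by simp
qed simp_all

text \<open>For \<open>a > 0\<close> the integrand has no elementary primitive, but the derivative of the integral with
  respect to \<open>b\<close> is a moment computed above, and equals that of the closed form.  By symmetry
  the difference of the two sides does not depend on \<open>b\<close> and \<open>c\<close>, and both are known at \<open>b = c = 0\<close>.\<close>

definition G_real :: "real \<Rightarrow> real \<Rightarrow> real \<Rightarrow> real" where
  "G_real a b c = sqrt pi / (8 * sqrt a) + 1 / (4 * sqrt (pi * a)) *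
     (arctan (b / sqrt (2 * a)) + arctan (c / sqrt (2 * a))
      + arctan (b * c / sqrt (2 * a * (2 * a + b\<^sup>2 + c\<^sup>2))))"

text \<open>What makes the derivative factorise is a (a + b^2 + c^2) + (b c)^2 = (a + b^2) (a +
  c^2). The lemma is used with \<open>2 * a\<close> in place of \<open>a\<close>.\<close>

lemma DERIV_arctan_quotient:
  fixes a b c :: real
  assumes "a > 0"
  shows "((\<lambda>b. arctan (b * c / sqrt (a * (a + b\<^sup>2 + c\<^sup>2)))) has_real_derivative
    sqrt a / (a + b\<^sup>2) * (c / sqrt (a + b\<^sup>2 + c\<^sup>2))) (at b)"
proof -
  define D where "D = a + b\<^sup>2 + c\<^sup>2"
  have D: "D > 0" using assms by (auto simp: D_def intro!: add_pos_nonneg)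
  define r where "r = sqrt D" define q where "q = sqrt a"
  have r: "r > 0" "r\<^sup>2 = D" and q: "q > 0" "q\<^sup>2 = a" using D assms by (auto simp: r_def q_def)
  have "((\<lambda>b. sqrt (a + b\<^sup>2 + c\<^sup>2)) has_real_derivative b / r) (at b)"
    using D by (auto intro!: derivative_eq_intros simp: D_def r_def field_simps)
  from DERIV_divide[OF DERIV_cmult_right[OF DERIV_ident, of c] DERIV_cmult[OF this, of q]]
  have "((\<lambda>b. b * c / (q * sqrt (a + b\<^sup>2 + c\<^sup>2))) has_real_derivative
      (c * (q * r) - b * c * (q * (b / r))) / ((q * r) * (q * r))) (at b)"
    using r(1) q(1) by (simp add: D_def[symmetric] r_def[symmetric])
  from DERIV_chain'[OF this DERIV_arctan]
  have "((\<lambda>b. arctan (b * c / (q * sqrt (a + b\<^sup>2 + c\<^sup>2)))) has_real_derivative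
      inverse (1 + (b * c / (q * r))\<^sup>2) * ((c * (q * r) - b * c * (q * (b / r))) / ((q * r) * (q * r)))) (at b)"
    by (simp add: D_def[symmetric] r_def[symmetric])
  also have "(c * (q * r) - b * c * (q * (b / r))) / ((q * r) * (q * r)) = c * (r\<^sup>2 - b\<^sup>2) / (q * r ^ 3)"
    using r(1) q(1) by (simp add: field_simps power2_eq_square power3_eq_cube)
  also have "1 + (b * c / (q * r))\<^sup>2 = (a + b\<^sup>2) * (a + c\<^sup>2) / (q * r)\<^sup>2"
  proof -
    have "(q * r)\<^sup>2 + (b * c)\<^sup>2 = (a + b\<^sup>2) * (a + c\<^sup>2)"
      unfolding power_mult_distrib r(2) q(2) D_def by (simp add: algebra_simps power2_eq_square)
    moreover have "1 + (b * c / (q * r))\<^sup>2 = ((q * r)\<^sup>2 + (b * c)\<^sup>2) / (q * r)\<^sup>2"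
      using r q by (simp add: power_divide add_divide_distrib)
    ultimately show ?thesis by simp
  qed
  also have "r\<^sup>2 - b\<^sup>2 = a + c\<^sup>2" unfolding r(2) D_def by simp
  also have "inverse ((a + b\<^sup>2) * (a + c\<^sup>2) / (q * r)\<^sup>2) * (c * (a + c\<^sup>2) / (q * r ^ 3)) = q / (a + b\<^sup>2) * (c / r)"
  proof -
    have *: "inverse (A * C / (q * r)\<^sup>2) * (c * C / (q * r ^ 3)) = q / A * (c / r)" if "A > 0" "C > 0" for A C
      using that r(1) q(1) by (simp add: field_simps power2_eq_square power3_eq_cube)
    show ?thesis by (rule *) (use assms in \<open>auto intro: add_pos_nonneg\<close>)
  qed
  finally show ?thesis
    unfolding q_def r_def D_def by (simp add: real_sqrt_mult)
qed

text \<open>The right-hand side has the shape of \<open>nn_integral_moment\<close> at rate a + b^2 /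
  2: differentiating Phi (b x) inserts x and the density at b x, whose exponent adds b^2 / 2 to the
  rate.\<close>

lemma DERIV_G_real:
  assumes "a > 0"
  shows "((\<lambda>b. G_real a b c) has_real_derivative
    (1 + c / sqrt (2 * (a + b\<^sup>2 / 2) + c\<^sup>2)) / (4 * (a + b\<^sup>2 / 2)) / sqrt (2 * pi)) (at b)"
proof -
  define q where "q = sqrt (2 * a)"
  have q: "q > 0" "q\<^sup>2 = 2 * a" using assms by (auto simp: q_def)
  define r where "r = c / sqrt (2 * a + b\<^sup>2 + c\<^sup>2)"
  have pos: "2 * a + b\<^sup>2 > 0" using assms by (auto intro: add_pos_nonneg)
  have "((\<lambda>b. arctan (b / q)) has_real_derivative inverse (1 + (b / q)\<^sup>2) * (1 / q)) (at b)"
    by (rule DERIV_chain'[OF _ DERIV_arctan]) (use q in \<open>auto intro!: derivative_eq_intros\<close>)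
  also have "inverse (1 + (b / q)\<^sup>2) * (1 / q) = q / (2 * a + b\<^sup>2)"
  proof -
    have "1 + (b / q)\<^sup>2 = (2 * a + b\<^sup>2) / q\<^sup>2"
      using q assms by (simp add: power_divide add_divide_distrib)
    then show ?thesis using q(1) by (simp add: power2_eq_square)
  qed
  finally have d1: "((\<lambda>b. arctan (b / q)) has_real_derivative q / (2 * a + b\<^sup>2)) (at b)" .
  have d2: "((\<lambda>b. arctan (b * c / sqrt (2 * a * (2 * a + b\<^sup>2 + c\<^sup>2)))) has_real_derivative
      q / (2 * a + b\<^sup>2) * r) (at b)"
    unfolding q_def r_def by (rule DERIV_arctan_quotient) (use assms in simp)
  have "((\<lambda>b. G_real a b c) has_real_derivative
      0 + 1 / (4 * sqrt (pi * a)) * (q / (2 * a + b\<^sup>2) + 0 + q / (2 * a + b\<^sup>2) * r)) (at b)"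
    unfolding G_real_def q_def[symmetric] by (intro DERIV_add DERIV_const DERIV_cmult d1 d2)
  also have "0 + 1 / (4 * sqrt (pi * a)) * (q / (2 * a + b\<^sup>2) + 0 + q / (2 * a + b\<^sup>2) * r)
      = (1 + r) / (4 * (a + b\<^sup>2 / 2)) / sqrt (2 * pi)"
  proof -
    have "q / sqrt (pi * a) = 2 / sqrt (2 * pi)"
    proof -
      have "q * sqrt (2 * pi) = 2 * sqrt (pi * a)"
        unfolding q_def by (simp add: real_sqrt_mult)
      then show ?thesis using assms by (simp add: field_simps)
    qed
    moreover have "1 / (4 * S) * (q / X + 0 + q / X * r) = q / S * ((1 + r) / (4 * X))" for S X :: real
      by (simp add: add_divide_distrib distrib_left)
    ultimately have "1 / (4 * sqrt (pi * a)) * (q / (2 * a + b\<^sup>2) + 0 + q / (2 * a + b\<^sup>2) * r)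
        = (2 / sqrt (2 * pi)) * ((1 + r) / (4 * (2 * a + b\<^sup>2)))"
      by presburger
    also have "\<dots> = (1 + r) / (4 * (a + b\<^sup>2 / 2)) / sqrt (2 * pi)"
      using pos by (simp add: field_simps)
    finally show ?thesis by simp
  qed
  finally show ?thesis unfolding r_def by (simp add: distrib_left)
qed

lemma moment_nonneg:
  fixes a c :: real
  assumes "a > 0"
  shows "0 \<le> (1 + c / sqrt (2 * a + c\<^sup>2)) / (4 * a)"
proof -
  have "\<bar>c\<bar> = sqrt (c\<^sup>2)" by simp
  also have "\<dots> \<le> sqrt (2 * a + c\<^sup>2)" using assms by (intro real_sqrt_le_mono) simp
  finally have "- c \<le> sqrt (2 * a + c\<^sup>2)" by linarith
  moreover have "sqrt (2 * a + c\<^sup>2) > 0" using assms by (simp add: add_pos_nonneg)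
  ultimately have "- 1 \<le> c / sqrt (2 * a + c\<^sup>2)" by (simp add: pos_le_divide_eq)
  then show ?thesis using assms by simp
qed

lemma G_real_mono:
  assumes "a > 0" "b1 \<le> b2"
  shows "G_real a b1 c \<le> G_real a b2 c"
proof (rule DERIV_nonneg_imp_nondecreasing[OF assms(2)])
  fix t
  have "a + t\<^sup>2 / 2 > 0" using assms(1) by (auto intro: add_pos_nonneg)
  from moment_nonneg[OF this, of c]
  have "0 \<le> (1 + c / sqrt (2 * (a + t\<^sup>2 / 2) + c\<^sup>2)) / (4 * (a + t\<^sup>2 / 2)) / sqrt (2 * pi)"
    by (rule divide_nonneg_nonneg) simp
  with DERIV_G_real[OF assms(1), of c t] show "\<exists>y. DERIV (\<lambda>b. G_real a b c) t :> y \<and> 0 \<le> y"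
    by blast
qed

text \<open>The increment of Phi (t x) between \<open>b1\<close> and \<open>b2\<close> is the
  integral of x times the density at t x. After exchanging the integrals, the inner one over x is a
  moment and the outer one over t is the increment of \<open>G_real\<close>. All integrands are
  nonnegative, so the exchange needs no integrability.\<close>

lemma nn_integral_G_step:
  assumes a: "a > 0" and "b1 \<le> b2"
  shows "(\<integral>\<^sup>+x. ennreal (exp (- a * x\<^sup>2) * Phi (b2 * x) * Phi (c * x)) * indicator {0..} x \<partial>lborel)
    = (\<integral>\<^sup>+x. ennreal (exp (- a * x\<^sup>2) * Phi (b1 * x) * Phi (c * x)) * indicator {0..} x \<partial>lborel)
      + ennreal (G_real a b2 c - G_real a b1 c)"
proof -
  define h where "h = (\<lambda>x t. ennreal (x * exp (- a * x\<^sup>2) * std_normal_density (t * x) * Phi (c * x)) * indicator {0..} x * indicator {b1..b2} t)"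
  have [measurable]: "case_prod h \<in> borel_measurable (lborel \<Otimes>\<^sub>M lborel)"
    unfolding h_def by measurable
  have "ennreal (exp (- a * x\<^sup>2) * Phi (b2 * x) * Phi (c * x)) * indicator {0..} x
      = ennreal (exp (- a * x\<^sup>2) * Phi (b1 * x) * Phi (c * x)) * indicator {0..} x + (\<integral>\<^sup>+t. h x t \<partial>lborel)" for x
  proof (cases "x \<ge> 0")
    case True
    let ?F = "\<lambda>t. exp (- a * x\<^sup>2) * Phi (c * x) * Phi (x * t)"
    have nn: "0 \<le> x * exp (- a * x\<^sup>2) * std_normal_density (t * x) * Phi (c * x)" for t
      using True Phi_bounds by (intro mult_nonneg_nonneg) auto
    have "(\<integral>\<^sup>+t. h x t \<partial>lborel)
        = (\<integral>\<^sup>+t. ennreal (x * exp (- a * x\<^sup>2) * std_normal_density (t * x) * Phi (c * x)) * indicator {b1..b2} t \<partial>lborel)"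
      using True by (simp add: h_def)
    also have "\<dots> = ennreal (?F b2 - ?F b1)"
    proof (rule nn_integral_FTC_Icc)
      fix t
      have "(?F has_real_derivative exp (- a * x\<^sup>2) * Phi (c * x) * (x * std_normal_density (x * t))) (at t)"
        by (rule DERIV_cmult[OF DERIV_Phi_mult])
      then show "(?F has_real_derivative x * exp (- a * x\<^sup>2) * std_normal_density (t * x) * Phi (c * x)) (at t)"
        by (rule DERIV_cong) (simp add: mult_ac)
    qed (use nn assms in auto)
    also have "ennreal (exp (- a * x\<^sup>2) * Phi (b1 * x) * Phi (c * x)) + ennreal (?F b2 - ?F b1)
        = ennreal (exp (- a * x\<^sup>2) * Phi (b2 * x) * Phi (c * x))"
    proof -
      have "?F b1 \<le> ?F b2"
      proof (rule DERIV_nonneg_imp_nondecreasing[OF assms(2)])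
        fix t
        have "DERIV ?F t :> exp (- a * x\<^sup>2) * Phi (c * x) * (x * std_normal_density (x * t))"
          by (rule DERIV_cmult[OF DERIV_Phi_mult])
        moreover have "0 \<le> exp (- a * x\<^sup>2) * Phi (c * x) * (x * std_normal_density (x * t))"
          using True Phi_bounds by (intro mult_nonneg_nonneg) auto
        ultimately show "\<exists>y. DERIV ?F t :> y \<and> 0 \<le> y" by blast
      qed
      then show ?thesis
        using Phi_bounds by (subst ennreal_plus[symmetric]) (auto simp: mult_ac intro!: mult_nonneg_nonneg)
    qed
    finally show ?thesis using True by (simp add: add.commute)
  qed (simp add: h_def)
  then have "(\<integral>\<^sup>+x. ennreal (exp (- a * x\<^sup>2) * Phi (b2 * x) * Phi (c * x)) * indicator {0..} x \<partial>lborel)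
    = (\<integral>\<^sup>+x. ennreal (exp (- a * x\<^sup>2) * Phi (b1 * x) * Phi (c * x)) * indicator {0..} x \<partial>lborel)
      + (\<integral>\<^sup>+x. \<integral>\<^sup>+t. h x t \<partial>lborel \<partial>lborel)"
    by (simp only:) (rule nn_integral_add; measurable)
  also have "(\<integral>\<^sup>+x. \<integral>\<^sup>+t. h x t \<partial>lborel \<partial>lborel) = (\<integral>\<^sup>+t. \<integral>\<^sup>+x. h x t \<partial>lborel \<partial>lborel)"
    by (rule lborel_pair.Fubini'[symmetric]) measurable
  also have "\<dots> = (\<integral>\<^sup>+t. ennreal ((1 + c / sqrt (2 * (a + t\<^sup>2 / 2) + c\<^sup>2)) / (4 * (a + t\<^sup>2 / 2)) / sqrt (2 * pi)) * indicator {b1..b2} t \<partial>lborel)"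
  proof (rule nn_integral_cong)
    fix t
    have a': "a + t\<^sup>2 / 2 > 0" using a by (auto intro: add_pos_nonneg)
    have "(\<integral>\<^sup>+x. h x t \<partial>lborel)
        = (\<integral>\<^sup>+x. ennreal (1 / sqrt (2 * pi)) * indicator {b1..b2} t * (ennreal (x * exp (- (a + t\<^sup>2 / 2) * x\<^sup>2) * Phi (c * x)) * indicator {0..} x) \<partial>lborel)"
    proof (rule nn_integral_cong)
      fix x
      have "x * exp (- a * x\<^sup>2) * std_normal_density (t * x) * Phi (c * x)
          = 1 / sqrt (2 * pi) * (x * exp (- (a + t\<^sup>2 / 2) * x\<^sup>2) * Phi (c * x))"
      proof -
        have "- (a + t\<^sup>2 / 2) * x\<^sup>2 = - a * x\<^sup>2 + - (t * x)\<^sup>2 / 2"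
          by (simp add: algebra_simps power_mult_distrib)
        then have "exp (- (a + t\<^sup>2 / 2) * x\<^sup>2) = exp (- a * x\<^sup>2) * exp (- (t * x)\<^sup>2 / 2)"
          by (simp only: exp_add)
        then show ?thesis by (simp add: std_normal_density_def)
      qed
      moreover have "ennreal (1 / sqrt (2 * pi) * (x * exp (- (a + t\<^sup>2 / 2) * x\<^sup>2) * Phi (c * x)))
          = ennreal (1 / sqrt (2 * pi)) * ennreal (x * exp (- (a + t\<^sup>2 / 2) * x\<^sup>2) * Phi (c * x))"
        by (rule ennreal_mult') simp
      ultimately show "h x t = ennreal (1 / sqrt (2 * pi)) * indicator {b1..b2} t * (ennreal (x * exp (- (a + t\<^sup>2 / 2) * x\<^sup>2) * Phi (c * x)) * indicator {0..} x)"
        unfolding h_def by (simp only: mult_ac)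
    qed
    also have "\<dots> = ennreal (1 / sqrt (2 * pi)) * indicator {b1..b2} t * ennreal ((1 + c / sqrt (2 * (a + t\<^sup>2 / 2) + c\<^sup>2)) / (4 * (a + t\<^sup>2 / 2)))"
      unfolding nn_integral_moment[OF a', symmetric] by (rule nn_integral_cmult) measurable
    also have "\<dots> = ennreal ((1 + c / sqrt (2 * (a + t\<^sup>2 / 2) + c\<^sup>2)) / (4 * (a + t\<^sup>2 / 2)) / sqrt (2 * pi)) * indicator {b1..b2} t"
    proof -
      have "ennreal (1 / sqrt (2 * pi) * ((1 + c / sqrt (2 * (a + t\<^sup>2 / 2) + c\<^sup>2)) / (4 * (a + t\<^sup>2 / 2))))
        = ennreal (1 / sqrt (2 * pi)) * ennreal ((1 + c / sqrt (2 * (a + t\<^sup>2 / 2) + c\<^sup>2)) / (4 * (a + t\<^sup>2 / 2)))"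
        by (rule ennreal_mult') simp
      then show ?thesis by (simp add: mult_ac)
    qed
    finally show "(\<integral>\<^sup>+x. h x t \<partial>lborel) = ennreal ((1 + c / sqrt (2 * (a + t\<^sup>2 / 2) + c\<^sup>2)) / (4 * (a + t\<^sup>2 / 2)) / sqrt (2 * pi)) * indicator {b1..b2} t" .
  qed
  also have "\<dots> = ennreal (G_real a b2 c - G_real a b1 c)"
  proof (rule nn_integral_FTC_Icc)
    fix t
    show "((\<lambda>b. G_real a b c) has_real_derivative (1 + c / sqrt (2 * (a + t\<^sup>2 / 2) + c\<^sup>2)) / (4 * (a + t\<^sup>2 / 2)) / sqrt (2 * pi)) (at t)"
      by (rule DERIV_G_real[OF a])
    have "a + t\<^sup>2 / 2 > 0" using a by (auto intro: add_pos_nonneg)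
    from moment_nonneg[OF this, of c]
    show "0 \<le> (1 + c / sqrt (2 * (a + t\<^sup>2 / 2) + c\<^sup>2)) / (4 * (a + t\<^sup>2 / 2)) / sqrt (2 * pi)"
      by (rule divide_nonneg_nonneg) simp
  qed (use assms in measurable)
  finally show ?thesis .
qed

lemma G_integrable:
  fixes a :: real and f :: "real \<Rightarrow> real"
  assumes "a > 0" "f \<in> borel_measurable borel" "\<And>x. 0 \<le> f x" "\<And>x. f x \<le> 1"
  shows "integrable lborel (\<lambda>x. indicator {0..} x * (exp (- a * x\<^sup>2) * f x))"
proof (rule Bochner_Integration.integrable_bound)
  show "integrable lborel (\<lambda>x. indicator {0..} x * exp (- a * x\<^sup>2))"
    using integral_gauss_half_line[OF assms(1)] by (simp add: has_bochner_integral_iff)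
  show "AE x in lborel. norm (indicator {0..} x * (exp (- a * x\<^sup>2) * f x)) \<le> norm (indicator {0..} x * exp (- a * x\<^sup>2))"
    using assms(3,4) by (intro AE_I2) (simp add: abs_mult indicator_def mult_left_le)
qed (use assms in measurable)

definition G_int :: "real \<Rightarrow> real \<Rightarrow> real \<Rightarrow> real" where
  "G_int a b c = (\<integral>x. indicator {0..} x * (exp (- a * x\<^sup>2) * (Phi (b * x) * Phi (c * x))) \<partial>lborel)"

lemma G_int_integrable:
  "a > 0 \<Longrightarrow> integrable lborel (\<lambda>x. indicator {0..} x * (exp (- a * x\<^sup>2) * (Phi (b * x) * Phi (c * x))))"
  by (rule G_integrable) (auto intro: Phi_bounds mult_nonneg_nonneg mult_le_one)

lemma G_int_step:
  assumes "a > 0" "b1 \<le> b2"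
  shows "G_int a b2 c - G_real a b2 c = G_int a b1 c - G_real a b1 c"
proof -
  have nn: "(\<integral>\<^sup>+x. ennreal (exp (- a * x\<^sup>2) * Phi (b * x) * Phi (c * x)) * indicator {0..} x \<partial>lborel) = ennreal (G_int a b c)" for b
  proof -
    have "(\<integral>\<^sup>+x. ennreal (exp (- a * x\<^sup>2) * Phi (b * x) * Phi (c * x)) * indicator {0..} x \<partial>lborel)
        = (\<integral>\<^sup>+x. ennreal (indicator {0..} x * (exp (- a * x\<^sup>2) * (Phi (b * x) * Phi (c * x)))) \<partial>lborel)"
      by (intro nn_integral_cong) (simp add: indicator_def mult.assoc)
    also have "\<dots> = ennreal (G_int a b c)"
      unfolding G_int_def by (intro nn_integral_eq_integral G_int_integrable assms AE_I2)
        (auto intro!: mult_nonneg_nonneg Phi_bounds)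
    finally show ?thesis .
  qed
  have nonneg: "0 \<le> G_int a b c" for b
    unfolding G_int_def by (intro integral_nonneg_AE AE_I2) (auto intro!: mult_nonneg_nonneg Phi_bounds)
  have mono: "G_real a b1 c \<le> G_real a b2 c" by (rule G_real_mono[OF assms])
  moreover have "ennreal (G_int a b2 c) = ennreal (G_int a b1 c) + ennreal (G_real a b2 c - G_real a b1 c)"
    using nn_integral_G_step[OF assms, of c] unfolding nn .
  ultimately have "ennreal (G_int a b2 c) = ennreal (G_int a b1 c + (G_real a b2 c - G_real a b1 c))"
    using nonneg by (subst ennreal_plus) simp_all
  then show ?thesis using nonneg[of b1] nonneg[of b2] mono by (subst (asm) ennreal_inj) auto
qed

lemma G_int_eq:
  assumes "a > 0"
  shows "G_int a b c = G_real a b c"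
proof -
  have indep: "G_int a b c - G_real a b c = G_int a b' c - G_real a b' c" for b b' c
    using G_int_step[OF assms, of b b' c] G_int_step[OF assms, of b' b c] by (cases "b \<le> b'") auto
  have sym: "G_int a b c = G_int a c b" "G_real a b c = G_real a c b" for b c
    unfolding G_int_def G_real_def by (simp_all add: mult_ac add_ac)
  have "G_int a 0 0 = (\<integral>x. indicator {0..} x * exp (- a * x\<^sup>2) / 4 \<partial>lborel)"
    unfolding G_int_def by (intro Bochner_Integration.integral_cong) auto
  also have "\<dots> = sqrt pi / (8 * sqrt a)"
    using integral_gauss_half_line[OF assms] by (simp add: has_bochner_integral_iff)
  finally have "G_int a 0 0 = G_real a 0 0" by (simp add: G_real_def)
  then show ?thesis using indep[of b c 0] indep[of c 0 0] sym(1)[of 0 c] sym(2)[of 0 c] by simp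
qed

lemma integral_G_finite:
  assumes "a > 0"
  shows "has_bochner_integral lborel (\<lambda>x. indicator {0..} x * (exp (- a * x\<^sup>2) * (Phi (b * x) * Phi (c * x)))) (G_real a b c)"
  using G_int_integrable[OF assms, of b c] G_int_eq[OF assms, of b c] by (simp add: has_bochner_integral_iff G_int_def)

text \<open>An infinite argument means a factor 1, which is twice \<open>Phi 0\<close>; the value is
  therefore twice the finite case at \<open>b = 0\<close>.\<close>

lemma integral_G_infinite:
  assumes "a > 0"
  shows "has_bochner_integral lborel (\<lambda>x. indicator {0..} x * (exp (- a * x\<^sup>2) * Phi (c * x)))
    (sqrt pi / (4 * sqrt a) + 1 / (2 * sqrt (pi * a)) * arctan (c / sqrt (2 * a)))"
proof -
  have "has_bochner_integral lborel (\<lambda>x. 2 * (indicator {0..} x * (exp (- a * x\<^sup>2) * (Phi (0 * x) * Phi (c * x))))) (2 * G_real a 0 c)"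
    by (intro has_bochner_integral_mult_right integral_G_finite assms)
  moreover have "2 * G_real a 0 c = sqrt pi / (4 * sqrt a) + 1 / (2 * sqrt (pi * a)) * arctan (c / sqrt (2 * a))"
    by (simp add: G_real_def field_simps)
  ultimately show ?thesis by simp
qed

definition Phi_ereal :: "ereal \<Rightarrow> real \<Rightarrow> real" where
  "Phi_ereal b x = (if b = \<infinity> then 1 else Phi (real_of_ereal b * x))"

lemma integral_I1:
  assumes "0 < b" "0 < c"
  shows "has_bochner_integral lborel (\<lambda>x. indicator {0..} x * (1 - Phi_ereal b x * Phi_ereal c x)) (I1 b c)"
proof -
  have pos: "real_of_ereal r > 0" if "0 < r" "r \<noteq> \<infinity>" for r using that by (cases r) auto
  show ?thesis
    using integral_I1_finite[of "real_of_ereal b" "real_of_ereal c"] integral_I1_infinite[of "real_of_ereal b"]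
      integral_I1_infinite[of "real_of_ereal c"] pos[OF assms(1)] pos[OF assms(2)]
    by (auto simp: I1_def Phi_ereal_def Let_def)
qed

text \<open>For \<open>a = 0\<close> convergence comes from a negative third argument. In the
  application \<open>a = 0\<close> forces \<sigma> = 1 for the parameter of that argument, which is
  then -1.\<close>

lemma integral_G:
  assumes "0 < a \<or> a = 0 \<and> b \<noteq> 0 \<and> b \<noteq> - \<infinity> \<and> c < 0 \<and> c \<noteq> - \<infinity>"
  shows "has_bochner_integral lborel (\<lambda>x. indicator {0..} x * (exp (- a * x\<^sup>2) * (Phi_ereal b x * Phi_ereal c x))) (G a b c)"
proof (cases "a > 0")
  case True
  then show ?thesis
    using integral_G_finite[OF True, of "real_of_ereal b" "real_of_ereal c"] integral_G_infinite[OF True, of "real_of_ereal b"]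
      integral_G_infinite[OF True, of "real_of_ereal c"] integral_gauss_half_line[OF True]
    by (auto simp: G_def G_pos_def Phi_ereal_def G_real_def Let_def)
next
  case False
  then have a: "a = 0" and b: "b \<noteq> 0" "b \<noteq> - \<infinity>" and c: "c < 0" "c \<noteq> - \<infinity>" using assms by auto
  have c': "real_of_ereal c < 0" "c \<noteq> \<infinity>" using c by (cases c; auto)+
  have b': "real_of_ereal b \<noteq> 0" if "b \<noteq> \<infinity>" using b that by (cases b) (auto simp: zero_ereal_def)
  have inf: "has_bochner_integral lborel (\<lambda>x. indicator {0..} x * Phi (real_of_ereal c * x)) (- 1 / (real_of_ereal c * sqrt (2 * pi)))"
    using integral_I1_infinite[of "- real_of_ereal c"] c' by (simp add: Phi_minus)
  show ?thesis
    using integral_G_zero_finite[OF c'(1) b'] inf c'(2)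
    by (auto simp: a G_def G_zero_def Phi_ereal_def Let_def mult_ac add_ac)
qed

subsection \<open>The support function of the hull\<close>

lemma inner_real_2: "(x :: real^2) \<bullet> u = x $ 1 * u $ 1 + x $ 2 * u $ 2"
  by (simp add: inner_vec_def sum_2)

text \<open>The coordinates are uncorrelated with equal covariances, so the projection to a unit
  vector has that common covariance multiplied by the squared length 1: the law is invariant under
  rotation.\<close>

lemma (in prob_space) planar_bridge_inner:
  assumes B: "planar_brownian_bridge M B" and u: "norm u = 1" and s: "s \<in> {0..1}" and t: "t \<in> {0..1}"
  shows "(\<lambda>\<omega>. B s \<omega> \<bullet> u) \<in> borel_measurable M"
    and "integrable M (\<lambda>\<omega>. B s \<omega> \<bullet> u)" "expectation (\<lambda>\<omega>. B s \<omega> \<bullet> u) = 0"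
    and "integrable M (\<lambda>\<omega>. (B s \<omega> \<bullet> u) * (B t \<omega> \<bullet> u))"
    and "expectation (\<lambda>\<omega>. (B s \<omega> \<bullet> u) * (B t \<omega> \<bullet> u)) = min s t - s * t"
proof -
  have meas: "B r \<in> borel_measurable M" if "r \<in> {0..1}" for r
    using B that by (simp add: planar_brownian_bridge_def gaussian_process_def)
  have mean: "expectation (\<lambda>\<omega>. B r \<omega> $ i) = 0" if "r \<in> {0..1}" for r i
    using B that by (simp add: planar_brownian_bridge_def)
  have cov: "expectation (\<lambda>\<omega>. B p \<omega> $ i * B r \<omega> $ j) = (if i = j then min p r - p * r else 0)"
    if "p \<in> {0..1}" "r \<in> {0..1}" for p r i j
    using B that unfolding planar_brownian_bridge_def by blast
  have gauss: "gaussian_rv M (\<lambda>\<omega>. B r \<omega> $ i)" if "r \<in> {0..1}" for r i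
  proof -
    have "gaussian_rv M (\<lambda>\<omega>. \<Sum>t\<in>{r}. axis i 1 \<bullet> B t \<omega>)"
      using B that unfolding planar_brownian_bridge_def gaussian_process_def
      by (elim conjE) (erule allE[of _ "{r}"], erule allE[of _ "\<lambda>_. axis i 1"], simp)
    then show ?thesis by (simp add: inner_axis inner_commute[of "axis i 1"])
  qed
  have comp_meas: "(\<lambda>\<omega>. B r \<omega> $ i) \<in> borel_measurable M" if "r \<in> {0..1}" for r i
    using gauss[OF that] by (simp add: gaussian_rv_def)
  have int: "integrable M (\<lambda>\<omega>. B r \<omega> $ i)" "integrable M (\<lambda>\<omega>. (B r \<omega> $ i)\<^sup>2)" if "r \<in> {0..1}" for r i
    using gaussian_centered(1,2)[OF gauss[OF that] mean[OF that]] .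
  have int2: "integrable M (\<lambda>\<omega>. B p \<omega> $ i * B r \<omega> $ j)" if "p \<in> {0..1}" "r \<in> {0..1}" for p r i j
    using comp_meas int(2) that by (intro integrable_mult_of_squares)
  show "(\<lambda>\<omega>. B s \<omega> \<bullet> u) \<in> borel_measurable M"
    by (intro borel_measurable_inner meas s) simp
  show "integrable M (\<lambda>\<omega>. B s \<omega> \<bullet> u)"
    unfolding inner_real_2 by (intro Bochner_Integration.integrable_add integrable_mult_left int s)
  show "expectation (\<lambda>\<omega>. B s \<omega> \<bullet> u) = 0"
    unfolding inner_real_2 using int(1)[OF s] mean[OF s] by simp
  have eq: "(B s \<omega> \<bullet> u) * (B t \<omega> \<bullet> u) =
      ((u$1 * u$1) * (B s \<omega> $ 1 * B t \<omega> $ 1) + (u$1 * u$2) * (B s \<omega> $ 1 * B t \<omega> $ 2))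
      + ((u$2 * u$1) * (B s \<omega> $ 2 * B t \<omega> $ 1) + (u$2 * u$2) * (B s \<omega> $ 2 * B t \<omega> $ 2))" for \<omega>
    by (simp add: inner_real_2 algebra_simps)
  show "integrable M (\<lambda>\<omega>. (B s \<omega> \<bullet> u) * (B t \<omega> \<bullet> u))"
    unfolding eq by (intro Bochner_Integration.integrable_add integrable_mult_right int2 s t)
  have "expectation (\<lambda>\<omega>. (B s \<omega> \<bullet> u) * (B t \<omega> \<bullet> u)) = (u$1 * u$1 + u$2 * u$2) * (min s t - s * t)"
    unfolding eq using int2[OF s t] cov[OF s t] by (simp add: distrib_right)
  also have "u$1 * u$1 + u$2 * u$2 = 1"
    using u by (simp add: norm_eq_sqrt_inner inner_real_2)
  finally show "expectation (\<lambda>\<omega>. (B s \<omega> \<bullet> u) * (B t \<omega> \<bullet> u)) = min s t - s * t" by simp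
qed

lemma (in prob_space) planar_bridge_start:
  assumes "planar_brownian_bridge M B" "norm u = 1"
  shows "AE \<omega> in M. B 0 \<omega> \<bullet> u = 0"
proof -
  have 0: "0 \<in> {0..1::real}" by simp
  note m = planar_bridge_inner[OF assms 0 0]
  show ?thesis using m(4,5) by (intro AE_zero_of_square_integral) simp_all
qed

text \<open>The starting point is subtracted because it is \<open>0\<close> only almost surely.\<close>

lemma (in prob_space) planar_bridge_std_bridge:
  assumes B: "planar_brownian_bridge M B" and u: "norm u = 1"
  shows "std_bridge M (\<lambda>t \<omega>. B t \<omega> \<bullet> u - B 0 \<omega> \<bullet> u)"
proof
  have z: "0 \<in> {0..1::real}" by simp
  note m = planar_bridge_inner[OF B u]
  show "(\<lambda>\<omega>. B t \<omega> \<bullet> u - B 0 \<omega> \<bullet> u) \<in> borel_measurable M" if "t \<in> {0..1}" for t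
    using m(1)[OF that that] m(1)[OF z z] by (rule borel_measurable_diff)
  show "gaussian_rv M (\<lambda>\<omega>. \<Sum>t\<in>T. c t * (B t \<omega> \<bullet> u - B 0 \<omega> \<bullet> u))"
    if T: "finite T" "T \<subseteq> {0..1}" for T and c :: "real \<Rightarrow> real"
  proof -
    \<comment> \<open>Subtracting the start in every term amounts to lowering the coefficient of the
      value at time 0 by the sum of all coefficients; 0 may or may not belong to
      \<open>T\<close>.\<close>
    define d where "d = (\<lambda>t. ((if t \<in> T then c t else 0) - (if t = 0 then sum c T else 0)) *\<^sub>R u)"
    have "(\<Sum>t\<in>T. c t * (B t \<omega> \<bullet> u - B 0 \<omega> \<bullet> u)) = (\<Sum>t\<in>insert 0 T. d t \<bullet> B t \<omega>)" for \<omega>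
    proof -
      have "(\<Sum>t\<in>insert 0 T. d t \<bullet> B t \<omega>)
          = (\<Sum>t\<in>insert 0 T. (if t \<in> T then c t * (B t \<omega> \<bullet> u) else 0) - (if t = 0 then sum c T * (B 0 \<omega> \<bullet> u) else 0))"
        by (intro sum.cong refl) (auto simp: d_def inner_commute[of u] algebra_simps)
      also have "\<dots> = (\<Sum>t\<in>insert 0 T. (if t \<in> T then c t * (B t \<omega> \<bullet> u) else 0)) - sum c T * (B 0 \<omega> \<bullet> u)"
        unfolding sum_subtractf using T by (subst sum.delta) auto
      also have "(\<Sum>t\<in>insert 0 T. (if t \<in> T then c t * (B t \<omega> \<bullet> u) else 0)) = (\<Sum>t\<in>T. c t * (B t \<omega> \<bullet> u))"
        using T by (intro sum.mono_neutral_cong_right) auto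
      finally show ?thesis by (simp add: right_diff_distrib sum_subtractf sum_distrib_right)
    qed
    moreover have "gaussian_rv M (\<lambda>\<omega>. \<Sum>t\<in>insert 0 T. d t \<bullet> B t \<omega>)"
    proof -
      have "finite (insert 0 T) \<and> insert 0 T \<subseteq> {0..1}" using T by auto
      then show ?thesis using B unfolding planar_brownian_bridge_def gaussian_process_def by blast
    qed
    ultimately show ?thesis by presburger
  qed
  show "continuous_on {0..1} (\<lambda>t. B t \<omega> \<bullet> u - B 0 \<omega> \<bullet> u)" if "\<omega> \<in> space M" for \<omega>
  proof -
    have "continuous_on {0..1} (\<lambda>t. B t \<omega>)" using B that by (simp add: planar_brownian_bridge_def)
    then show ?thesis by (intro continuous_intros)
  qed
  show "expectation (\<lambda>\<omega>. B t \<omega> \<bullet> u - B 0 \<omega> \<bullet> u) = 0" if "t \<in> {0..1}" for t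
    using m(2,3)[OF that that] m(2,3)[OF z z] by simp
  show "expectation (\<lambda>\<omega>. (B s \<omega> \<bullet> u - B 0 \<omega> \<bullet> u) * (B t \<omega> \<bullet> u - B 0 \<omega> \<bullet> u)) = min s t - s * t"
    if s: "s \<in> {0..1}" and t: "t \<in> {0..1}" for s t
  proof -
    have eq: "(B s \<omega> \<bullet> u - B 0 \<omega> \<bullet> u) * (B t \<omega> \<bullet> u - B 0 \<omega> \<bullet> u)
        = ((B s \<omega> \<bullet> u) * (B t \<omega> \<bullet> u) - (B s \<omega> \<bullet> u) * (B 0 \<omega> \<bullet> u))
          - ((B 0 \<omega> \<bullet> u) * (B t \<omega> \<bullet> u) - (B 0 \<omega> \<bullet> u) * (B 0 \<omega> \<bullet> u))" for \<omega>
      by (simp add: algebra_simps)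
    show ?thesis
      unfolding eq using m(4,5)[OF s t] m(4,5)[OF s z] m(4,5)[OF z t] m(4,5)[OF z z] s t by simp
  qed
qed simp

lemma prod_UNIV_Basis: "(\<Prod>i\<in>UNIV. f (z $ i)) = (\<Prod>b\<in>Basis. f (z \<bullet> b))" for z :: "real^'n"
proof -
  have "(Basis :: (real^'n) set) = (\<lambda>i. axis i 1) ` UNIV" by (auto simp: Basis_vec_def)
  moreover have "inj (\<lambda>i. axis i (1::real) :: real^'n)" by (auto simp: inj_on_def axis_eq_axis)
  then have "(\<Prod>b\<in>range (\<lambda>i. axis i (1::real) :: real^'n). f (z \<bullet> b)) = (\<Prod>i\<in>UNIV. f (z $ i))"
    by (subst prod.reindex) (simp_all add: inner_axis)
  ultimately show ?thesis by (simp only:)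
qed

lemma lborel_eq_distr_PiM:
  "(lborel :: 'a::euclidean_space measure) = distr (\<Pi>\<^sub>M b\<in>Basis. lborel) borel (\<lambda>f. \<Sum>b\<in>Basis. f b *\<^sub>R b)"
  unfolding lborel_eq_real by (rule lborel_def)

lemma std_normal_integral_iexp:
  "integrable lborel (\<lambda>x. std_normal_density x *\<^sub>R iexp (t * x))"
  "(CLINT x|lborel. std_normal_density x *\<^sub>R iexp (t * x)) = of_real (exp (- t\<^sup>2 / 2))"
proof -
  interpret real_distribution std_normal_distribution by (rule real_dist_normal_dist)
  have "integrable std_normal_distribution (\<lambda>x. iexp (t * x))"
    by (rule integrable_const_bound[of _ 1]) auto
  then show "integrable lborel (\<lambda>x. std_normal_density x *\<^sub>R iexp (t * x))"
    by (subst (asm) integrable_density) auto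
  have "char std_normal_distribution t = (CLINT x|lborel. std_normal_density x *\<^sub>R iexp (t * x))"
    unfolding char_def by (rule integral_density) auto
  then show "(CLINT x|lborel. std_normal_density x *\<^sub>R iexp (t * x)) = of_real (exp (- t\<^sup>2 / 2))"
    by (simp add: char_std_normal_distribution)
qed

text \<open>The characteristic function of the projection factorises over the basis, and the squared
  coordinates of \<open>u\<close> in the exponents add up to 1.\<close>

lemma (in prob_space) std_gaussian_vector_inner:
  assumes Z: "std_gaussian_vector M Z" and u: "norm u = 1"
  shows "Z \<in> borel_measurable M" "distr M borel (\<lambda>\<omega>. Z \<omega> \<bullet> u) = std_normal_distribution"
proof -
  define d where "d = (\<lambda>z :: real^2. \<Prod>i\<in>UNIV. std_normal_density (z $ i))"
  have D: "distributed M lborel Z (\<lambda>z. ennreal (d z))" using Z by (simp add: std_gaussian_vector_def d_def)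
  then show [measurable]: "Z \<in> borel_measurable M" using distributed_measurable[OF D] by simp
  have d_eq: "d z = (\<Prod>b\<in>Basis. std_normal_density (z \<bullet> b))" for z
    unfolding d_def by (rule prod_UNIV_Basis)
  have d [measurable]: "d \<in> borel_measurable borel"
    unfolding d_eq[abs_def] by measurable
  have d_nn: "0 \<le> d z" for z by (simp add: d_def prod_nonneg)
  show "distr M borel (\<lambda>\<omega>. Z \<omega> \<bullet> u) = std_normal_distribution"
  proof (rule Levy_uniqueness[OF _ real_dist_normal_dist])
    show "real_distribution (distr M borel (\<lambda>\<omega>. Z \<omega> \<bullet> u))"
      by (rule real_distribution_distr) simp
    show "char (distr M borel (\<lambda>\<omega>. Z \<omega> \<bullet> u)) = char std_normal_distribution"
    proof
      fix s :: real
      define f where "f = (\<lambda>b::real^2. \<lambda>x. std_normal_density x *\<^sub>R iexp (s * (b \<bullet> u) * x))"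
      have iexp_meas [measurable]: "(\<lambda>z. iexp (s * (z \<bullet> u))) \<in> borel_measurable borel" by measurable
      have "char (distr M borel (\<lambda>\<omega>. Z \<omega> \<bullet> u)) s = (CLINT \<omega>|M. iexp (s * (Z \<omega> \<bullet> u)))"
        unfolding char_def by (rule integral_distr) auto
      also have "\<dots> = (CLINT z|distr M lborel Z. iexp (s * (z \<bullet> u)))"
        by (rule integral_distr[symmetric]) auto
      also have "\<dots> = (CLINT z|lborel. d z *\<^sub>R iexp (s * (z \<bullet> u)))"
        unfolding distributed_distr_eq_density[OF D] using d_nn by (intro integral_density) auto
      also have "\<dots> = (CLINT z|lborel. (\<Prod>b\<in>Basis. f b (z \<bullet> b)))"
      proof (intro Bochner_Integration.integral_cong refl)
        fix z :: "real^2"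
        have "z \<bullet> u = (\<Sum>b\<in>Basis. (z \<bullet> b) * (u \<bullet> b))" by (rule euclidean_inner)
        then have "complex_of_real (s * (z \<bullet> u)) = (\<Sum>b\<in>Basis. complex_of_real (s * (b \<bullet> u) * (z \<bullet> b)))"
          by (simp add: sum_distrib_left inner_commute mult_ac)
        then have "iexp (s * (z \<bullet> u)) = (\<Prod>b\<in>Basis. iexp (s * (b \<bullet> u) * (z \<bullet> b)))"
          by (simp only: sum_distrib_left exp_sum finite_Basis)
        then show "d z *\<^sub>R iexp (s * (z \<bullet> u)) = (\<Prod>b\<in>Basis. f b (z \<bullet> b))"
          unfolding d_eq f_def scaleR_conv_of_real of_real_prod by (simp only: prod.distrib)
      qed
      also have "\<dots> = (CLINT x|(\<Pi>\<^sub>M b\<in>Basis. lborel). (\<Prod>b\<in>Basis. f b (x b)))"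
      proof -
        have "(CLINT z|lborel. (\<Prod>b\<in>Basis. f b (z \<bullet> b)))
            = (CLINT x|(\<Pi>\<^sub>M b\<in>Basis. lborel). (\<Prod>b\<in>Basis. f b ((\<Sum>b\<in>Basis. x b *\<^sub>R b) \<bullet> b)))"
          unfolding lborel_eq_distr_PiM[where 'a = "real^2"]
        proof (rule integral_distr)
          show "(\<lambda>x. \<Sum>b\<in>Basis. x b *\<^sub>R b) \<in> (\<Pi>\<^sub>M b\<in>Basis. lborel) \<rightarrow>\<^sub>M (borel :: (real^2) measure)"
            by (intro borel_measurable_sum borel_measurable_scaleR measurable_component_singleton[THEN measurable_compose])
               simp_all
          show "(\<lambda>z. \<Prod>b\<in>Basis. f b (z \<bullet> b)) \<in> borel_measurable (borel :: (real^2) measure)"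
            unfolding f_def by measurable
        qed
        also have "\<dots> = (CLINT x|(\<Pi>\<^sub>M b\<in>Basis. lborel). (\<Prod>b\<in>Basis. f b (x b)))"
          by (intro Bochner_Integration.integral_cong prod.cong refl) simp
        finally show ?thesis .
      qed
      also have "\<dots> = (\<Prod>b\<in>Basis. CLINT x|lborel. f b x)"
      proof -
        interpret product_sigma_finite "\<lambda>b::real^2. lborel :: real measure" by standard
        show ?thesis by (rule product_integral_prod) (simp, unfold f_def, rule std_normal_integral_iexp(1))
      qed
      also have "\<dots> = of_real (\<Prod>b\<in>Basis. exp (- (s * (b \<bullet> u))\<^sup>2 / 2))"
        unfolding f_def std_normal_integral_iexp(2) of_real_prod ..
      also have "(\<Prod>b\<in>Basis. exp (- (s * (b \<bullet> u))\<^sup>2 / 2)) = exp (\<Sum>b\<in>Basis. - (s * (b \<bullet> u))\<^sup>2 / 2)"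
        by (rule exp_sum[symmetric]) simp
      also have "(\<Sum>b\<in>Basis. - (s * (b \<bullet> u))\<^sup>2 / 2) = - s\<^sup>2 / 2"
      proof -
        have "(\<Sum>b\<in>Basis. (b \<bullet> u)\<^sup>2) = 1"
          using u euclidean_inner[of u u] by (simp add: norm_eq_sqrt_inner power2_eq_square inner_commute)
        moreover have "(\<Sum>b\<in>Basis. - (s * (b \<bullet> u))\<^sup>2 / 2) = - s\<^sup>2 / 2 * (\<Sum>b\<in>Basis. (b \<bullet> u)\<^sup>2)"
          by (simp add: sum_distrib_left power_mult_distrib)
        ultimately show ?thesis by simp
      qed
      finally show "char (distr M borel (\<lambda>\<omega>. Z \<omega> \<bullet> u)) s = char std_normal_distribution s"
        by (simp add: char_std_normal_distribution)
    qed
  qed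
qed

section \<open>The law of the maximum in a fixed direction\<close>

text \<open>Independence in the form of a product law. \<open>Y\<close>, which will be the Gaussian
  vector, comes first, so that a slice of a measurable set fixes the endpoint and leaves an event
  about the bridge.\<close>

lemma (in prob_space) indep_rvs_distr_pair:
  assumes ind: "indep_rvs M S X T Y"
  shows "X \<in> measurable M S" "Y \<in> measurable M T"
    and "distr M T Y \<Otimes>\<^sub>M distr M S X = distr M (T \<Otimes>\<^sub>M S) (\<lambda>\<omega>. (Y \<omega>, X \<omega>))"
proof -
  show X: "X \<in> measurable M S" and Y: "Y \<in> measurable M T" using ind by (auto simp: indep_rvs_def)
  interpret X: prob_space "distr M S X" by (rule prob_space_distr[OF X])
  interpret Y: prob_space "distr M T Y" by (rule prob_space_distr[OF Y])
  show "distr M T Y \<Otimes>\<^sub>M distr M S X = distr M (T \<Otimes>\<^sub>M S) (\<lambda>\<omega>. (Y \<omega>, X \<omega>))"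
  proof (rule pair_measure_eqI)
    show "sigma_finite_measure (distr M T Y)" "sigma_finite_measure (distr M S X)" by unfold_locales
    fix C A assume C: "C \<in> sets (distr M T Y)" and A: "A \<in> sets (distr M S X)"
    have "prob ((X -` A \<inter> space M) \<inter> (Y -` C \<inter> space M)) = prob (X -` A \<inter> space M) * prob (Y -` C \<inter> space M)"
      using ind A C unfolding indep_rvs_def by (intro indep_setD) auto
    moreover have "(\<lambda>\<omega>. (Y \<omega>, X \<omega>)) -` (C \<times> A) \<inter> space M = (X -` A \<inter> space M) \<inter> (Y -` C \<inter> space M)" by auto
    moreover have "(\<lambda>\<omega>. (Y \<omega>, X \<omega>)) \<in> measurable M (T \<Otimes>\<^sub>M S)" using X Y by measurable
    ultimately show "emeasure (distr M T Y) C * emeasure (distr M S X) A = emeasure (distr M (T \<Otimes>\<^sub>M S) (\<lambda>\<omega>. (Y \<omega>, X \<omega>))) (C \<times> A)"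
      using X Y A C by (simp add: emeasure_distr emeasure_eq_measure ennreal_mult'[symmetric] mult.commute)
  qed simp
qed

text \<open>Continuity reduces the condition to countably many times, which makes the events
  measurable for the product of Borel sets over \<open>{0..1}\<close>.\<close>

lemma ball_unit_interval_Rats:
  fixes f :: "real \<Rightarrow> real"
  assumes "continuous_on {0..1} f"
  shows "(\<forall>t\<in>{0..1}. f t \<le> x) \<longleftrightarrow> (\<forall>t\<in>\<rat> \<inter> {0..1}. f t \<le> x)"
proof
  assume le: "\<forall>t\<in>\<rat> \<inter> {0..1}. f t \<le> x"
  have dense: "closure (\<rat> \<inter> {0..1}) = {0..1::real}"
  proof
    show "closure (\<rat> \<inter> {0..1}) \<subseteq> {0..1::real}" by (rule closure_minimal) auto
    have "closure \<rat> = (UNIV :: real set)" by (rule Rats_closure_real)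
    then have "{0<..<1::real} \<subseteq> closure ({0<..<1} \<inter> \<rat>)"
      using open_Int_closure_subset[of "{0<..<1::real}" \<rat>] by simp
    also have "\<dots> \<subseteq> closure (\<rat> \<inter> {0..1})" by (intro closure_mono) auto
    finally have "closure {0<..<1::real} \<subseteq> closure (\<rat> \<inter> {0..1})" by (intro closure_minimal) auto
    then show "{0..1::real} \<subseteq> closure (\<rat> \<inter> {0..1})" by simp
  qed
  show "\<forall>t\<in>{0..1}. f t \<le> x"
  proof
    fix t :: real assume "t \<in> {0..1}"
    then show "f t \<le> x"
      using continuous_le_on_closure[of "\<rat> \<inter> {0..1}" f t x] le assms unfolding dense by auto
  qed
qed auto

lemma sets_Ball_unit_Rats:
  assumes "\<And>t :: real. t \<in> \<rat> \<inter> {0..1} \<Longrightarrow> {w \<in> space N. P t w} \<in> sets N"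
  shows "{w \<in> space N. \<forall>t\<in>\<rat> \<inter> {0..1}. P t w} \<in> sets N"
proof -
  have "0 \<in> \<rat> \<inter> {0..1::real}" by simp
  then have "{w \<in> space N. \<forall>t\<in>\<rat> \<inter> {0..1}. P t w} = (\<Inter>t\<in>\<rat> \<inter> {0..1}. {w \<in> space N. P t w})"
    by blast
  also have "\<dots> \<in> sets N"
    using assms \<open>0 \<in> _\<close> by (intro sets.countable_INT' countable_Int1 countable_rat) auto
  finally show ?thesis .
qed

text \<open>Passes from the bridge with its start subtracted to the given one, equal to it almost
  surely, and adds the endpoints \<open>y \<ge> x\<close>: the event shrinks as \<open>y\<close>
  grows, and its probability tends to 0 as \<open>y\<close> approaches \<open>x\<close> from
  below.\<close>

lemma (in prob_space) bridge_below_line: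
  assumes B: "planar_brownian_bridge M B" and u: "norm u = 1" and x: "x > 0"
  shows "{\<omega> \<in> space M. \<forall>t\<in>{0..1}. B t \<omega> \<bullet> u + y * t \<le> x} \<in> events"
    and "prob {\<omega> \<in> space M. \<forall>t\<in>{0..1}. B t \<omega> \<bullet> u + y * t \<le> x} = (if y < x then 1 - exp (- 2 * x * (x - y)) else 0)"
proof -
  interpret b: std_bridge M "\<lambda>t \<omega>. B t \<omega> \<bullet> u - B 0 \<omega> \<bullet> u"
    by (rule planar_bridge_std_bridge[OF B u])
  define N where "N = (\<lambda>y. {\<omega> \<in> space M. \<forall>t\<in>{0..1}. B t \<omega> \<bullet> u + y * t \<le> x})"
  have cont: "continuous_on {0..1} (\<lambda>t. B t \<omega>)" if "\<omega> \<in> space M" for \<omega>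
    using B that by (simp add: planar_brownian_bridge_def)
  have N_ev: "N y \<in> events" for y
  proof -
    have "N y = {\<omega> \<in> space M. \<forall>t\<in>\<rat> \<inter> {0..1}. B t \<omega> \<bullet> u + y * t \<le> x}"
      unfolding N_def using cont by (intro Collect_cong conj_cong refl ball_unit_interval_Rats) (intro continuous_intros)
    also have "\<dots> \<in> events"
    proof (rule sets_Ball_unit_Rats)
      fix t :: real assume "t \<in> \<rat> \<inter> {0..1}"
      then have [measurable]: "(\<lambda>\<omega>. B t \<omega> \<bullet> u) \<in> borel_measurable M" using planar_bridge_inner(1)[OF B u] by blast
      show "{\<omega> \<in> space M. B t \<omega> \<bullet> u + y * t \<le> x} \<in> events" by measurable
    qed
    finally show ?thesis .
  qed
  then show "{\<omega> \<in> space M. \<forall>t\<in>{0..1}. B t \<omega> \<bullet> u + y * t \<le> x} \<in> events" by (simp add: N_def)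
  have N_less: "prob (N y) = 1 - exp (- 2 * x * (x - y))" if "y < x" for y
  proof -
    let ?N = "{\<omega> \<in> space M. \<forall>t\<in>{0..1}. (B t \<omega> \<bullet> u - B 0 \<omega> \<bullet> u) + y * t \<le> x}"
    have "AE \<omega> in M. \<omega> \<in> N y \<longleftrightarrow> \<omega> \<in> ?N"
      using planar_bridge_start[OF B u] by eventually_elim (simp add: N_def)
    then have "prob (N y) = prob ?N"
      using N_ev b.prob_below_line(1)[OF x that] by (intro finite_measure_eq_AE)
    also have "\<dots> = 1 - exp (- 2 * x * (x - y))" by (rule b.prob_below_line(2)[OF x that])
    finally show ?thesis .
  qed
  have "prob (N y) = 0" if "\<not> y < x"
  proof -
    have "prob (N y) \<le> 1 - exp (- 2 * x * (x - y'))" if "y' < x" for y'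
    proof -
      have "N y \<subseteq> N y'"
      proof
        fix \<omega> assume \<omega>: "\<omega> \<in> N y"
        have "B t \<omega> \<bullet> u + y' * t \<le> x" if "t \<in> {0..1}" for t
        proof -
          have "y' * t \<le> y * t" using that \<open>y' < x\<close> \<open>\<not> y < x\<close> by (intro mult_right_mono) auto
          then show ?thesis using \<omega> that by (force simp: N_def)
        qed
        then show "\<omega> \<in> N y'" using \<omega> by (simp add: N_def)
      qed
      then have "prob (N y) \<le> prob (N y')" by (intro finite_measure_mono N_ev)
      then show ?thesis using N_less[OF that] by simp
    qed
    then have "\<forall>\<^sub>F y' in at_left x. prob (N y) \<le> 1 - exp (- 2 * x * (x - y'))"
      unfolding eventually_at_filter by (intro always_eventually) auto
    moreover have "((\<lambda>y'. 1 - exp (- 2 * x * (x - y'))) \<longlongrightarrow> 1 - exp (- 2 * x * (x - x))) (at_left x)"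
      by (intro tendsto_intros)
    ultimately have "prob (N y) \<le> 1 - exp (- 2 * x * (x - x))"
      by (intro tendsto_lowerbound) auto
    then show ?thesis using measure_nonneg[of M "N y"] by simp
  qed
  then show "prob {\<omega> \<in> space M. \<forall>t\<in>{0..1}. B t \<omega> \<bullet> u + y * t \<le> x} = (if y < x then 1 - exp (- 2 * x * (x - y)) else 0)"
    using N_less by (simp add: N_def)
qed

lemma Phi_eq_integral: "Phi w = (\<integral>v. std_normal_density v * indicator {..w} v \<partial>lborel)"
proof -
  interpret real_distribution std_normal_distribution by (rule real_dist_normal_dist)
  have "Phi w = (\<integral>v. indicator {..w} v \<partial>std_normal_distribution)"
    by (simp add: Phi_def)
  also have "\<dots> = (\<integral>v. std_normal_density v *\<^sub>R indicator {..w} v \<partial>lborel)"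
    by (rule integral_density) auto
  finally show ?thesis by simp
qed

text \<open>Tilting and translating turn the truncated exponential moment into a distribution
  function at the shifted point.\<close>

lemma tilted_normal_cdf:
  "has_bochner_integral std_normal_distribution (\<lambda>v. indicator {..w} v * exp (l * v)) (exp (l\<^sup>2 / 2) * Phi (w - l))"
proof -
  have eq: "std_normal_density v *\<^sub>R (indicator {..w} v * exp (l * v))
      = exp (l\<^sup>2 / 2) * (std_normal_density (v - l) * indicator {..w - l} (v - l))" for v
    using std_normal_density_tilt[of v l] by (simp add: indicator_def)
  have int: "integrable lborel (\<lambda>v. std_normal_density v * indicator {..w - l} v)"
    using integrable_mult_indicator[of "{..w - l}" lborel std_normal_density] by (simp add: mult.commute)
  have "integrable lborel (\<lambda>v. std_normal_density (v - l) * indicator {..w - l} (v - l))"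
    using lborel_integrable_real_affine[OF int, of 1 "- l"] by simp
  moreover have "(\<integral>v. std_normal_density (v - l) * indicator {..w - l} (v - l) \<partial>lborel) = Phi (w - l)"
    unfolding Phi_eq_integral
    by (subst (2) lborel_integral_real_affine[where c = 1 and t = "- l"]) simp_all
  ultimately have "has_bochner_integral lborel (\<lambda>v. std_normal_density v *\<^sub>R (indicator {..w} v * exp (l * v))) (exp (l\<^sup>2 / 2) * Phi (w - l))"
    unfolding eq by (intro has_bochner_integral_mult_right) (simp add: has_bochner_integral_iff)
  then show ?thesis by (intro has_bochner_integral_density) auto
qed

text \<open>The distribution function, for \<open>x > 0\<close>, of the maximum of one projected
  path. For \<sigma> = 0 both arguments are infinite, and it becomes 1 - exp (- 2 x^2).\<close>

definition max_cdf :: "real \<Rightarrow> real \<Rightarrow> real" where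
  "max_cdf \<sigma> x = Phi_ereal (quot 1 \<sigma>) x - exp (- (2 * (1 - \<sigma>\<^sup>2)) * x\<^sup>2) * Phi_ereal (quot (1 - 2 * \<sigma>\<^sup>2) \<sigma>) x"

text \<open>The endpoint is \<sigma> v with v standard normal. Nonnegativity of the value is stated
  as well, because it allows an equation between extended nonnegative reals to be read back in the
  reals.\<close>

lemma bridge_mixture:
  assumes x: "x > 0" and \<sigma>: "\<sigma> \<ge> 0"
  shows "(\<integral>\<^sup>+v. ennreal (if \<sigma> * v < x then 1 - exp (- 2 * x * (x - \<sigma> * v)) else 0) \<partial>std_normal_distribution) = ennreal (max_cdf \<sigma> x)
    \<and> 0 \<le> max_cdf \<sigma> x"
proof (cases "\<sigma> = 0")
  case True
  interpret real_distribution std_normal_distribution by (rule real_dist_normal_dist)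
  have "emeasure std_normal_distribution UNIV = 1" using emeasure_space_1 by simp
  then have "(\<integral>\<^sup>+v. ennreal (if \<sigma> * v < x then 1 - exp (- 2 * x * (x - \<sigma> * v)) else 0) \<partial>std_normal_distribution)
      = ennreal (1 - exp (- 2 * x * x))"
    using True x by (simp add: nn_integral_const)
  moreover have "max_cdf \<sigma> x = 1 - exp (- 2 * x * x)"
    using True by (simp add: max_cdf_def quot_def Phi_ereal_def power2_eq_square mult.assoc)
  ultimately show ?thesis using x by simp
next
  case False
  then have pos: "\<sigma> > 0" using \<sigma> by simp
  define w where "w = x / \<sigma>" define l where "l = 2 * x * \<sigma>"
  interpret real_distribution std_normal_distribution by (rule real_dist_normal_dist)
  \<comment> \<open>At \<open>v = w\<close> the right-hand side is 1 - 1, in agreement with the case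
    distinction, so the closed ray may replace the open one.\<close>
  have f: "(if \<sigma> * v < x then 1 - exp (- 2 * x * (x - \<sigma> * v)) else 0)
      = indicator {..w} v - exp (- 2 * x\<^sup>2) * (indicator {..w} v * exp (l * v))" for v
  proof -
    have "exp (- 2 * x * (x - \<sigma> * v)) = exp (- 2 * x\<^sup>2) * exp (l * v)"
      unfolding exp_add[symmetric] by (simp add: l_def algebra_simps power2_eq_square)
    moreover have "\<sigma> * v < x \<longleftrightarrow> v < w" "\<sigma> * v = x \<longleftrightarrow> v = w" using pos by (auto simp: w_def field_simps)
    moreover have "exp (- 2 * x\<^sup>2) * exp (l * w) = 1"
      unfolding exp_add[symmetric] using pos by (simp add: l_def w_def power2_eq_square)
    ultimately show ?thesis by (cases "v = w") (auto simp: indicator_def)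
  qed
  have "has_bochner_integral std_normal_distribution (\<lambda>v. indicator {..w} v :: real) (Phi w)"
    unfolding Phi_def
    by (rule has_bochner_integral_real_indicator) (simp_all flip: less_top)
  then have "has_bochner_integral std_normal_distribution
      (\<lambda>v. if \<sigma> * v < x then 1 - exp (- 2 * x * (x - \<sigma> * v)) else 0)
      (Phi w - exp (- 2 * x\<^sup>2) * (exp (l\<^sup>2 / 2) * Phi (w - l)))"
    unfolding f by (intro has_bochner_integral_diff has_bochner_integral_mult_right tilted_normal_cdf)
  moreover have "Phi w - exp (- 2 * x\<^sup>2) * (exp (l\<^sup>2 / 2) * Phi (w - l)) = max_cdf \<sigma> x"
  proof -
    have "exp (- 2 * x\<^sup>2) * exp (l\<^sup>2 / 2) = exp (- (2 * (1 - \<sigma>\<^sup>2)) * x\<^sup>2)"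
      unfolding exp_add[symmetric] by (simp add: l_def power_mult_distrib algebra_simps)
    moreover have "w - l = (1 - 2 * \<sigma>\<^sup>2) / \<sigma> * x"
      using pos by (simp add: w_def l_def field_simps power2_eq_square)
    ultimately show ?thesis
      using pos by (simp add: max_cdf_def quot_def Phi_ereal_def w_def mult.assoc[symmetric])
  qed
  moreover have "AE v in std_normal_distribution. 0 \<le> (if \<sigma> * v < x then 1 - exp (- 2 * x * (x - \<sigma> * v)) else 0)"
    using x by (intro AE_I2) auto
  ultimately show ?thesis
    using integral_nonneg_AE[of "\<lambda>v. if \<sigma> * v < x then 1 - exp (- 2 * x * (x - \<sigma> * v)) else 0" std_normal_distribution]
    by (simp add: has_bochner_integral_iff nn_integral_eq_integral)
qed

lemma (in prob_space) path_rv_in_space: "path_rv X \<omega> \<in> space path_space"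
  by (auto simp: path_rv_def space_PiM)

lemma (in prob_space) endpoint_bridge_props:
  assumes X: "gaussian_endpoint_bridge M \<sigma> X"
  shows "t \<in> {0..1} \<Longrightarrow> X t \<in> borel_measurable M"
    and "\<omega> \<in> space M \<Longrightarrow> continuous_on {0..1} (\<lambda>t. X t \<omega>)"
    and "norm u = 1 \<Longrightarrow> AE \<omega> in M. X 0 \<omega> \<bullet> u = 0"
proof -
  obtain B Z where B: "planar_brownian_bridge M B" and Z: "std_gaussian_vector M Z"
    and eq: "\<And>t \<omega>. t \<in> {0..1} \<Longrightarrow> \<omega> \<in> space M \<Longrightarrow> X t \<omega> = B t \<omega> + (\<sigma> * t) *\<^sub>R Z \<omega>"
    using X unfolding gaussian_endpoint_bridge_def by blast
  have [measurable]: "Z \<in> borel_measurable M"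
    using std_gaussian_vector_inner(1)[OF Z norm_direction[of 0]] .
  show "X t \<in> borel_measurable M" if "t \<in> {0..1}"
  proof -
    have "B t \<in> borel_measurable M" using B that by (simp add: planar_brownian_bridge_def gaussian_process_def)
    then have "(\<lambda>\<omega>. B t \<omega> + (\<sigma> * t) *\<^sub>R Z \<omega>) \<in> borel_measurable M" by measurable
    then show ?thesis using measurable_cong[of M "X t" "\<lambda>\<omega>. B t \<omega> + (\<sigma> * t) *\<^sub>R Z \<omega>"] eq[OF that] by simp
  qed
  show "continuous_on {0..1} (\<lambda>t. X t \<omega>)" if "\<omega> \<in> space M"
  proof -
    have "continuous_on {0..1} (\<lambda>t. B t \<omega>)" using B that by (simp add: planar_brownian_bridge_def)
    then have "continuous_on {0..1} (\<lambda>t. B t \<omega> + (\<sigma> * t) *\<^sub>R Z \<omega>)" by (intro continuous_intros)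
    then show ?thesis by (rule continuous_on_eq) (simp add: eq that)
  qed
  show "AE \<omega> in M. X 0 \<omega> \<bullet> u = 0" if "norm u = 1"
    using planar_bridge_start[OF B that] AE_space by eventually_elim (simp add: eq)
qed

text \<open>The law of the pair (Gaussian vector, bridge path) is a product. Fixing the vector z
  leaves the bridge below a line with endpoint \<sigma> times the projection of z; that projection
  is standard normal, so the outer integral is \<open>bridge_mixture\<close>.\<close>

lemma (in prob_space) endpoint_bridge_max_cdf:
  assumes X: "gaussian_endpoint_bridge M \<sigma> X" and u: "norm u = 1" and x: "x > 0" and \<sigma>: "\<sigma> \<ge> 0"
  shows "prob {\<omega> \<in> space M. \<forall>t\<in>{0..1}. X t \<omega> \<bullet> u \<le> x} = max_cdf \<sigma> x"
proof -
  obtain B Z where B: "planar_brownian_bridge M B" and Z: "std_gaussian_vector M Z"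
    and ind: "indep_rvs M path_space (path_rv B) borel Z"
    and eq: "\<And>t \<omega>. t \<in> {0..1} \<Longrightarrow> \<omega> \<in> space M \<Longrightarrow> X t \<omega> = B t \<omega> + (\<sigma> * t) *\<^sub>R Z \<omega>"
    using X unfolding gaussian_endpoint_bridge_def by blast
  note pm = indep_rvs_distr_pair[OF ind]
  note Zm [measurable] = pm(2)
  note Bm [measurable] = pm(1)
  define p where "p = (\<lambda>y. if y < x then 1 - exp (- 2 * x * (x - y)) else 0)"
  define S where "S = {q \<in> space (borel \<Otimes>\<^sub>M path_space). \<forall>t\<in>\<rat> \<inter> {0..1}. snd q t \<bullet> u + (\<sigma> * (fst q \<bullet> u)) * t \<le> x}"
  have S [measurable]: "S \<in> sets (borel \<Otimes>\<^sub>M path_space)"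
    unfolding S_def
  proof (rule sets_Ball_unit_Rats)
    fix t :: real assume t: "t \<in> \<rat> \<inter> {0..1}"
    then have "(\<lambda>q. snd q t) \<in> borel_measurable (borel \<Otimes>\<^sub>M path_space)"
      by (intro measurable_compose[OF measurable_snd measurable_component_singleton]) auto
    then have [measurable]: "(\<lambda>q. snd q t \<bullet> u) \<in> borel_measurable (borel \<Otimes>\<^sub>M path_space)" by measurable
    show "{q \<in> space (borel \<Otimes>\<^sub>M path_space). snd q t \<bullet> u + (\<sigma> * (fst q \<bullet> u)) * t \<le> x} \<in> sets (borel \<Otimes>\<^sub>M path_space)"
      by measurable
  qed
  have contB: "continuous_on {0..1} (\<lambda>t. B t \<omega>)" if "\<omega> \<in> space M" for \<omega>
    using B that by (simp add: planar_brownian_bridge_def)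
  have mem: "(z, path_rv B \<omega>) \<in> S \<longleftrightarrow> (\<forall>t\<in>{0..1}. B t \<omega> \<bullet> u + (\<sigma> * (z \<bullet> u)) * t \<le> x)" if "\<omega> \<in> space M" for z \<omega>
  proof -
    have "(\<forall>t\<in>{0..1}. B t \<omega> \<bullet> u + (\<sigma> * (z \<bullet> u)) * t \<le> x) \<longleftrightarrow> (\<forall>t\<in>\<rat> \<inter> {0..1}. B t \<omega> \<bullet> u + (\<sigma> * (z \<bullet> u)) * t \<le> x)"
      using contB[OF that] by (intro ball_unit_interval_Rats continuous_intros)
    moreover have "path_rv B \<omega> t = B t \<omega>" if "t \<in> \<rat> \<inter> {0..1}" for t using that by (simp add: path_rv_def)
    ultimately show ?thesis by (simp add: S_def space_pair_measure path_rv_in_space)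
  qed
  interpret D: prob_space "distr M path_space (path_rv B)" by (rule prob_space_distr[OF Bm])
  have slice: "emeasure (distr M path_space (path_rv B)) (Pair z -` S) = ennreal (p (\<sigma> * (z \<bullet> u)))" for z
  proof -
    have "emeasure (distr M path_space (path_rv B)) (Pair z -` S) = emeasure M (path_rv B -` (Pair z -` S) \<inter> space M)"
      by (rule emeasure_distr[OF Bm sets_Pair1[OF S]])
    also have "path_rv B -` (Pair z -` S) \<inter> space M = {\<omega> \<in> space M. \<forall>t\<in>{0..1}. B t \<omega> \<bullet> u + (\<sigma> * (z \<bullet> u)) * t \<le> x}"
      using mem by auto
    finally show ?thesis
      unfolding emeasure_eq_measure bridge_below_line(2)[OF B u x] p_def .
  qed
  have "{\<omega> \<in> space M. \<forall>t\<in>{0..1}. X t \<omega> \<bullet> u \<le> x} = (\<lambda>\<omega>. (Z \<omega>, path_rv B \<omega>)) -` S \<inter> space M"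
  proof -
    have "(\<forall>t\<in>{0..1}. X t \<omega> \<bullet> u \<le> x) \<longleftrightarrow> (\<forall>t\<in>{0..1}. B t \<omega> \<bullet> u + (\<sigma> * (Z \<omega> \<bullet> u)) * t \<le> x)" if "\<omega> \<in> space M" for \<omega>
      using eq[OF _ that] by (simp add: inner_add_left mult_ac)
    then show ?thesis using mem by auto
  qed
  then have "emeasure M {\<omega> \<in> space M. \<forall>t\<in>{0..1}. X t \<omega> \<bullet> u \<le> x} = emeasure (distr M (borel \<Otimes>\<^sub>M path_space) (\<lambda>\<omega>. (Z \<omega>, path_rv B \<omega>))) S"
    by (simp add: emeasure_distr)
  also have "\<dots> = (\<integral>\<^sup>+z. emeasure (distr M path_space (path_rv B)) (Pair z -` S) \<partial>distr M borel Z)"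
    unfolding pm(3)[symmetric] by (rule D.emeasure_pair_measure_alt) (use S in simp)
  also have "\<dots> = (\<integral>\<^sup>+z. ennreal (p (\<sigma> * (z \<bullet> u))) \<partial>distr M borel Z)"
    unfolding slice ..
  also have "\<dots> = (\<integral>\<^sup>+\<omega>. ennreal (p (\<sigma> * (Z \<omega> \<bullet> u))) \<partial>M)"
    by (rule nn_integral_distr) (auto simp: p_def)
  also have "\<dots> = (\<integral>\<^sup>+v. ennreal (p (\<sigma> * v)) \<partial>distr M borel (\<lambda>\<omega>. Z \<omega> \<bullet> u))"
    by (rule nn_integral_distr[symmetric]) (auto simp: p_def)
  also have "\<dots> = ennreal (max_cdf \<sigma> x)"
    unfolding std_gaussian_vector_inner(2)[OF Z u] p_def by (rule conjunct1[OF bridge_mixture[OF x \<sigma>]])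
  finally have "ennreal (prob {\<omega> \<in> space M. \<forall>t\<in>{0..1}. X t \<omega> \<bullet> u \<le> x}) = ennreal (max_cdf \<sigma> x)"
    by (simp add: emeasure_eq_measure)
  then show ?thesis using conjunct2[OF bridge_mixture[OF x \<sigma>]] by simp
qed

section \<open>Mean support function and perimeter\<close>

text \<open>The region below the graph of \<open>h\<close> is measured in both orders. The law of
  the maximum is known only for \<open>x > 0\<close>, so \<open>g\<close> is unconstrained
  elsewhere, and the point 0 is treated as a null set.\<close>

lemma (in prob_space) expectation_layer_cake:
  assumes h [measurable]: "h \<in> borel_measurable M" and nn: "AE \<omega> in M. 0 \<le> h \<omega>"
    and g: "\<And>x. x > 0 \<Longrightarrow> prob {\<omega> \<in> space M. h \<omega> \<le> x} = 1 - g x"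
    and V: "has_bochner_integral lborel (\<lambda>x. indicator {0..} x * g x) V"
  shows "has_bochner_integral M h V"
proof (rule has_bochner_integral_nn_integral[OF h nn])
  have AE0: "AE x in lborel. x \<noteq> (0::real)" by (rule AE_lborel_singleton)
  have gnn: "AE x in lborel. 0 \<le> indicator {0..} x * g x"
    using AE0
  proof eventually_elim
    case (elim x)
    show ?case
    proof (cases "x > 0")
      case True
      have "prob {\<omega> \<in> space M. h \<omega> \<le> x} \<le> 1" by simp
      then show ?thesis using g[OF True] True by simp
    qed (use elim in \<open>simp add: indicator_def\<close>)
  qed
  have "V = (\<integral>x. indicator {0..} x * g x \<partial>lborel)" using V by (simp add: has_bochner_integral_iff)
  then show "0 \<le> V" using gnn by (simp add: integral_nonneg_AE)
  let ?A = "{p \<in> space (M \<Otimes>\<^sub>M lborel). 0 \<le> snd p \<and> snd p < h (fst p)}"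
  have A [measurable]: "?A \<in> sets (M \<Otimes>\<^sub>M lborel)" by measurable
  have "(\<integral>\<^sup>+\<omega>. ennreal (h \<omega>) \<partial>M) = (\<integral>\<^sup>+\<omega>. \<integral>\<^sup>+x. indicator ?A (\<omega>, x) \<partial>lborel \<partial>M)"
  proof (rule nn_integral_cong)
    fix \<omega> assume "\<omega> \<in> space M"
    then have "(\<integral>\<^sup>+x. indicator ?A (\<omega>, x) \<partial>lborel) = (\<integral>\<^sup>+x. indicator {0..<h \<omega>} x \<partial>lborel)"
      by (intro nn_integral_cong) (auto simp: indicator_def space_pair_measure)
    also have "\<dots> = ennreal (h \<omega>)" by (cases "0 \<le> h \<omega>") (auto simp: ennreal_neg)
    finally show "ennreal (h \<omega>) = (\<integral>\<^sup>+x. indicator ?A (\<omega>, x) \<partial>lborel)" by simp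
  qed
  also have "\<dots> = (\<integral>\<^sup>+x. \<integral>\<^sup>+\<omega>. indicator ?A (\<omega>, x) \<partial>M \<partial>lborel)"
  proof -
    interpret pair_sigma_finite M lborel by unfold_locales
    show ?thesis by (rule Fubini'[symmetric]) measurable
  qed
  also have "\<dots> = (\<integral>\<^sup>+x. ennreal (indicator {0..} x * g x) \<partial>lborel)"
  proof (rule nn_integral_cong_AE)
    show "AE x in lborel. (\<integral>\<^sup>+\<omega>. indicator ?A (\<omega>, x) \<partial>M) = ennreal (indicator {0..} x * g x)"
      using AE0
    proof eventually_elim
      case (elim x)
      show ?case
      proof (cases "x > 0")
        case True
        have "(\<integral>\<^sup>+\<omega>. indicator ?A (\<omega>, x) \<partial>M) = (\<integral>\<^sup>+\<omega>. indicator (space M - {\<omega> \<in> space M. h \<omega> \<le> x}) \<omega> \<partial>M)"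
          using True by (intro nn_integral_cong) (auto simp: indicator_def space_pair_measure)
        also have "\<dots> = emeasure M (space M - {\<omega> \<in> space M. h \<omega> \<le> x})" by (rule nn_integral_indicator) measurable
        also have "\<dots> = ennreal (1 - prob {\<omega> \<in> space M. h \<omega> \<le> x})"
          unfolding emeasure_eq_measure by (subst prob_compl) auto
        finally show ?thesis using g[OF True] True by simp
      next
        case False
        then have "indicator ?A (\<omega>, x) = (0 :: ennreal)" for \<omega> using elim by (simp add: indicator_def)
        then show ?thesis using False elim by (simp add: indicator_def)
      qed
    qed
  qed
  also have "\<dots> = ennreal V"
    using V gnn by (simp add: has_bochner_integral_iff nn_integral_eq_integral)
  finally show "(\<integral>\<^sup>+\<omega>. ennreal (h \<omega>) \<partial>M) = ennreal V" .
qed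

lemma hull_of_paths_support:
  assumes "continuous_on {0..1} (\<lambda>t. X t \<omega>)" "continuous_on {0..1} (\<lambda>t. Y t \<omega>)"
  shows "compact (hull_of_paths X Y \<omega>)" "hull_of_paths X Y \<omega> \<noteq> {}"
    and "support (hull_of_paths X Y \<omega>) u \<le> x \<longleftrightarrow> (\<forall>t\<in>{0..1}. X t \<omega> \<bullet> u \<le> x) \<and> (\<forall>t\<in>{0..1}. Y t \<omega> \<bullet> u \<le> x)"
proof -
  let ?S = "(\<lambda>t. X t \<omega>) ` {0..1} \<union> (\<lambda>t. Y t \<omega>) ` {0..1}"
  have K: "compact (convex hull ?S)"
    using assms by (intro compact_convex_hull compact_Un compact_continuous_image) auto
  have ne: "convex hull ?S \<noteq> {}" by simp
  from K ne show "compact (hull_of_paths X Y \<omega>)" "hull_of_paths X Y \<omega> \<noteq> {}"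
    unfolding hull_of_paths_def by blast+
  have "support (convex hull ?S) u \<le> x \<longleftrightarrow> (\<forall>y\<in>?S. y \<bullet> u \<le> x)"
  proof
    assume le: "support (convex hull ?S) u \<le> x"
    show "\<forall>y\<in>?S. y \<bullet> u \<le> x"
    proof
      fix y assume "y \<in> ?S"
      then have "y \<in> convex hull ?S" by (rule hull_inc)
      from inner_le_support[OF K ne this, of u] le show "y \<bullet> u \<le> x" by linarith
    qed
  next
    assume le: "\<forall>y\<in>?S. y \<bullet> u \<le> x"
    have "convex hull ?S \<subseteq> {y. y \<bullet> u \<le> x}"
    proof (rule hull_minimal)
      show "convex {y. y \<bullet> u \<le> x}" using convex_halfspace_le[of u x] by (simp add: inner_commute)
    qed (use le in blast)
    then show "support (convex hull ?S) u \<le> x" by (intro support_leI[OF K ne]) blast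
  qed
  then show "support (hull_of_paths X Y \<omega>) u \<le> x \<longleftrightarrow> (\<forall>t\<in>{0..1}. X t \<omega> \<bullet> u \<le> x) \<and> (\<forall>t\<in>{0..1}. Y t \<omega> \<bullet> u \<le> x)"
    unfolding hull_of_paths_def by blast
qed

text \<open>In the product the Gaussian rates add, which gives 2 (2 - \<sigma>1^2 - \<sigma>2^2). A
  rate can vanish only if its parameters are all 1, and then each corresponding last argument is -1,
  so the four integrals converge separately.\<close>

lemma integral_max_cdf:
  assumes "\<sigma>1 \<in> {0..1}" "\<sigma>2 \<in> {0..1}"
  shows "has_bochner_integral lborel (\<lambda>x. indicator {0..} x * (1 - max_cdf \<sigma>1 x * max_cdf \<sigma>2 x))
    (I1 (quot 1 \<sigma>1) (quot 1 \<sigma>2)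
      + G (2 * (1 - \<sigma>2\<^sup>2)) (quot 1 \<sigma>1) (quot (1 - 2 * \<sigma>2\<^sup>2) \<sigma>2)
      + G (2 * (1 - \<sigma>1\<^sup>2)) (quot 1 \<sigma>2) (quot (1 - 2 * \<sigma>1\<^sup>2) \<sigma>1)
      - G (2 * (2 - \<sigma>1\<^sup>2 - \<sigma>2\<^sup>2)) (quot (1 - 2 * \<sigma>1\<^sup>2) \<sigma>1) (quot (1 - 2 * \<sigma>2\<^sup>2) \<sigma>2))"
proof -
  let ?p = "\<lambda>s. Phi_ereal (quot 1 s)" and ?q = "\<lambda>s. Phi_ereal (quot (1 - 2 * s\<^sup>2) s)"
  have quot_pos: "0 < quot 1 s" "quot 1 s \<noteq> 0" "quot 1 s \<noteq> - \<infinity>" if "s \<in> {0..1}" for s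
    using that by (auto simp: quot_def zero_ereal_def)
  have quot_one: "quot (1 - 2 * s\<^sup>2) s < 0" "quot (1 - 2 * s\<^sup>2) s \<noteq> 0" "quot (1 - 2 * s\<^sup>2) s \<noteq> - \<infinity>" if "s = 1" for s
    using that by (auto simp: quot_def zero_ereal_def)
  have sq: "s\<^sup>2 < 1 \<or> s = 1" if "s \<in> {0..1}" for s :: real
    using that power_strict_mono[of s 1 2] by fastforce
  have cond: "0 < 2 * (1 - s\<^sup>2) \<or> 2 * (1 - s\<^sup>2) = 0 \<and> quot 1 r \<noteq> 0 \<and> quot 1 r \<noteq> - \<infinity>
      \<and> quot (1 - 2 * s\<^sup>2) s < 0 \<and> quot (1 - 2 * s\<^sup>2) s \<noteq> - \<infinity>" if "s \<in> {0..1}" "r \<in> {0..1}" for s r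
    using sq[OF that(1)] quot_pos[OF that(2)] quot_one[of s] by auto
  have cond2: "0 < 2 * (2 - \<sigma>1\<^sup>2 - \<sigma>2\<^sup>2) \<or> 2 * (2 - \<sigma>1\<^sup>2 - \<sigma>2\<^sup>2) = 0
      \<and> quot (1 - 2 * \<sigma>1\<^sup>2) \<sigma>1 \<noteq> 0 \<and> quot (1 - 2 * \<sigma>1\<^sup>2) \<sigma>1 \<noteq> - \<infinity>
      \<and> quot (1 - 2 * \<sigma>2\<^sup>2) \<sigma>2 < 0 \<and> quot (1 - 2 * \<sigma>2\<^sup>2) \<sigma>2 \<noteq> - \<infinity>"
    using sq[OF assms(1)] sq[OF assms(2)] quot_one[of \<sigma>1] quot_one[of \<sigma>2] by auto
  have eq: "indicator {0..} x * (1 - max_cdf \<sigma>1 x * max_cdf \<sigma>2 x)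
      = indicator {0..} x * (1 - ?p \<sigma>1 x * ?p \<sigma>2 x)
        + indicator {0..} x * (exp (- (2 * (1 - \<sigma>2\<^sup>2)) * x\<^sup>2) * (?p \<sigma>1 x * ?q \<sigma>2 x))
        + indicator {0..} x * (exp (- (2 * (1 - \<sigma>1\<^sup>2)) * x\<^sup>2) * (?p \<sigma>2 x * ?q \<sigma>1 x))
        - indicator {0..} x * (exp (- (2 * (2 - \<sigma>1\<^sup>2 - \<sigma>2\<^sup>2)) * x\<^sup>2) * (?q \<sigma>1 x * ?q \<sigma>2 x))" for x
  proof -
    have "- (2 * (2 - \<sigma>1\<^sup>2 - \<sigma>2\<^sup>2)) * x\<^sup>2 = - (2 * (1 - \<sigma>1\<^sup>2)) * x\<^sup>2 + - (2 * (1 - \<sigma>2\<^sup>2)) * x\<^sup>2"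
      by (simp add: algebra_simps)
    then have e: "exp (- (2 * (2 - \<sigma>1\<^sup>2 - \<sigma>2\<^sup>2)) * x\<^sup>2) = exp (- (2 * (1 - \<sigma>1\<^sup>2)) * x\<^sup>2) * exp (- (2 * (1 - \<sigma>2\<^sup>2)) * x\<^sup>2)"
      by (simp only: exp_add)
    have "i * (1 - (p1 - e1 * q1) * (p2 - e2 * q2))
        = i * (1 - p1 * p2) + i * (e2 * (p1 * q2)) + i * (e1 * (p2 * q1)) - i * (e1 * e2 * (q1 * q2))"
      for i p1 p2 q1 q2 e1 e2 :: real by (simp add: algebra_simps)
    then show ?thesis unfolding max_cdf_def e .
  qed
  show ?thesis
    unfolding eq
    by (intro has_bochner_integral_diff has_bochner_integral_add integral_I1 integral_G quot_pos cond cond2 assms)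
qed

text \<open>Joint measurability in direction and sample point is what the exchange of integrals
  requires. A bound on the support function is a bound on both paths at rational times.\<close>

lemma (in prob_space) hull_support_measurable:
  assumes X1: "gaussian_endpoint_bridge M \<sigma>1 X1" and X2: "gaussian_endpoint_bridge M \<sigma>2 X2"
  shows "(\<lambda>p. support (hull_of_paths X1 X2 (snd p)) (direction (fst p))) \<in> borel_measurable (lborel \<Otimes>\<^sub>M M)"
  unfolding borel_measurable_iff_le
proof
  fix x
  let ?N = "lborel \<Otimes>\<^sub>M M :: (real \<times> 'a) measure"
  note c1 = endpoint_bridge_props(2)[OF X1] and c2 = endpoint_bridge_props(2)[OF X2]
  have "{p \<in> space ?N. support (hull_of_paths X1 X2 (snd p)) (direction (fst p)) \<le> x}
      = {p \<in> space ?N. \<forall>t\<in>\<rat> \<inter> {0..1}. X1 t (snd p) \<bullet> direction (fst p) \<le> x}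
        \<inter> {p \<in> space ?N. \<forall>t\<in>\<rat> \<inter> {0..1}. X2 t (snd p) \<bullet> direction (fst p) \<le> x}"
  proof -
    have "support (hull_of_paths X1 X2 (snd p)) (direction (fst p)) \<le> x \<longleftrightarrow>
        (\<forall>t\<in>\<rat> \<inter> {0..1}. X1 t (snd p) \<bullet> direction (fst p) \<le> x) \<and> (\<forall>t\<in>\<rat> \<inter> {0..1}. X2 t (snd p) \<bullet> direction (fst p) \<le> x)"
      if "p \<in> space ?N" for p
    proof -
      have \<omega>: "snd p \<in> space M" using that by (auto simp: space_pair_measure)
      have "continuous_on {0..1} (\<lambda>t. X1 t (snd p) \<bullet> direction (fst p))"
        using c1[OF \<omega>] by (intro continuous_intros)
      moreover have "continuous_on {0..1} (\<lambda>t. X2 t (snd p) \<bullet> direction (fst p))"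
        using c2[OF \<omega>] by (intro continuous_intros)
      ultimately have "continuous_on {0..1} (\<lambda>t. X1 t (snd p) \<bullet> direction (fst p))"
        "continuous_on {0..1} (\<lambda>t. X2 t (snd p) \<bullet> direction (fst p))" .
      from this[THEN ball_unit_interval_Rats, of x] show ?thesis
        unfolding hull_of_paths_support(3)[of X1 _ X2, OF c1[OF \<omega>] c2[OF \<omega>]] by (rule conj_cong)
    qed
    then show ?thesis by blast
  qed
  also have "\<dots> \<in> sets ?N"
  proof (rule sets.Int; rule sets_Ball_unit_Rats)
    have [measurable]: "direction \<in> borel_measurable borel"
      by (intro borel_measurable_continuous_onI continuous_on_direction)
    fix t :: real assume "t \<in> \<rat> \<inter> {0..1}"
    then have [measurable]: "X1 t \<in> borel_measurable M" "X2 t \<in> borel_measurable M"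
      using endpoint_bridge_props(1)[OF X1] endpoint_bridge_props(1)[OF X2] by auto
    show "{p \<in> space ?N. X1 t (snd p) \<bullet> direction (fst p) \<le> x} \<in> sets ?N" by measurable
    show "{p \<in> space ?N. X2 t (snd p) \<bullet> direction (fst p) \<le> x} \<in> sets ?N" by measurable
  qed
  finally show "{p \<in> space ?N. support (hull_of_paths X1 X2 (snd p)) (direction (fst p)) \<le> x} \<in> sets ?N" .
qed

text \<open>A closed half plane contains the hull exactly if it contains both paths, and these two
  events are independent.\<close>

lemma (in prob_space) hull_support_cdf:
  assumes X1: "gaussian_endpoint_bridge M \<sigma>1 X1" and X2: "gaussian_endpoint_bridge M \<sigma>2 X2"
    and ind: "indep_var path_space (path_rv X1) path_space (path_rv X2)"
    and \<sigma>: "\<sigma>1 \<ge> 0" "\<sigma>2 \<ge> 0" and u: "norm u = 1" and x: "x > 0"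
  shows "prob {\<omega> \<in> space M. support (hull_of_paths X1 X2 \<omega>) u \<le> x} = max_cdf \<sigma>1 x * max_cdf \<sigma>2 x"
proof -
  note c1 = endpoint_bridge_props(2)[OF X1] and c2 = endpoint_bridge_props(2)[OF X2]
  define A where "A = {f \<in> space path_space. \<forall>t\<in>\<rat> \<inter> {0..1}. f t \<bullet> u \<le> x}"
  have A: "A \<in> sets path_space"
    unfolding A_def
  proof (rule sets_Ball_unit_Rats)
    fix t :: real assume "t \<in> \<rat> \<inter> {0..1}"
    then have [measurable]: "(\<lambda>f. f t) \<in> borel_measurable path_space"
      by (intro measurable_component_singleton) auto
    show "{f \<in> space path_space. f t \<bullet> u \<le> x} \<in> sets path_space" by measurable
  qed
  have mem: "path_rv X \<omega> \<in> A \<longleftrightarrow> (\<forall>t\<in>{0..1}. X t \<omega> \<bullet> u \<le> x)" if "continuous_on {0..1} (\<lambda>t. X t \<omega>)" for X \<omega>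
  proof -
    have "(\<forall>t\<in>{0..1}. X t \<omega> \<bullet> u \<le> x) \<longleftrightarrow> (\<forall>t\<in>\<rat> \<inter> {0..1}. X t \<omega> \<bullet> u \<le> x)"
      using that by (intro ball_unit_interval_Rats continuous_intros)
    moreover have "path_rv X \<omega> t = X t \<omega>" if "t \<in> \<rat> \<inter> {0..1}" for t using that by (simp add: path_rv_def)
    ultimately show ?thesis by (simp add: A_def path_rv_in_space)
  qed
  have mem1: "path_rv X1 \<omega> \<in> A \<longleftrightarrow> (\<forall>t\<in>{0..1}. X1 t \<omega> \<bullet> u \<le> x)"
    and mem2: "path_rv X2 \<omega> \<in> A \<longleftrightarrow> (\<forall>t\<in>{0..1}. X2 t \<omega> \<bullet> u \<le> x)" if "\<omega> \<in> space M" for \<omega>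
    using mem[of X1 \<omega>, OF c1[OF that]] mem[of X2 \<omega>, OF c2[OF that]] .
  have "{\<omega> \<in> space M. support (hull_of_paths X1 X2 \<omega>) u \<le> x} = (\<lambda>\<omega>. (path_rv X1 \<omega>, path_rv X2 \<omega>)) -` (A \<times> A) \<inter> space M"
    by (auto simp: hull_of_paths_support(3)[of X1 _ X2, OF c1 c2] mem1 mem2)
  then have "prob {\<omega> \<in> space M. support (hull_of_paths X1 X2 \<omega>) u \<le> x}
      = prob (path_rv X1 -` A \<inter> space M) * prob (path_rv X2 -` A \<inter> space M)"
    using indep_varD[OF ind A A] by simp
  also have "path_rv X1 -` A \<inter> space M = {\<omega> \<in> space M. \<forall>t\<in>{0..1}. X1 t \<omega> \<bullet> u \<le> x}" by (auto simp: mem1)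
  also have "path_rv X2 -` A \<inter> space M = {\<omega> \<in> space M. \<forall>t\<in>{0..1}. X2 t \<omega> \<bullet> u \<le> x}" by (auto simp: mem2)
  finally show ?thesis
    unfolding endpoint_bridge_max_cdf[OF X1 u x \<sigma>(1)] endpoint_bridge_max_cdf[OF X2 u x \<sigma>(2)] .
qed

text \<open>The mean support function takes the same value in every direction, so after exchanging
  the two integrals the factor 2 pi is the length of the interval of angles.\<close>

theorem theorem5p1:
  fixes M :: "'a measure"
    and X1 X2 :: "real \<Rightarrow> 'a \<Rightarrow> real^2"
    and \<sigma>1 \<sigma>2 :: real
  assumes "prob_space M"
    and "\<sigma>1 \<in> {0..1}" and "\<sigma>2 \<in> {0..1}"
    and "gaussian_endpoint_bridge M \<sigma>1 X1"
    and "gaussian_endpoint_bridge M \<sigma>2 X2"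
    and "prob_space.indep_var M path_space (path_rv X1) path_space (path_rv X2)"
  shows "integrable M (\<lambda>\<omega>. perim (hull_of_paths X1 X2 \<omega>)) \<and>
    (\<integral>\<omega>. perim (hull_of_paths X1 X2 \<omega>) \<partial>M) =
      2 * pi *
        (I1 (quot 1 \<sigma>1) (quot 1 \<sigma>2)
         + G (2 * (1 - \<sigma>2\<^sup>2)) (quot 1 \<sigma>1) (quot (1 - 2 * \<sigma>2\<^sup>2) \<sigma>2)
         + G (2 * (1 - \<sigma>1\<^sup>2)) (quot 1 \<sigma>2) (quot (1 - 2 * \<sigma>1\<^sup>2) \<sigma>1)
         - G (2 * (2 - \<sigma>1\<^sup>2 - \<sigma>2\<^sup>2)) (quot (1 - 2 * \<sigma>1\<^sup>2) \<sigma>1) (quot (1 - 2 * \<sigma>2\<^sup>2) \<sigma>2))"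
    (is "_ \<and> _ = 2 * pi * ?V")
proof -
  interpret prob_space M by fact
  interpret P: pair_sigma_finite lborel M by unfold_locales
  note X1 = assms(4) and X2 = assms(5) and ind = assms(6)
  define h where "h = (\<lambda>p. support (hull_of_paths X1 X2 (snd p)) (direction (fst p)))"
  have h_meas [measurable]: "h \<in> borel_measurable (lborel \<Otimes>\<^sub>M M)"
    unfolding h_def by (rule hull_support_measurable[OF X1 X2])
  have h_sec [measurable]: "(\<lambda>\<omega>. h (\<theta>, \<omega>)) \<in> borel_measurable M" for \<theta> by measurable
  note c1 = endpoint_bridge_props(2)[OF X1] and c2 = endpoint_bridge_props(2)[OF X2]
  have h_nn: "AE \<omega> in M. 0 \<le> h (\<theta>, \<omega>)" for \<theta>
    using endpoint_bridge_props(3)[OF X1 norm_direction[of \<theta>]] AE_space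
  proof eventually_elim
    case (elim \<omega>)
    have "(\<forall>t\<in>{0..1}. X1 t \<omega> \<bullet> direction \<theta> \<le> h (\<theta>, \<omega>))"
      using hull_of_paths_support(3)[of X1 \<omega> X2, OF c1 c2, OF elim(2) elim(2), of "direction \<theta>" "h (\<theta>, \<omega>)"]
      by (simp add: h_def)
    then have "X1 0 \<omega> \<bullet> direction \<theta> \<le> h (\<theta>, \<omega>)" by simp
    then show ?case using elim(1) by simp
  qed
  have mean: "has_bochner_integral M (\<lambda>\<omega>. h (\<theta>, \<omega>)) ?V" for \<theta>
  proof (rule expectation_layer_cake[OF h_sec h_nn _ integral_max_cdf[OF assms(2,3)]])
    show "prob {\<omega> \<in> space M. h (\<theta>, \<omega>) \<le> x} = 1 - (1 - max_cdf \<sigma>1 x * max_cdf \<sigma>2 x)" if "x > 0" for x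
      using hull_support_cdf[OF X1 X2 ind _ _ norm_direction that, of \<theta>] assms(2,3) by (simp add: h_def)
  qed
  \<comment> \<open>The range of angles is moved into the integrand, so that the product measure can
    be taken with Lebesgue measure on the whole line.\<close>
  define f where "f = (\<lambda>p. indicator {0..2 * pi} (fst p) * h p)"
  have f_meas [measurable]: "f \<in> borel_measurable (lborel \<Otimes>\<^sub>M M)" unfolding f_def by measurable
  have f_int: "has_bochner_integral M (\<lambda>\<omega>. f (\<theta>, \<omega>)) (indicator {0..2 * pi} \<theta> * ?V)" for \<theta>
    unfolding f_def fst_conv by (intro has_bochner_integral_mult_right mean)
  have ind_int: "integrable lborel (\<lambda>\<theta>. indicator {0..2 * pi} \<theta> * ?V)"
    by (intro integrable_mult_left) simp
  \<comment> \<open>For each fixed angle \<open>h\<close> is nonnegative almost surely, which is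
    enough to compute the integral of the norm and thereby obtain integrability on the
    product.\<close>
  have norm_f: "(\<integral>\<omega>. norm (f (\<theta>, \<omega>)) \<partial>M) = indicator {0..2 * pi} \<theta> * ?V" for \<theta>
  proof -
    have "(\<integral>\<omega>. norm (f (\<theta>, \<omega>)) \<partial>M) = (\<integral>\<omega>. f (\<theta>, \<omega>) \<partial>M)"
      using h_nn[of \<theta>] by (intro integral_cong_AE) (auto simp: f_def elim!: eventually_mono)
    then show ?thesis using f_int[of \<theta>] by (simp add: has_bochner_integral_iff)
  qed
  have F: "integrable (lborel \<Otimes>\<^sub>M M) f"
  proof (rule P.Fubini_integrable[OF f_meas])
    show "integrable lborel (\<lambda>\<theta>. \<integral>\<omega>. norm (f (\<theta>, \<omega>)) \<partial>M)" unfolding norm_f by (rule ind_int)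
    show "AE \<theta> in lborel. integrable M (\<lambda>\<omega>. f (\<theta>, \<omega>))"
      using f_int by (intro AE_I2) (auto simp: has_bochner_integral_iff)
  qed
  then have F': "integrable (lborel \<Otimes>\<^sub>M M) (case_prod (\<lambda>\<theta> \<omega>. f (\<theta>, \<omega>)))" by simp
  have perim: "perim (hull_of_paths X1 X2 \<omega>) = (\<integral>\<theta>. f (\<theta>, \<omega>) \<partial>lborel)" if "\<omega> \<in> space M" for \<omega>
  proof -
    note K = hull_of_paths_support(1,2)[of X1 \<omega> X2, OF c1[OF that] c2[OF that]]
    have "set_integrable lborel {0..2 * pi} (\<lambda>\<theta>. support (hull_of_paths X1 X2 \<omega>) (direction \<theta>))"
      by (intro borel_integrable_atLeastAtMost' continuous_on_support_direction K)
    from set_borel_integral_eq_integral(2)[OF this] show ?thesis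
      unfolding perim_eq_integral_support[OF K] by (simp add: f_def h_def set_lebesgue_integral_def)
  qed
  have "integrable M (\<lambda>\<omega>. \<integral>\<theta>. f (\<theta>, \<omega>) \<partial>lborel)" by (rule P.integrable_snd[OF F'])
  then have "integrable M (\<lambda>\<omega>. perim (hull_of_paths X1 X2 \<omega>))"
    by (rule Bochner_Integration.integrable_cong[THEN iffD2, rotated 2]) (simp_all add: perim)
  moreover have "(\<integral>\<omega>. perim (hull_of_paths X1 X2 \<omega>) \<partial>M) = 2 * pi * ?V"
  proof -
    have "(\<integral>\<omega>. perim (hull_of_paths X1 X2 \<omega>) \<partial>M) = (\<integral>\<omega>. (\<integral>\<theta>. f (\<theta>, \<omega>) \<partial>lborel) \<partial>M)"
      by (intro Bochner_Integration.integral_cong refl perim)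
    also have "\<dots> = (\<integral>\<theta>. (\<integral>\<omega>. f (\<theta>, \<omega>) \<partial>M) \<partial>lborel)" by (rule P.Fubini_integral[OF F'])
    also have "\<dots> = (\<integral>\<theta>. indicator {0..2 * pi} \<theta> * ?V \<partial>lborel)"
      using f_int by (intro Bochner_Integration.integral_cong refl) (simp add: has_bochner_integral_iff)
    also have "\<dots> = 2 * pi * ?V" by simp
    finally show ?thesis .
  qed
  ultimately show ?thesis by blast
qed

end
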